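(* Let $\Gamma$ be a subgroup of $\mathrm{PGL}_2(k)$ generated by finitely many elements $\gamma_1,\dots,\gamma_g$ ($g\ge 1$). If there exists a Schottky figure adapted to $(\gamma_1,\dots,\gamma_g)$, then $\Gamma$ is a Schottky group over $k$.
   Context: $(k,|\cdot|)$ is a complete non-Archimedean valued field and $k^a$ an algebraic closure of $k$ (with the unique extension of $|\cdot|$). The Berkovich affine line $\mathbb{A}^{1,\mathrm{an}}_k$ is the set of multiplicative seminorms $|\cdot|_x$ on $k[T]$ inducing $|\cdot|$ on $k$; one writes $|P(x)|=|P|_x$, and the topology is the coarsest making all maps $x\mapsto |P(x)|$ ($P\in k[T]$) continuous. The Berkovich projective line $\mathbb{P}^{1,\mathrm{an}}_k$ is obtained by gluing two affine lines with coordinates $T,T'$ along the complements of $0$ via $T'=1/T$; $\mathrm{PGL}_2(k)$ acts on it by Möbius transformations. For $\alpha\in k$, $r>0$, $D^-(\alpha,r)=\{x : |(T-\alpha)(x)|<r\}$ (open disc) and $D^+(\alpha,r)=\{x: |(T-\alpha)(x)|\le r\}$ (closed disc). Open (resp. closed) discs of $\mathbb{P}^{1,\mathrm{an}}_k$ are the images of these by elements of $\mathrm{PGL}_2(k)$. Schottky figure: let $\mathcal{B}=(D^+(\gamma_i^{\varepsilon}),\,1\le i\le g,\ \varepsilon\in\{\pm1\})$ be a family of pairwise disjoint closed discs in $\mathbb{P}^{1,\mathrm{an}}_k$ and set $D^-(\gamma_i^{\varepsilon}):=\gamma_i^{\varepsilon}(\mathbb{P}^{1,\mathrm{an}}_k\setminus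 D^+(\gamma_i^{-\varepsilon}))$. Then $\mathcal{B}$ is a Schottky figure adapted to $(\gamma_1,\dots,\gamma_g)$ if, for all $i$ and $\varepsilon$, $D^-(\gamma_i^{\varepsilon})$ is a maximal open disc inside $D^+(\gamma_i^{\varepsilon})$. A matrix in $\mathrm{GL}_2(k)$ is loxodromic if its eigenvalues in $k^a$ have distinct absolute values; an element of $\mathrm{PGL}_2(k)$ is loxodromic if some (equivalently every) representative is. A subgroup $\Gamma$ of $\mathrm{PGL}_2(k)$ is a Schottky group over $k$ if (i) it is free and finitely generated; (ii) all its non-trivial elements are loxodromic; (iii) there exists a non-empty $\Gamma$-invariant connected open subset of $\mathbb{P}^{1,\mathrm{an}}_k$ on which the action of $\Gamma$ is free and proper (the action of the discrete group $\Gamma$ on a space $E$ is proper if the map $\Gamma\times E\to E\times E$, $(\gamma,x)\mapsto(x,\gamma x)$ is proper). *)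

theory Defs
  imports
    "HOL-Analysis.Analysis"
    "HOL-Algebra.Generated_Groups"
    "HOL-Algebra.Coset"
    "HOL-Algebra.Algebraic_Closure_Type"
begin

section \<open>Valued fields\<close>

text \<open>The trivial absolute value is allowed.\<close>

definition nonarch_abs :: "('k::field \<Rightarrow> real) \<Rightarrow> bool" where
  "nonarch_abs av \<longleftrightarrow>
     (\<forall>a. 0 \<le> av a) \<and> (\<forall>a. av a = 0 \<longleftrightarrow> a = 0) \<and>
     (\<forall>a b. av (a * b) = av a * av b) \<and> (\<forall>a b. av (a + b) \<le> max (av a) (av b))"

definition complete_nonarch_abs :: "('k::field \<Rightarrow> real) \<Rightarrow> bool" where
  "complete_nonarch_abs av \<longleftrightarrow>
     nonarch_abs av \<and> Metric_space.mcomplete UNIV (\<lambda>a b. av (a - b))"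

definition extends_to_closure :: "('k::field \<Rightarrow> real) \<Rightarrow> ('k alg_closure \<Rightarrow> real) \<Rightarrow> bool" where
  "extends_to_closure av ava \<longleftrightarrow> nonarch_abs ava \<and> (\<forall>a. ava (to_ac a) = av a)"


section \<open>The Berkovich affine line\<close>

definition A1 :: "('k::field \<Rightarrow> real) \<Rightarrow> ('k poly \<Rightarrow> real) set" where
  "A1 av = {x. (\<forall>P. 0 \<le> x P) \<and> (\<forall>P Q. x (P + Q) \<le> x P + x Q) \<and>
               (\<forall>P Q. x (P * Q) = x P * x Q) \<and> (\<forall>a. x [:a:] = av a)}"

definition A1_top :: "('k::field \<Rightarrow> real) \<Rightarrow> ('k poly \<Rightarrow> real) topology" where
  "A1_top av = topology_generated_by {{x \<in> A1 av. x P \<in> U} | P U. open U}"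

definition eval_point :: "('k::field \<Rightarrow> real) \<Rightarrow> 'k \<Rightarrow> 'k poly \<Rightarrow> real" where
  "eval_point av a = (\<lambda>P. av (poly P a))"

text \<open>
  If \<open>x D \<noteq> 0\<close>, the seminorm \<open>x\<close> extends to quotients with denominator a power of \<open>D\<close>, and
  \<open>at_fraction x N D P\<close> is the value of \<open>P(N/D)\<close> under this extension. The polynomial in the
  numerator is \<open>D ^ degree P * P(N/D)\<close>.
\<close>

definition at_fraction :: "('k::field poly \<Rightarrow> real) \<Rightarrow> 'k poly \<Rightarrow> 'k poly \<Rightarrow> 'k poly \<Rightarrow> real" where
  "at_fraction x N D = (\<lambda>P.
     x (\<Sum>i\<le>Polynomial.degree P.
          Polynomial.smult (Polynomial.coeff P i) (N ^ i * D ^ (Polynomial.degree P - i)))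
     / x D ^ Polynomial.degree P)"


section \<open>The Berkovich projective line\<close>

text \<open>
  The second affine line, with coordinate \<open>T' = 1/T\<close>, contributes a single point outside the
  overlap, namely its origin. The glued set is therefore realised as the first affine line
  (constructor \<open>Some\<close>) together with one more point \<open>None\<close>; \<open>chart_inf\<close> is the embedding of the
  second affine line, and the topology is the final one for both charts.
\<close>

definition P1 :: "('k::field \<Rightarrow> real) \<Rightarrow> ('k poly \<Rightarrow> real) option set" where
  "P1 av = insert None (Some ` A1 av)"

definition chart_inf :: "('k::field poly \<Rightarrow> real) \<Rightarrow> ('k poly \<Rightarrow> real) option" where
  "chart_inf y = (if y [:0, 1:] = 0 then None else Some (at_fraction y 1 [:0, 1:]))"

definition P1_top :: "('k::field \<Rightarrow> real) \<Rightarrow> ('k poly \<Rightarrow> real) option topology" where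
  "P1_top av = topology (\<lambda>U. U \<subseteq> P1 av \<and>
     openin (A1_top av) {x \<in> A1 av. Some x \<in> U} \<and>
     openin (A1_top av) {y \<in> A1 av. chart_inf y \<in> U})"


section \<open>The projective linear group and its action\<close>

definition GL2 :: "('k::field ^ 2 ^ 2) monoid" where
  "GL2 = \<lparr>carrier = {A. invertible A}, mult = (**), one = Finite_Cartesian_Product.mat 1\<rparr>"

definition scalars2 :: "('k::field ^ 2 ^ 2) set" where
  "scalars2 = {Finite_Cartesian_Product.mat c | c. c \<noteq> 0}"

definition PGL2 :: "('k::field ^ 2 ^ 2) set monoid" where
  "PGL2 = GL2 Mod scalars2"

definition moebius ::
    "('k::field \<Rightarrow> real) \<Rightarrow> 'k ^ 2 ^ 2 \<Rightarrow> ('k poly \<Rightarrow> real) option \<Rightarrow> ('k poly \<Rightarrow> real) option" where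
  "moebius av A p =
     (let a = A $ 1 $ 1; b = A $ 1 $ 2; c = A $ 2 $ 1; d = A $ 2 $ 2 in
      case p of
        None \<Rightarrow> if c = 0 then None else Some (eval_point av (a / c))
      | Some x \<Rightarrow> if x [:d, c:] = 0 then None else Some (at_fraction x [:b, a:] [:d, c:]))"

text \<open>Independence of the representative is lemma \<open>pgl_act_rcoset\<close> below.\<close>

definition pgl_act ::
    "('k::field \<Rightarrow> real) \<Rightarrow> ('k ^ 2 ^ 2) set \<Rightarrow> ('k poly \<Rightarrow> real) option \<Rightarrow> ('k poly \<Rightarrow> real) option" where
  "pgl_act av C = moebius av (SOME A. A \<in> C)"


section \<open>Discs and Schottky figures\<close>

definition open_disc_A1 :: "('k::field \<Rightarrow> real) \<Rightarrow> 'k \<Rightarrow> real \<Rightarrow> ('k poly \<Rightarrow> real) option set" where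
  "open_disc_A1 av a r = Some ` {x \<in> A1 av. x [:- a, 1:] < r}"

definition closed_disc_A1 :: "('k::field \<Rightarrow> real) \<Rightarrow> 'k \<Rightarrow> real \<Rightarrow> ('k poly \<Rightarrow> real) option set" where
  "closed_disc_A1 av a r = Some ` {x \<in> A1 av. x [:- a, 1:] \<le> r}"

definition is_open_disc :: "('k::field \<Rightarrow> real) \<Rightarrow> ('k poly \<Rightarrow> real) option set \<Rightarrow> bool" where
  "is_open_disc av U \<longleftrightarrow>
     (\<exists>\<gamma>\<in>carrier PGL2. \<exists>a r. r > 0 \<and> U = pgl_act av \<gamma> ` open_disc_A1 av a r)"

definition is_closed_disc :: "('k::field \<Rightarrow> real) \<Rightarrow> ('k poly \<Rightarrow> real) option set \<Rightarrow> bool" where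
  "is_closed_disc av U \<longleftrightarrow>
     (\<exists>\<gamma>\<in>carrier PGL2. \<exists>a r. r > 0 \<and> U = pgl_act av \<gamma> ` closed_disc_A1 av a r)"

definition is_maximal_open_disc_in ::
    "('k::field \<Rightarrow> real) \<Rightarrow> ('k poly \<Rightarrow> real) option set \<Rightarrow> ('k poly \<Rightarrow> real) option set \<Rightarrow> bool" where
  "is_maximal_open_disc_in av U B \<longleftrightarrow>
     is_open_disc av U \<and> U \<subseteq> B \<and> (\<forall>V. is_open_disc av V \<and> U \<subseteq> V \<and> V \<subseteq> B \<longrightarrow> V = U)"

text \<open>
  \<open>B i \<epsilon>\<close> is the closed disc attached to \<open>\<gamma>\<^sub>i\<close> and the sign \<open>\<epsilon>\<close>, for \<open>1 \<le> i \<le> g\<close> and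
  \<open>\<epsilon> \<in> {1, -1}\<close>; other values of \<open>B\<close> are irrelevant.
\<close>

definition figure_open_disc ::
    "('k::field \<Rightarrow> real) \<Rightarrow> (nat \<Rightarrow> ('k ^ 2 ^ 2) set) \<Rightarrow>
     (nat \<Rightarrow> int \<Rightarrow> ('k poly \<Rightarrow> real) option set) \<Rightarrow> nat \<Rightarrow> int \<Rightarrow> ('k poly \<Rightarrow> real) option set" where
  "figure_open_disc av \<gamma> B i \<epsilon> = pgl_act av (\<gamma> i [^]\<^bsub>PGL2\<^esub> \<epsilon>) ` (P1 av - B i (- \<epsilon>))"

definition schottky_figure ::
    "('k::field \<Rightarrow> real) \<Rightarrow> nat \<Rightarrow> (nat \<Rightarrow> ('k ^ 2 ^ 2) set) \<Rightarrow>
     (nat \<Rightarrow> int \<Rightarrow> ('k poly \<Rightarrow> real) option set) \<Rightarrow> bool" where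
  "schottky_figure av g \<gamma> B \<longleftrightarrow>
     (\<forall>i\<in>{1..g}. \<forall>\<epsilon>\<in>{1, -1}. is_closed_disc av (B i \<epsilon>)) \<and>
     disjoint_family_on (\<lambda>(i, \<epsilon>). B i \<epsilon>) ({1..g} \<times> {1, -1}) \<and>
     (\<forall>i\<in>{1..g}. \<forall>\<epsilon>\<in>{1, -1}.
        is_maximal_open_disc_in av (figure_open_disc av \<gamma> B i \<epsilon>) (B i \<epsilon>))"


section \<open>Free groups\<close>

text \<open>A letter \<open>(s, True)\<close> stands for \<open>s\<close> and \<open>(s, False)\<close> for the inverse of \<open>s\<close>.\<close>

definition reduced_words :: "'a set \<Rightarrow> ('a \<times> bool) list set" where
  "reduced_words S = {w. fst ` set w \<subseteq> S \<and>
     successively (\<lambda>l m. \<not> (fst l = fst m \<and> snd l \<noteq> snd m)) w}"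

definition eval_word :: "('a, 'b) monoid_scheme \<Rightarrow> ('a \<times> bool) list \<Rightarrow> 'a" where
  "eval_word G w =
     foldr (\<lambda>(s, e) h. (if e then s else inv\<^bsub>G\<^esub> s) \<otimes>\<^bsub>G\<^esub> h) w \<one>\<^bsub>G\<^esub>"

text \<open>
  The reduced words are the elements of the free group on \<open>S\<close>; the group is free if the canonical
  map from that group is a bijection for some \<open>S\<close>.
\<close>

definition is_free_group :: "('a, 'b) monoid_scheme \<Rightarrow> bool" where
  "is_free_group G \<longleftrightarrow> Group.group G \<and>
     (\<exists>S \<subseteq> carrier G. bij_betw (eval_word G) (reduced_words S) (carrier G))"

definition is_finitely_generated :: "('a, 'b) monoid_scheme \<Rightarrow> bool" where
  "is_finitely_generated G \<longleftrightarrow>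
     (\<exists>S. finite S \<and> S \<subseteq> carrier G \<and> generate G S = carrier G)"


section \<open>Schottky groups\<close>

definition eigenvalue_ac :: "'k::field ^ 2 ^ 2 \<Rightarrow> 'k alg_closure \<Rightarrow> bool" where
  "eigenvalue_ac A l \<longleftrightarrow> (\<exists>v. v \<noteq> 0 \<and> map_matrix to_ac A *v v = l *s v)"

definition loxodromic_matrix ::
    "('k::field alg_closure \<Rightarrow> real) \<Rightarrow> 'k ^ 2 ^ 2 \<Rightarrow> bool" where
  "loxodromic_matrix ava A \<longleftrightarrow>
     (\<exists>l m. eigenvalue_ac A l \<and> eigenvalue_ac A m \<and> ava l \<noteq> ava m)"

definition loxodromic :: "('k::field alg_closure \<Rightarrow> real) \<Rightarrow> ('k ^ 2 ^ 2) set \<Rightarrow> bool" where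
  "loxodromic ava C \<longleftrightarrow> (\<exists>A\<in>C. loxodromic_matrix ava A)"

definition acts_freely_on ::
    "('k::field \<Rightarrow> real) \<Rightarrow> ('k ^ 2 ^ 2) set set \<Rightarrow> ('k poly \<Rightarrow> real) option set \<Rightarrow> bool" where
  "acts_freely_on av \<Gamma> E \<longleftrightarrow>
     (\<forall>\<gamma>\<in>\<Gamma>. \<forall>x\<in>E. pgl_act av \<gamma> x = x \<longrightarrow> \<gamma> = \<one>\<^bsub>PGL2\<^esub>)"

definition acts_properly_on ::
    "('k::field \<Rightarrow> real) \<Rightarrow> ('k ^ 2 ^ 2) set set \<Rightarrow> ('k poly \<Rightarrow> real) option set \<Rightarrow> bool" where
  "acts_properly_on av \<Gamma> E \<longleftrightarrow>
     proper_map
       (prod_topology (discrete_topology \<Gamma>) (subtopology (P1_top av) E))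
       (prod_topology (subtopology (P1_top av) E) (subtopology (P1_top av) E))
       (\<lambda>(\<gamma>, x). (x, pgl_act av \<gamma> x))"

definition schottky_group ::
    "('k::field \<Rightarrow> real) \<Rightarrow> ('k alg_closure \<Rightarrow> real) \<Rightarrow> ('k ^ 2 ^ 2) set set \<Rightarrow> bool" where
  "schottky_group av ava \<Gamma> \<longleftrightarrow>
     subgroup \<Gamma> PGL2 \<and>
     is_free_group (PGL2\<lparr>carrier := \<Gamma>\<rparr>) \<and> is_finitely_generated (PGL2\<lparr>carrier := \<Gamma>\<rparr>) \<and>
     (\<forall>\<gamma>\<in>\<Gamma>. \<gamma> \<noteq> \<one>\<^bsub>PGL2\<^esub> \<longrightarrow> loxodromic ava \<gamma>) \<and>
     (\<exists>E. E \<noteq> {} \<and> openin (P1_top av) E \<and> connectedin (P1_top av) E \<and>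
        (\<forall>\<gamma>\<in>\<Gamma>. pgl_act av \<gamma> ` E = E) \<and> acts_freely_on av \<Gamma> E \<and> acts_properly_on av \<Gamma> E)"


section \<open>Consistency of the definitions\<close>

lemma topspace_A1_top: "topspace (A1_top av) = A1 av"
proof -
  have "A1 av = {x \<in> A1 av. x 0 \<in> (UNIV :: real set)}" by simp
  then have "A1 av \<in> {{x \<in> A1 av. x P \<in> U} | P U. open U}" by blast
  then show ?thesis unfolding A1_top_def topology_generated_by_topspace by blast
qed

lemma openin_P1_top:
  "openin (P1_top av) U \<longleftrightarrow> U \<subseteq> P1 av \<and>
     openin (A1_top av) {x \<in> A1 av. Some x \<in> U} \<and>
     openin (A1_top av) {y \<in> A1 av. chart_inf y \<in> U}"
proof -
  have *: "istopology (\<lambda>U. U \<subseteq> P1 av \<and> openin (A1_top av) {x \<in> A1 av. f x \<in> U} \<and>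
             openin (A1_top av) {y \<in> A1 av. h y \<in> U})" (is "istopology ?L")
    for f h :: "('a poly \<Rightarrow> real) \<Rightarrow> ('a poly \<Rightarrow> real) option"
    unfolding istopology_def
  proof (intro conjI allI impI)
    fix S T assume "S \<subseteq> P1 av \<and> openin (A1_top av) {x \<in> A1 av. f x \<in> S} \<and>
          openin (A1_top av) {y \<in> A1 av. h y \<in> S}"
      and "T \<subseteq> P1 av \<and> openin (A1_top av) {x \<in> A1 av. f x \<in> T} \<and>
          openin (A1_top av) {y \<in> A1 av. h y \<in> T}"
    moreover have "{x \<in> A1 av. u x \<in> S \<inter> T} = {x \<in> A1 av. u x \<in> S} \<inter> {x \<in> A1 av. u x \<in> T}"
      for u :: "('a poly \<Rightarrow> real) \<Rightarrow> ('a poly \<Rightarrow> real) option" by blast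
    ultimately show "S \<inter> T \<subseteq> P1 av" "openin (A1_top av) {x \<in> A1 av. f x \<in> S \<inter> T}"
      "openin (A1_top av) {y \<in> A1 av. h y \<in> S \<inter> T}" by auto
  next
    fix K assume K: "\<forall>S\<in>K. S \<subseteq> P1 av \<and> openin (A1_top av) {x \<in> A1 av. f x \<in> S} \<and>
          openin (A1_top av) {y \<in> A1 av. h y \<in> S}"
    have "{x \<in> A1 av. u x \<in> \<Union>K} = (\<Union>S\<in>K. {x \<in> A1 av. u x \<in> S})"
      for u :: "('a poly \<Rightarrow> real) \<Rightarrow> ('a poly \<Rightarrow> real) option" by blast
    with K show "\<Union>K \<subseteq> P1 av" "openin (A1_top av) {x \<in> A1 av. f x \<in> \<Union>K}"
      "openin (A1_top av) {y \<in> A1 av. h y \<in> \<Union>K}" by (auto intro!: openin_Union)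
  qed
  show ?thesis unfolding P1_top_def topology_inverse'[OF *] ..
qed

lemma A1_smult: "x \<in> A1 av \<Longrightarrow> x (Polynomial.smult c P) = av c * x P"
proof -
  assume "x \<in> A1 av"
  then have "x ([:c:] * P) = x [:c:] * x P" "x [:c:] = av c" unfolding A1_def by blast+
  then show "x (Polynomial.smult c P) = av c * x P" by simp
qed

lemma nonarch_abs_power:
  assumes "nonarch_abs av"
  shows "av (c ^ n) = av c ^ n"
proof -
  have "av 1 * av 1 = av 1" using assms unfolding nonarch_abs_def by (metis mult_1)
  moreover have "av 1 \<noteq> 0" using assms unfolding nonarch_abs_def by (metis one_neq_zero)
  ultimately have "av 1 = 1" by simp
  then show ?thesis using assms by (induction n) (auto simp: nonarch_abs_def)
qed

lemma smult_sum_distrib: "Polynomial.smult c (\<Sum>i\<in>I. f i) = (\<Sum>i\<in>I. Polynomial.smult c (f i))"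
  by (induction I rule: infinite_finite_induct) (simp_all add: smult_add_right)

lemma at_fraction_smult:
  fixes av :: "'a::field \<Rightarrow> real"
  assumes av: "nonarch_abs av" and x: "x \<in> A1 av" and c: "c \<noteq> 0"
  shows "at_fraction x (Polynomial.smult c N) (Polynomial.smult c D) = at_fraction x N D"
proof
  fix P :: "'a poly"
  let ?n = "Polynomial.degree P"
  let ?S = "\<lambda>N D. \<Sum>i\<le>?n. Polynomial.smult (Polynomial.coeff P i) (N ^ i * D ^ (?n - i))"
  have "?S (Polynomial.smult c N) (Polynomial.smult c D) = Polynomial.smult (c ^ ?n) (?S N D)"
    unfolding smult_sum_distrib
  proof (rule sum.cong)
    fix i assume "i \<in> {..?n}"
    then have "c ^ i * c ^ (?n - i) = c ^ ?n" by (simp flip: power_add)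
    then show "Polynomial.smult (Polynomial.coeff P i)
          (Polynomial.smult c N ^ i * Polynomial.smult c D ^ (?n - i)) =
        Polynomial.smult (c ^ ?n) (Polynomial.smult (Polynomial.coeff P i) (N ^ i * D ^ (?n - i)))"
      unfolding smult_power mult_smult_left mult_smult_right smult_smult
      by (metis mult.commute mult.left_commute)
  qed simp
  moreover have "av c \<noteq> 0" using av c by (simp add: nonarch_abs_def)
  ultimately show "at_fraction x (Polynomial.smult c N) (Polynomial.smult c D) P = at_fraction x N D P"
    unfolding at_fraction_def
    by (simp add: A1_smult[OF x] nonarch_abs_power[OF av] power_mult_distrib)
qed

lemma moebius_scalar:
  assumes av: "nonarch_abs av" and c: "c \<noteq> 0" and p: "p \<in> P1 av"
  shows "moebius av (Finite_Cartesian_Product.mat c ** A) p = moebius av A p"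
proof -
  have e: "(Finite_Cartesian_Product.mat c ** A) $ i $ j = c * A $ i $ j" for i j :: 2
    using exhaust_2[of i]
    by (auto simp: matrix_matrix_mult_def Finite_Cartesian_Product.mat_def sum_2)
  have s: "[:c * u, c * v:] = Polynomial.smult c [:u, v:]" for u v by simp
  have ne: "av c \<noteq> 0" using av c by (simp add: nonarch_abs_def)
  show ?thesis
  proof (cases p)
    case None
    then show ?thesis using c by (simp add: moebius_def e)
  next
    case (Some x)
    then have x: "x \<in> A1 av" using p by (auto simp: P1_def)
    show ?thesis
      using Some ne
      unfolding moebius_def Let_def e s
      by (simp add: A1_smult[OF x] at_fraction_smult[OF av x c] del: smult_pCons)
  qed
qed

lemma pgl_act_rcoset:
  assumes av: "nonarch_abs av" and p: "p \<in> P1 av"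
  shows "pgl_act av (scalars2 #>\<^bsub>GL2\<^esub> A) p = moebius av A p"
proof -
  let ?C = "scalars2 #>\<^bsub>GL2\<^esub> A"
  have "Finite_Cartesian_Product.mat 1 \<in> scalars2"
    unfolding scalars2_def using one_neq_zero by blast
  then have "Finite_Cartesian_Product.mat 1 \<otimes>\<^bsub>GL2\<^esub> A \<in> ?C"
    unfolding r_coset_def by blast
  then have "(SOME B. B \<in> ?C) \<in> ?C" by (rule someI)
  then obtain c where "c \<noteq> 0" "(SOME B. B \<in> ?C) = Finite_Cartesian_Product.mat c ** A"
    by (auto simp: r_coset_def GL2_def scalars2_def)
  then show ?thesis by (simp add: pgl_act_def moebius_scalar[OF av _ p])
qed

end

theory Submission
  imports Defs
begin

text \<open>
  Ping-pong: the generator attached to a letter maps the complement of one disc of the figure onto the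
  open disc inside another one. Hence reduced words act nontrivially, and every nontrivial element is
  conjugate to one that maps a closed disc into an open disc of the same centre and radius; evaluating
  this at the Gauss point and at rational points gives \<open>|det| < |trace|\<^sup>2\<close>, which forces
  eigenvalues of distinct absolute values. The required open set is the union of the translates of
  the complement \<open>F\<close> of the open discs. A neighbourhood of \<open>F\<close> meets only finitely many
  of its translates, which gives openness and properness. \<open>F\<close> is connected because every
  point of a disc can be moved to the Gauss point of the disc along a path of seminorms that never
  enters an open disc which it did not meet at the start.
\<close>

section \<open>Ultrametric multiplicative seminorms\<close>

text \<open>The absolute value may be trivial or discrete, so radii of discs need not be values of
  \<open>k\<close> and rational points are too few to measure discs. Gauss points serve as witnesses
  instead: they bound the radius of an open disc from below, show that a closed disc of the figure
  is strictly larger than its open disc, and control the entries of a contracting matrix. Each ring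
  between two such discs lies in \<open>F\<close>. It is where \<open>F\<close> meets a neighbouring
  translate, and it supplies the points of \<open>F\<close> outside a given disc on which words are
  tested. The other obstacle is infinity, since the action is defined by cases according to poles.
  Reading a point as a seminorm on binary forms up to rescaling turns the action into substitution
  and discs into homogeneous inequalities, so composition, centres and radii can be computed
  uniformly. The ping-pong is carried out for an abstract action on a Hausdorff space. Geometry
  enters it through the connectedness of \<open>F\<close> and the non-empty rings; the trace
  inequality is treated separately, in coordinates adapted to one disc, because trace and
  determinant are invariant under conjugation.\<close>

locale mult_seminorm =
  fixes x :: "'r::comm_ring_1 \<Rightarrow> real"
  assumes nonneg: "0 \<le> x p"
    and ultra: "x (p + q) \<le> max (x p) (x q)"
    and mult: "x (p * q) = x p * x q"
    and one: "x 1 = 1"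
    and zero: "x 0 = 0"
begin

lemma uminus: "x (- p) = x p"
proof -
  have "x (- 1) * x (- 1) = 1" using mult[of "- 1" "- 1"] one by simp
  then have "x (- 1) = 1" using nonneg[of "- 1"] by (metis abs_of_nonneg abs_1 power2_eq_1_iff power2_eq_square abs_minus_cancel)
  then show ?thesis using mult[of "- 1" p] by simp
qed

lemma diff: "x (p - q) \<le> max (x p) (x q)"
  using ultra[of p "- q"] by (simp add: uminus)

lemma minus_commute: "x (p - q) = x (q - p)"
  using uminus[of "p - q"] by simp

text \<open>Isosceles principle: in \<open>p = (p + q) - q\<close> the smaller seminorm of
  \<open>q\<close> cannot account for \<open>x p\<close>, so \<open>p + q\<close> must.\<close>

lemma add_eq: "x q < x p \<Longrightarrow> x (p + q) = x p"
  using ultra[of p q] diff[of "p + q" q] by (auto simp: max_def split: if_splits)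

lemma add_eq': "x q < x p \<Longrightarrow> x (q + p) = x p"
  by (subst add.commute) (rule add_eq)

lemma power: "x (p ^ n) = x p ^ n"
  by (induction n) (simp_all add: one mult)

lemma sum_le: "(\<And>i. i \<in> I \<Longrightarrow> x (f i) \<le> c) \<Longrightarrow> 0 \<le> c \<Longrightarrow> x (sum f I) \<le> c"
proof (induction I rule: infinite_finite_induct)
  case (insert i I)
  then have "x (f i) \<le> c" "x (sum f I) \<le> c" by auto
  then show ?case using ultra[of "f i" "sum f I"] insert.hyps by simp
qed (simp_all add: zero)

lemma sum_less: "(\<And>i. i \<in> I \<Longrightarrow> x (f i) < c) \<Longrightarrow> 0 < c \<Longrightarrow> x (sum f I) < c"
proof (induction I rule: infinite_finite_induct)
  case (insert i I)
  then have "x (f i) < c" "x (sum f I) < c" by auto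
  then show ?case using ultra[of "f i" "sum f I"] insert.hyps by simp
qed (simp_all add: zero)

end

lemma nonarch_abs_mult_seminorm:
  assumes "nonarch_abs av"
  shows "mult_seminorm av"
proof
  show "av 1 = 1" using nonarch_abs_power[OF assms, of 1 0] by simp
qed (use assms in \<open>auto simp: nonarch_abs_def\<close>)

lemma nonarch_abs_pos: "nonarch_abs av \<Longrightarrow> a \<noteq> 0 \<Longrightarrow> 0 < av a"
  unfolding nonarch_abs_def by (metis order_le_less)

lemma nonarch_abs_divide:
  assumes "nonarch_abs av"
  shows "av (a / b) = av a / av b"
proof (cases "b = 0")
  case False
  then have "av (a / b) * av b = av a" using assms unfolding nonarch_abs_def by (metis nonzero_eq_divide_eq)
  then show ?thesis using nonarch_abs_pos[OF assms False] by (simp add: field_simps)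
next
  case True
  have "av 0 = 0" using assms by (simp add: nonarch_abs_def)
  then show ?thesis using True by simp
qed

lemma nonarch_abs_of_nat_le:
  assumes "nonarch_abs av"
  shows "av (of_nat n) \<le> 1"
proof -
  interpret mult_seminorm av using nonarch_abs_mult_seminorm[OF assms] .
  show ?thesis
  proof (induction n)
    case (Suc n)
    then show ?case using ultra[of 1 "of_nat n"] by (simp add: one)
  qed (simp add: zero)
qed

text \<open>
  The binomial expansion gives \<open>s ^ n \<le> (n + 1) * M ^ n\<close> for the seminorm \<open>s\<close> of a sum and the
  maximum \<open>M\<close> of the seminorms of its summands; this lemma then yields \<open>s \<le> M\<close>.
\<close>

lemma le_of_power_le_linear_times_power:
  fixes s M :: real
  assumes "0 \<le> M" and le: "\<And>n. s ^ n \<le> (real n + 1) * M ^ n"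
  shows "s \<le> M"
proof (rule ccontr)
  assume "\<not> s \<le> M"
  then have sM: "M < s" by simp
  have "M \<noteq> 0" using le[of 1] sM by auto
  then have M: "0 < M" using assms by simp
  define q where "q = s / M"
  have q: "1 < q" using sM M by (simp add: q_def)
  have "(\<lambda>n. of_nat n / q ^ n) \<longlonglongrightarrow> 0" using q by (intro lim_n_over_pown) simp
  moreover have "(\<lambda>n. 1 / q ^ n) \<longlonglongrightarrow> 0"
    using LIMSEQ_realpow_zero[of "1 / q"] q by (simp add: power_one_over)
  ultimately have "(\<lambda>n. of_nat n / q ^ n + 1 / q ^ n) \<longlonglongrightarrow> 0 + 0" by (rule tendsto_add)
  moreover have "1 \<le> of_nat n / q ^ n + 1 / q ^ n" for n
  proof -
    have "q ^ n \<le> real n + 1"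
      using le[of n] M by (simp add: q_def power_divide divide_le_eq)
    then show ?thesis using q by (simp add: field_simps)
  qed
  ultimately have "(1::real) \<le> 0 + 0" by (intro LIMSEQ_le_const) auto
  then show False by simp
qed

lemma A1_nonneg: "x \<in> A1 av \<Longrightarrow> 0 \<le> x P"
  and A1_mult: "x \<in> A1 av \<Longrightarrow> x (P * Q) = x P * x Q"
  and A1_const: "x \<in> A1 av \<Longrightarrow> x [:a:] = av a"
  and A1_triangle: "x \<in> A1 av \<Longrightarrow> x (P + Q) \<le> x P + x Q"
  unfolding A1_def by blast+

text \<open>Points are defined by the triangle inequality alone. Binomial coefficients have norm at
  most 1 because \<open>av\<close> is ultrametric on \<open>k\<close>, so expanding
  \<open>(P + Q) ^ n\<close> costs only the number \<open>n + 1\<close> of terms.\<close>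

lemma A1_mult_seminorm:
  fixes av :: "'k::field \<Rightarrow> real"
  assumes av: "nonarch_abs av" and x: "x \<in> A1 av"
  shows "mult_seminorm x"
proof
  interpret av: mult_seminorm av using nonarch_abs_mult_seminorm[OF av] .
  show one: "x 1 = 1" using A1_const[OF x, of 1] av.one by (simp add: one_pCons)
  show zero: "x 0 = 0" using A1_const[OF x, of 0] av.zero by simp
  fix P Q :: "'k poly"
  show "0 \<le> x P" using A1_nonneg[OF x] .
  show "x (P * Q) = x P * x Q" using A1_mult[OF x] .
  have pow: "x (R ^ n) = x R ^ n" for R n
    by (induction n) (simp_all add: one A1_mult[OF x])
  have sum: "x (sum f I) \<le> (\<Sum>i\<in>I. x (f i))" for f and I :: "nat set"
  proof (induction I rule: infinite_finite_induct)
    case (insert i I)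
    then show ?case using A1_triangle[OF x, of "f i" "sum f I"] by simp
  qed (simp_all add: zero)
  define M where "M = max (x P) (x Q)"
  have M: "0 \<le> M" "x P \<le> M" "x Q \<le> M" using A1_nonneg[OF x] by (auto simp: M_def max_def)
  have "x (P + Q) ^ n \<le> (real n + 1) * M ^ n" for n
  proof -
    have "x (P + Q) ^ n = x (\<Sum>k\<le>n. of_nat (n choose k) * P ^ k * Q ^ (n - k))"
      by (simp flip: pow binomial_ring)
    also have "\<dots> \<le> (\<Sum>k\<le>n. x (of_nat (n choose k) * P ^ k * Q ^ (n - k)))" by (rule sum)
    also have "\<dots> \<le> (\<Sum>k\<le>n. M ^ n)"
    proof (rule sum_mono)
      fix k assume k: "k \<in> {..n}"
      have "x (of_nat (n choose k)) \<le> 1"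
        using nonarch_abs_of_nat_le[OF av, of "n choose k"] by (simp add: of_nat_poly A1_const[OF x])
      moreover have "x P ^ k * x Q ^ (n - k) \<le> M ^ k * M ^ (n - k)"
        using M A1_nonneg[OF x, of P] A1_nonneg[OF x, of Q]
        by (intro mult_mono power_mono zero_le_power) simp_all
      moreover have "0 \<le> x P ^ k * x Q ^ (n - k)"
        using A1_nonneg[OF x, of P] A1_nonneg[OF x, of Q] by simp
      ultimately have "x (of_nat (n choose k)) * (x P ^ k * x Q ^ (n - k)) \<le> 1 * (M ^ k * M ^ (n - k))"
        by (rule_tac mult_mono) simp_all
      then show "x (of_nat (n choose k) * P ^ k * Q ^ (n - k)) \<le> M ^ n"
        using k by (simp add: A1_mult[OF x] pow flip: power_add)
    qed
    finally show ?thesis by (simp add: add.commute)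
  qed
  then have "x (P + Q) \<le> M" using M(1) by (rule le_of_power_le_linear_times_power[rotated])
  then show "x (P + Q) \<le> max (x P) (x Q)" by (simp add: M_def)
qed

lemma A1_I:
  fixes av :: "'k::field \<Rightarrow> real"
  assumes "mult_seminorm x" and "\<And>a. x [:a:] = av a"
  shows "x \<in> A1 av"
proof -
  interpret mult_seminorm x by fact
  have "x (P + Q) \<le> x P + x Q" for P Q
    using ultra[of P Q] nonneg[of P] nonneg[of Q] by (simp add: max_def split: if_splits)
  then show ?thesis using nonneg mult assms(2) by (auto simp: A1_def)
qed

lemma eval_point_A1:
  assumes "nonarch_abs av"
  shows "eval_point av a \<in> A1 av"
proof (rule A1_I)
  interpret mult_seminorm av using nonarch_abs_mult_seminorm[OF assms] .
  show "mult_seminorm (eval_point av a)"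
    by unfold_locales (auto simp: eval_point_def nonneg ultra mult one zero)
qed (simp add: eval_point_def)

section \<open>Homogenization of polynomials\<close>

text \<open>For \<open>degree P \<le> n\<close> this is \<open>D ^ n * P(N/D)\<close>, the value at
  \<open>(N, D)\<close> of \<open>P\<close> read as a binary form of degree \<open>n\<close>.
  Keeping \<open>n\<close> free makes the operation linear in \<open>P\<close>; coefficients above
  \<open>n\<close> are dropped.\<close>

definition homogenize :: "'k::field poly \<Rightarrow> 'k poly \<Rightarrow> nat \<Rightarrow> 'k poly \<Rightarrow> 'k poly" where
  "homogenize N D n P =
     (\<Sum>i\<le>n. Polynomial.smult (Polynomial.coeff P i) (N ^ i * D ^ (n - i)))"

lemma at_fraction_homogenize:
  "at_fraction x N D P =
     x (homogenize N D (Polynomial.degree P) P) / x D ^ Polynomial.degree P"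
  by (simp add: at_fraction_def homogenize_def)

lemma homogenize_0 [simp]: "homogenize N D n 0 = 0"
  by (simp add: homogenize_def)

lemma homogenize_add: "homogenize N D n (P + Q) = homogenize N D n P + homogenize N D n Q"
  by (simp add: homogenize_def smult_add_left sum.distrib)

lemma homogenize_smult:
  "homogenize N D n (Polynomial.smult c P) = Polynomial.smult c (homogenize N D n P)"
  by (simp add: homogenize_def smult_sum_distrib)

lemma homogenize_sum: "homogenize N D n (\<Sum>i\<in>I. f i) = (\<Sum>i\<in>I. homogenize N D n (f i))"
  by (induction I rule: infinite_finite_induct) (simp_all add: homogenize_add)

lemma homogenize_Suc_pCons:
  "homogenize N D (Suc n) (pCons c P) = Polynomial.smult c (D ^ Suc n) + N * homogenize N D n P"
  unfolding homogenize_def sum.atMost_Suc_shift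
  by (simp add: sum_distrib_left mult.assoc)

lemma homogenize_zero_degree: "homogenize N D 0 P = [:Polynomial.coeff P 0:]"
  by (simp add: homogenize_def)

lemma homogenize_linear: "homogenize N D 1 [:b, a:] = Polynomial.smult b D + Polynomial.smult a N"
  by (simp add: homogenize_def)

text \<open>Raising the formal degree by \<open>k\<close> only multiplies by \<open>D ^ k\<close>.
  Hence the quotient of \<open>x (homogenize N D n P)\<close> by \<open>x D ^ n\<close> is the same
  for every admissible \<open>n\<close>, and polynomials of different degrees can be compared over
  one denominator.\<close>

lemma homogenize_raise:
  assumes "Polynomial.degree P \<le> n"
  shows "homogenize N D (k + n) P = D ^ k * homogenize N D n P"
proof -
  have "homogenize N D (k + n) P =
      (\<Sum>i\<le>n. Polynomial.smult (Polynomial.coeff P i) (N ^ i * D ^ (k + n - i)))"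
    unfolding homogenize_def
    by (rule sum.mono_neutral_right) (use assms in \<open>auto intro!: coeff_eq_0\<close>)
  also have "\<dots> = D ^ k * homogenize N D n P"
    unfolding homogenize_def sum_distrib_left
  proof (rule sum.cong)
    fix i assume "i \<in> {..n}"
    then have "k + n - i = k + (n - i)" by simp
    then show "Polynomial.smult (Polynomial.coeff P i) (N ^ i * D ^ (k + n - i)) =
        D ^ k * Polynomial.smult (Polynomial.coeff P i) (N ^ i * D ^ (n - i))"
      by (simp add: power_add mult.left_commute)
  qed simp
  finally show ?thesis .
qed

text \<open>The induction splits off the constant coefficient of \<open>P\<close>. The degree bounds
  guarantee that no coefficient of a factor or of the product is dropped.\<close>

lemma homogenize_mult:
  assumes "Polynomial.degree P \<le> n" "Polynomial.degree Q \<le> m"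
  shows "homogenize N D (n + m) (P * Q) = homogenize N D n P * homogenize N D m Q"
  using assms(1)
proof (induction n arbitrary: P)
  case 0
  then obtain c where "P = [:c:]" by (auto elim: degree_eq_zeroE)
  then show ?case by (simp add: homogenize_smult homogenize_zero_degree)
next
  case (Suc n)
  obtain c P' where P: "P = pCons c P'" by (rule pCons_cases)
  then have "Polynomial.degree P' \<le> n" using Suc.prems by (auto split: if_splits)
  then have IH: "homogenize N D (n + m) (P' * Q) = homogenize N D n P' * homogenize N D m Q"
    by (rule Suc.IH)
  have "homogenize N D (Suc n + m) (P * Q) =
      Polynomial.smult c (homogenize N D (Suc n + m) Q) + homogenize N D (Suc (n + m)) (pCons 0 (P' * Q))"
    by (simp add: P homogenize_add homogenize_smult)
  also have "\<dots> = (Polynomial.smult c (D ^ Suc n) + N * homogenize N D n P') * homogenize N D m Q"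
    unfolding homogenize_raise[OF assms(2)] homogenize_Suc_pCons IH by (simp add: algebra_simps)
  finally show ?case by (simp add: P homogenize_Suc_pCons)
qed

lemma homogenize_one: "homogenize N D n 1 = D ^ n"
  using homogenize_raise[of 1 0 N D n] by (simp add: homogenize_zero_degree flip: one_pCons)

lemma degree_power_le_of_linear: "Polynomial.degree P \<le> 1 \<Longrightarrow> Polynomial.degree (P ^ n) \<le> n"
  using degree_power_le[of P n] mult_le_mono1[of "Polynomial.degree P" 1 n] by linarith

lemma homogenize_power:
  assumes "Polynomial.degree P \<le> 1"
  shows "homogenize N D n (P ^ n) = homogenize N D 1 P ^ n"
proof (induction n)
  case 0
  then show ?case by (simp add: homogenize_one)
next
  case (Suc n)
  have "homogenize N D (Suc n) (P ^ Suc n) = homogenize N D 1 P * homogenize N D n (P ^ n)"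
    using homogenize_mult[OF assms degree_power_le_of_linear[OF assms], of N D n] by simp
  then show ?case by (simp only: Suc power_Suc)
qed

lemma degree_prod_powers_le:
  assumes "Polynomial.degree N \<le> 1" "Polynomial.degree D \<le> 1" "i \<le> n"
  shows "Polynomial.degree (N ^ i * D ^ (n - i)) \<le> n"
  using degree_mult_le[of "N ^ i" "D ^ (n - i)"] degree_power_le_of_linear[OF assms(1), of i]
    degree_power_le_of_linear[OF assms(2), of "n - i"] assms(3) by linarith

lemma degree_homogenize_le:
  assumes "Polynomial.degree N \<le> 1" "Polynomial.degree D \<le> 1"
  shows "Polynomial.degree (homogenize N D n P) \<le> n"
  unfolding homogenize_def
  by (rule degree_sum_le) (auto intro: order_trans[OF degree_smult_le] degree_prod_powers_le assms)

text \<open>Substitution respects products of linear forms, so substituting twice is substituting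
  the transformed pair once. For pairs coming from matrices this becomes the matrix product.\<close>

lemma homogenize_homogenize:
  assumes "Polynomial.degree N' \<le> 1" "Polynomial.degree D' \<le> 1"
  shows "homogenize N D n (homogenize N' D' n P) =
    homogenize (homogenize N D 1 N') (homogenize N D 1 D') n P"
proof -
  have "homogenize N D n (N' ^ i * D' ^ (n - i)) =
      homogenize N D 1 N' ^ i * homogenize N D 1 D' ^ (n - i)" if "i \<le> n" for i
    using homogenize_mult[of "N' ^ i" i "D' ^ (n - i)" "n - i" N D] that
    by (simp add: degree_power_le_of_linear assms homogenize_power del: One_nat_def)
  then show ?thesis
    unfolding homogenize_def[of N' D'] homogenize_sum homogenize_smult
      homogenize_def[of "homogenize N D 1 N'" "homogenize N D 1 D'"]
    by (intro sum.cong) auto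
qed

lemma homogenize_id: "Polynomial.degree P \<le> n \<Longrightarrow> homogenize [:0, 1:] 1 n P = P"
  unfolding homogenize_def using poly_as_sum_of_monoms'[of P n] by (simp add: monom_altdef)

text \<open>The coefficient at the formal degree is the value of the binary form at the point at
  infinity, hence multiplicative.\<close>

lemma coeff_mult_top:
  assumes "Polynomial.degree P \<le> n" "Polynomial.degree Q \<le> m"
  shows "Polynomial.coeff (P * Q) (n + m) = Polynomial.coeff P n * Polynomial.coeff Q m"
proof -
  have "Polynomial.coeff (P * Q) (n + m) =
      (\<Sum>i\<le>n + m. Polynomial.coeff P i * Polynomial.coeff Q (n + m - i))"
    by (simp add: coeff_mult)
  also have "\<dots> = (\<Sum>i\<in>{n}. Polynomial.coeff P i * Polynomial.coeff Q (n + m - i))"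
  proof (rule sum.mono_neutral_right)
    show "\<forall>i\<in>{..n + m} - {n}. Polynomial.coeff P i * Polynomial.coeff Q (n + m - i) = 0"
    proof
      fix i assume "i \<in> {..n + m} - {n}"
      then consider "n < i" | "m < n + m - i" by force
      then show "Polynomial.coeff P i * Polynomial.coeff Q (n + m - i) = 0"
        using assms by cases (auto simp: coeff_eq_0)
    qed
  qed auto
  finally show ?thesis by simp
qed

lemma poly_altdef_le:
  "Polynomial.degree P \<le> n \<Longrightarrow> poly P a = (\<Sum>i\<le>n. Polynomial.coeff P i * a ^ i)"
  for a :: "'a::comm_ring_1"
  unfolding poly_altdef by (rule sum.mono_neutral_left) (auto simp: coeff_eq_0)

lemma coeff_power_top:
  assumes "Polynomial.degree P \<le> 1"
  shows "Polynomial.coeff (P ^ n) n = Polynomial.coeff P 1 ^ n"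
proof (induction n)
  case (Suc n)
  then show ?case
    using coeff_mult_top[OF assms degree_power_le_of_linear[OF assms, of n]] by simp
qed simp

lemma coeff_homogenize_top:
  assumes "Polynomial.degree N \<le> 1" "Polynomial.degree D \<le> 1"
  shows "Polynomial.coeff (homogenize N D n P) n =
    (\<Sum>i\<le>n. Polynomial.coeff P i * (Polynomial.coeff N 1 ^ i * Polynomial.coeff D 1 ^ (n - i)))"
proof -
  have "Polynomial.coeff (N ^ i * D ^ (n - i)) n = Polynomial.coeff N 1 ^ i * Polynomial.coeff D 1 ^ (n - i)"
    if "i \<le> n" for i
    using coeff_mult_top[OF degree_power_le_of_linear[OF assms(1), of i]
        degree_power_le_of_linear[OF assms(2), of "n - i"]] that
    by (simp add: coeff_power_top assms del: One_nat_def)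
  then show ?thesis unfolding homogenize_def coeff_sum by (auto intro!: sum.cong)
qed

section \<open>Homogeneous seminorms and the action of matrices\<close>

definition num :: "'k::field ^ 2 ^ 2 \<Rightarrow> 'k poly" where "num A = [:A $ 1 $ 2, A $ 1 $ 1:]"
definition den :: "'k::field ^ 2 ^ 2 \<Rightarrow> 'k poly" where "den A = [:A $ 2 $ 2, A $ 2 $ 1:]"

lemma degree_num: "Polynomial.degree (num A) \<le> 1"
  and degree_den: "Polynomial.degree (den A) \<le> 1"
  by (auto simp: num_def den_def)

lemma coeff_num [simp]: "Polynomial.coeff (num A) 1 = A $ 1 $ 1" "Polynomial.coeff (num A) (Suc 0) = A $ 1 $ 1"
  and coeff_den [simp]: "Polynomial.coeff (den A) 1 = A $ 2 $ 1" "Polynomial.coeff (den A) (Suc 0) = A $ 2 $ 1"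
  by (simp_all add: num_def den_def)

text \<open>Substitution of \<open>A\<close> into a binary form of degree \<open>n\<close>, written inhomogeneously.\<close>

definition subst_form :: "'k::field ^ 2 ^ 2 \<Rightarrow> nat \<Rightarrow> 'k poly \<Rightarrow> 'k poly" where
  "subst_form A n P = homogenize (num A) (den A) n P"

lemma degree_subst_form: "Polynomial.degree (subst_form A n P) \<le> n"
  unfolding subst_form_def by (intro degree_homogenize_le degree_num degree_den)

text \<open>Substitution acts on forms from the right, dual to the left action of matrices on
  points; this accounts for the order of the factors.\<close>

lemma subst_form_mult: "subst_form B n (subst_form A n P) = subst_form (A ** B) n P"
proof -
  have "homogenize (num B) (den B) 1 (num A) = num (A ** B)"
    "homogenize (num B) (den B) 1 (den A) = den (A ** B)"
    by (simp_all add: num_def den_def homogenize_linear[unfolded One_nat_def] matrix_matrix_mult_def sum_2 algebra_simps)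
  then show ?thesis by (simp add: subst_form_def homogenize_homogenize degree_num degree_den del: One_nat_def)
qed

lemma subst_form_one: "Polynomial.degree P \<le> n \<Longrightarrow> subst_form (Finite_Cartesian_Product.mat 1) n P = P"
  for P :: "'k::field poly"
proof -
  have "num (Finite_Cartesian_Product.mat 1 :: 'k ^ 2 ^ 2) = [:0, 1:]"
    "den (Finite_Cartesian_Product.mat 1 :: 'k ^ 2 ^ 2) = 1"
    by (simp_all add: num_def den_def Finite_Cartesian_Product.mat_def one_pCons)
  then show "Polynomial.degree P \<le> n \<Longrightarrow> ?thesis" by (simp add: subst_form_def homogenize_id)
qed

lemma subst_form_linear:
  "subst_form A 1 [:b, a:] = Polynomial.smult b (den A) + Polynomial.smult a (num A)"
  unfolding subst_form_def by (rule homogenize_linear)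

text \<open>
  A point of the projective line is a multiplicative seminorm on binary forms, up to rescaling
  by \<open>c ^ n\<close> in degree \<open>n\<close>; a form of degree \<open>n\<close> is given by its dehomogenization, a polynomial of
  degree at most \<open>n\<close>. In this description \<open>moebius\<close> is substitution.
\<close>

definition form_norm :: "('k::field \<Rightarrow> real) \<Rightarrow> ('k poly \<Rightarrow> real) option \<Rightarrow> nat \<Rightarrow> 'k poly \<Rightarrow> real" where
  "form_norm av p n P = (case p of None \<Rightarrow> av (Polynomial.coeff P n) | Some x \<Rightarrow> x P)"

lemma form_norm_simps [simp]:
  "form_norm av None n P = av (Polynomial.coeff P n)" "form_norm av (Some x) n P = x P"
  by (simp_all add: form_norm_def)

lemma moebius_None: "moebius av A None = (if A $ 2 $ 1 = 0 then None else Some (eval_point av (A $ 1 $ 1 / A $ 2 $ 1)))"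
  by (simp add: moebius_def)

lemma moebius_Some: "moebius av A (Some x) = (if x (den A) = 0 then None else Some (at_fraction x (num A) (den A)))"
  by (simp add: moebius_def num_def den_def)

lemma None_in_P1 [simp]: "None \<in> P1 av"
  and Some_in_P1 [simp]: "Some x \<in> P1 av \<longleftrightarrow> x \<in> A1 av"
  by (auto simp: P1_def)

section \<open>Points as seminorms on binary forms, and the group law of the action\<close>

locale nonarch_field =
  fixes av :: "'k::field \<Rightarrow> real"
  assumes av: "nonarch_abs av"
begin

sublocale av: mult_seminorm av
  using nonarch_abs_mult_seminorm[OF av] .

lemma av_pos: "a \<noteq> 0 \<Longrightarrow> 0 < av a"
  using nonarch_abs_pos[OF av] .

lemma av_eq_0 [simp]: "av a = 0 \<longleftrightarrow> a = 0"
  using av by (simp add: nonarch_abs_def)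

lemma seminorm: "x \<in> A1 av \<Longrightarrow> mult_seminorm x"
  using A1_mult_seminorm[OF av] .

lemma at_fraction_eq:
  assumes x: "x \<in> A1 av" and D: "x D \<noteq> 0" and n: "Polynomial.degree P \<le> n"
  shows "at_fraction x N D P = x (homogenize N D n P) / x D ^ n"
proof -
  interpret x: mult_seminorm x using seminorm[OF x] .
  have "homogenize N D n P = D ^ (n - Polynomial.degree P) * homogenize N D (Polynomial.degree P) P"
    using homogenize_raise[of P "Polynomial.degree P" N D "n - Polynomial.degree P"] n by simp
  moreover have "x D ^ n = x D ^ (n - Polynomial.degree P) * x D ^ Polynomial.degree P"
    using n by (simp flip: power_add)
  ultimately show ?thesis using D by (simp add: at_fraction_homogenize x.mult x.power)
qed

lemma at_fraction_A1:
  assumes x: "x \<in> A1 av" and D: "x D \<noteq> 0"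
  shows "at_fraction x N D \<in> A1 av"
proof (rule A1_I)
  interpret x: mult_seminorm x using seminorm[OF x] .
  note eq = at_fraction_eq[OF x D]
  have pos: "0 < x D ^ n" for n using D x.nonneg[of D] by simp
  show "mult_seminorm (at_fraction x N D)"
  proof
    fix P Q :: "'k poly"
    define n where "n = max (Polynomial.degree P) (Polynomial.degree Q)"
    have n: "Polynomial.degree P \<le> n" "Polynomial.degree Q \<le> n" "Polynomial.degree (P + Q) \<le> n"
      using degree_add_le_max[of P Q] by (auto simp: n_def)
    show "0 \<le> at_fraction x N D P" using x.nonneg by (simp add: at_fraction_homogenize)
    have "x (homogenize N D n (P + Q)) \<le> max (x (homogenize N D n P)) (x (homogenize N D n Q))"
      unfolding homogenize_add by (rule x.ultra)
    then have "x (homogenize N D n (P + Q)) / x D ^ n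
        \<le> max (x (homogenize N D n P)) (x (homogenize N D n Q)) / x D ^ n"
      using pos[of n] by (intro divide_right_mono) (simp_all only: less_imp_le)
    then show "at_fraction x N D (P + Q) \<le> max (at_fraction x N D P) (at_fraction x N D Q)"
      using pos[of n] by (simp only: eq[OF n(1)] eq[OF n(2)] eq[OF n(3)] max_divide_distrib_right less_imp_le if_True)
    show "at_fraction x N D (P * Q) = at_fraction x N D P * at_fraction x N D Q"
      using eq[OF degree_mult_le[of P Q]]
      by (simp add: homogenize_mult x.mult power_add at_fraction_homogenize)
  qed (simp_all add: at_fraction_homogenize homogenize_zero_degree x.zero A1_const[OF x] av.one)
qed (simp add: at_fraction_homogenize homogenize_zero_degree A1_const[OF x])

lemma det_combination:
  fixes A :: "'k ^ 2 ^ 2"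
  shows "Polynomial.smult (A $ 1 $ 1) (den A) - Polynomial.smult (A $ 2 $ 1) (num A) = [:det A:]"
  by (simp add: num_def den_def det_2 mult.commute)

text \<open>The nonzero constant \<open>det A\<close> is a combination of \<open>num A\<close> and
  \<open>den A\<close> with constant coefficients, so a seminorm extending \<open>av\<close> cannot
  kill both.\<close>

lemma num_nonzero_of_den_zero:
  assumes x: "x \<in> A1 av" and A: "invertible A" and D: "x (den A) = 0"
  shows "x (num A) \<noteq> 0"
proof
  interpret x: mult_seminorm x using seminorm[OF x] .
  assume "x (num A) = 0"
  then have "x [:det A:] \<le> 0"
    using x.diff[of "Polynomial.smult (A $ 1 $ 1) (den A)" "Polynomial.smult (A $ 2 $ 1) (num A)"] D
    by (simp add: det_combination A1_smult[OF x])
  then have "det A = 0" using av_pos[of "det A"] by (force simp: A1_const[OF x])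
  then show False using A by (simp add: invertible_det_nz)
qed

lemma moebius_in_P1: "p \<in> P1 av \<Longrightarrow> moebius av A p \<in> P1 av"
  by (cases p) (auto simp: moebius_None moebius_Some eval_point_A1[OF av] at_fraction_A1)

text \<open>The factor \<open>c\<close> is the value of the homogeneous coordinate used to normalise
  the image: \<open>den A\<close> if it does not vanish at \<open>p\<close>, and
  \<open>num A\<close> if the image is infinity. For \<open>p = None\<close> these coordinates are
  the entries in the first column of \<open>A\<close>.\<close>

lemma form_norm_moebius:
  assumes p: "p \<in> P1 av" and A: "invertible A"
  obtains c where "c > 0" "\<And>n P. Polynomial.degree P \<le> n \<Longrightarrow>
    form_norm av p n (subst_form A n P) = c ^ n * form_norm av (moebius av A p) n P"
proof (cases p)
  case (Some x)
  then have x: "x \<in> A1 av" using p by simp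
  interpret x: mult_seminorm x using seminorm[OF x] .
  show ?thesis
  proof (cases "x (den A) = 0")
    case False
    show ?thesis
    proof
      show "0 < x (den A)" using False x.nonneg[of "den A"] by simp
      show "form_norm av p n (subst_form A n P) = x (den A) ^ n * form_norm av (moebius av A p) n P"
        if "Polynomial.degree P \<le> n" for n P
        using at_fraction_eq[OF x False that, of "num A"] False
        by (simp add: Some moebius_Some subst_form_def)
    qed
  next
    case True
    show ?thesis
    proof
      show "0 < x (num A)" using num_nonzero_of_den_zero[OF x A True] x.nonneg[of "num A"] by simp
      show "form_norm av p n (subst_form A n P) = x (num A) ^ n * form_norm av (moebius av A p) n P"
        if "Polynomial.degree P \<le> n" for n P
      proof -
        \<comment> \<open>All terms below the top one contain the factor \<open>den A\<close>, which
          \<open>x\<close> kills. Only the top coefficient of \<open>P\<close> survives, and this is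
          its value at infinity.\<close>
        let ?t = "\<lambda>i. Polynomial.smult (Polynomial.coeff P i) (num A ^ i * den A ^ (n - i))"
        have eq: "subst_form A n P = ?t n + (\<Sum>i<n. ?t i)"
          unfolding subst_form_def homogenize_def
          by (simp add: add.commute flip: lessThan_Suc_atMost)
        have "x (\<Sum>i<n. ?t i) \<le> 0"
          using True by (intro x.sum_le) (auto simp: A1_smult[OF x] x.mult x.power power_0_left)
        then have z: "x (\<Sum>i<n. ?t i) = 0" using x.nonneg by (simp add: order_antisym)
        have "x (?t n + (\<Sum>i<n. ?t i)) = x (?t n)"
        proof (cases "x (?t n) = 0")
          case True
          then show ?thesis using x.ultra[of "?t n" "\<Sum>i<n. ?t i"] z x.nonneg by (simp add: order_antisym)
        next
          case False
          then have "x (\<Sum>i<n. ?t i) < x (?t n)" using z x.nonneg[of "?t n"] by linarith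
          then show ?thesis by (rule x.add_eq)
        qed
        then show ?thesis
          by (simp add: Some True moebius_Some eq A1_smult[OF x] x.power)
      qed
    qed
  qed
next
  case None
  show ?thesis
  proof (cases "A $ 2 $ 1 = 0")
    case True
    then have a: "A $ 1 $ 1 \<noteq> 0" using A by (auto simp: invertible_det_nz det_2)
    show ?thesis
    proof
      show "0 < av (A $ 1 $ 1)" using a by (rule av_pos)
      show "form_norm av p n (subst_form A n P) = av (A $ 1 $ 1) ^ n * form_norm av (moebius av A p) n P"
        if "Polynomial.degree P \<le> n" for n P
      proof -
        have "(\<Sum>i\<le>n. Polynomial.coeff P i * (A $ 1 $ 1 ^ i * 0 ^ (n - i))) = Polynomial.coeff P n * A $ 1 $ 1 ^ n"
          by (subst sum.remove[of _ n]) (auto intro!: sum.neutral)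
        then show ?thesis
          using True by (simp add: None subst_form_def coeff_homogenize_top[OF degree_num degree_den] moebius_None av.mult av.power)
      qed
    qed
  next
    case False
    show ?thesis
    proof
      show "0 < av (A $ 2 $ 1)" using False by (rule av_pos)
      show "form_norm av p n (subst_form A n P) = av (A $ 2 $ 1) ^ n * form_norm av (moebius av A p) n P"
        if "Polynomial.degree P \<le> n" for n P
      proof -
        have "(\<Sum>i\<le>n. Polynomial.coeff P i * (A $ 1 $ 1 ^ i * A $ 2 $ 1 ^ (n - i))) =
            A $ 2 $ 1 ^ n * poly P (A $ 1 $ 1 / A $ 2 $ 1)"
          unfolding poly_altdef_le[OF that] sum_distrib_left
          using False by (auto intro!: sum.cong simp: power_divide power_diff field_simps)
        then show ?thesis
          using False by (simp add: None subst_form_def coeff_homogenize_top[OF degree_num degree_den] moebius_None eval_point_def av.mult av.power)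
      qed
    qed
  qed
qed

text \<open>The constant 1, read as a form of degree 1, takes the value 0 at infinity and 1 at every
  finite point. It therefore tells the two kinds of points apart and forces \<open>c = 1\<close> for
  finite ones.\<close>

lemma form_norm_eqD:
  assumes p: "p \<in> P1 av" and q: "q \<in> P1 av" and c: "c > 0"
    and eq: "\<And>n P. Polynomial.degree P \<le> n \<Longrightarrow> form_norm av p n P = c ^ n * form_norm av q n P"
  shows "p = q"
proof -
  have one: "x 1 = 1" if "x \<in> A1 av" for x using mult_seminorm.one[OF seminorm[OF that]] .
  have 1: "form_norm av p 1 1 = c * form_norm av q 1 1" using eq[of 1 1] by simp
  show ?thesis
  proof (cases p)
    case None
    have "q = None"
    proof (rule ccontr)
      assume "q \<noteq> None"
      then obtain y where "q = Some y" by auto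
      then show False using 1 None q one[of y] c by (simp add: av.zero)
    qed
    then show ?thesis using None by simp
  next
    case (Some x)
    then have x: "x \<in> A1 av" using p by simp
    then obtain y where y: "q = Some y" "y \<in> A1 av"
      using 1 q one[of x] Some by (cases q) (auto simp: av.zero)
    then have "c = 1" using 1 Some one[OF x] one[of y] by simp
    then have "x P = y P" for P using eq[of P "Polynomial.degree P"] Some y by simp
    then show ?thesis using Some y by auto
  qed
qed

lemma moebius_one: "p \<in> P1 av \<Longrightarrow> moebius av (Finite_Cartesian_Product.mat 1) p = p"
proof -
  assume p: "p \<in> P1 av"
  obtain c where "c > 0" and eq: "\<And>n P. Polynomial.degree P \<le> n \<Longrightarrow>
      form_norm av p n (subst_form (Finite_Cartesian_Product.mat 1) n P) =
      c ^ n * form_norm av (moebius av (Finite_Cartesian_Product.mat 1) p) n P"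
    using form_norm_moebius[OF p, of "Finite_Cartesian_Product.mat 1"]
    by (auto simp: invertible_det_nz)
  have "p = moebius av (Finite_Cartesian_Product.mat 1) p"
    by (rule form_norm_eqD[OF p moebius_in_P1[OF p] \<open>c > 0\<close>]) (use eq in \<open>simp add: subst_form_one\<close>)
  then show ?thesis by simp
qed

text \<open>Both sides give the same norm on forms up to rescaling, with a constant assembled from
  the three normalising factors; poles of \<open>A\<close>, \<open>B\<close> or the product require
  no separate treatment.\<close>

lemma moebius_mult:
  assumes p: "p \<in> P1 av" and A: "invertible A" and B: "invertible B"
  shows "moebius av (A ** B) p = moebius av A (moebius av B p)"
proof -
  let ?q = "moebius av B p"
  have q: "?q \<in> P1 av" using moebius_in_P1[OF p] .
  have AB: "invertible (A ** B)" using A B by (rule invertible_mult)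
  obtain b where b: "b > 0" "\<And>n P. Polynomial.degree P \<le> n \<Longrightarrow>
      form_norm av p n (subst_form B n P) = b ^ n * form_norm av ?q n P"
    using form_norm_moebius[OF p B] by blast
  obtain a where a: "a > 0" "\<And>n P. Polynomial.degree P \<le> n \<Longrightarrow>
      form_norm av ?q n (subst_form A n P) = a ^ n * form_norm av (moebius av A ?q) n P"
    using form_norm_moebius[OF q A] by blast
  obtain c where c: "c > 0" "\<And>n P. Polynomial.degree P \<le> n \<Longrightarrow>
      form_norm av p n (subst_form (A ** B) n P) = c ^ n * form_norm av (moebius av (A ** B) p) n P"
    using form_norm_moebius[OF p AB] by blast
  show ?thesis
  proof (rule form_norm_eqD[OF moebius_in_P1[OF p] moebius_in_P1[OF q]])
    show "0 < a * b / c" using a b c by simp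
    show "form_norm av (moebius av (A ** B) p) n P = (a * b / c) ^ n * form_norm av (moebius av A ?q) n P"
      if P: "Polynomial.degree P \<le> n" for n P
    proof -
      have "c ^ n * form_norm av (moebius av (A ** B) p) n P = b ^ n * (a ^ n * form_norm av (moebius av A ?q) n P)"
        using b(2)[OF degree_subst_form[of A n P]] a(2)[OF P] c(2)[OF P] by (simp add: subst_form_mult)
      then show ?thesis using c(1) by (simp add: power_divide power_mult_distrib field_simps)
    qed
  qed
qed

end

section \<open>The topology of the projective line\<close>

lemma continuous_map_A1_eval: "continuous_map (A1_top av) euclideanreal (\<lambda>x. x P)"
proof (clarsimp simp: continuous_map topspace_A1_top)
  fix U :: "real set" assume "open U"
  then show "openin (A1_top av) {x \<in> A1 av. x P \<in> U}"
    unfolding A1_top_def by (intro topology_generated_by_Basis) blast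
qed

lemma continuous_map_into_A1:
  assumes f: "\<And>z. z \<in> topspace Y \<Longrightarrow> f z \<in> A1 av"
    and cont: "\<And>P. continuous_map Y euclideanreal (\<lambda>z. f z P)"
  shows "continuous_map Y (A1_top av) f"
  unfolding A1_top_def
proof (rule continuous_on_generated_topo)
  have "A1 av = {x \<in> A1 av. x 0 \<in> (UNIV :: real set)}" by simp
  then have "A1 av \<subseteq> \<Union>{{x \<in> A1 av. x P \<in> U} |P U. open U}" by blast
  then show "f ` topspace Y \<subseteq> \<Union>{{x \<in> A1 av. x P \<in> U} |P U. open U}" using f by blast
next
  fix W assume "W \<in> {{x \<in> A1 av. x P \<in> U} |P U. open U}"
  then obtain P U where W: "W = {x \<in> A1 av. x P \<in> U}" "open U" by blast
  have "f -` W \<inter> topspace Y = {z \<in> topspace Y. f z P \<in> U}" using f by (auto simp: W)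
  then show "openin Y (f -` W \<inter> topspace Y)"
    using openin_continuous_map_preimage[OF cont, of U P] W(2) by simp
qed

lemma openin_A1_less:
  assumes "continuous_map (A1_top av) euclideanreal f" "continuous_map (A1_top av) euclideanreal g"
  shows "openin (A1_top av) {x \<in> A1 av. f x < g x}"
proof -
  have "continuous_map (A1_top av) euclideanreal (\<lambda>x. g x - f x)"
    using assms by (intro continuous_map_diff)
  then have "openin (A1_top av) {x \<in> topspace (A1_top av). g x - f x \<in> {0<..}}"
    by (rule openin_continuous_map_preimage) simp
  then show ?thesis by (simp add: topspace_A1_top)
qed

lemma openin_A1_nonzero: "openin (A1_top av) {x \<in> A1 av. x P \<noteq> 0}"
  using openin_continuous_map_preimage[OF continuous_map_A1_eval[of av P], of "- {0}"]
  by (simp add: topspace_A1_top open_Compl)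

definition swap_matrix :: "'k::field ^ 2 ^ 2" where
  "swap_matrix = vector [vector [0, 1], vector [1, 0]]"

lemma swap_matrix_nth [simp]:
  "swap_matrix $ 1 $ 1 = 0" "swap_matrix $ 1 $ 2 = 1" "swap_matrix $ 2 $ 1 = 1" "swap_matrix $ 2 $ 2 = 0"
  by (simp_all add: swap_matrix_def)

lemma invertible_swap_matrix: "invertible (swap_matrix :: 'k::field ^ 2 ^ 2)"
  by (simp add: invertible_det_nz det_2)

lemma swap_matrix_involutive: "swap_matrix ** swap_matrix = (Finite_Cartesian_Product.mat 1 :: 'k::field ^ 2 ^ 2)"
  by (simp add: vec_eq_iff matrix_matrix_mult_def sum_2 forall_2 Finite_Cartesian_Product.mat_def)

lemma num_swap_mult: "num (swap_matrix ** A) = den A"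
  and den_swap_mult: "den (swap_matrix ** A) = num A"
  by (simp_all add: num_def den_def matrix_matrix_mult_def sum_2)

text \<open>The second chart is the first one followed by \<open>T \<mapsto> 1/T\<close>, so
  statements about it become statements about the action of one matrix.\<close>

lemma chart_inf_eq: "chart_inf y = moebius av swap_matrix (Some y)"
  by (simp add: chart_inf_def moebius_Some num_def den_def flip: one_pCons)

section \<open>Continuity of the action, separation of points, and closed discs\<close>

context nonarch_field
begin

lemma continuous_map_at_fraction:
  "continuous_map (subtopology (A1_top av) {x. x D \<noteq> 0}) (A1_top av) (\<lambda>x. at_fraction x N D)"
proof (rule continuous_map_into_A1)
  fix x assume "x \<in> topspace (subtopology (A1_top av) {x. x D \<noteq> 0})"
  then show "at_fraction x N D \<in> A1 av" by (auto simp: topspace_A1_top at_fraction_A1)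
next
  fix P
  show "continuous_map (subtopology (A1_top av) {x. x D \<noteq> 0}) euclideanreal (\<lambda>x. at_fraction x N D P)"
    unfolding at_fraction_homogenize
    by (intro continuous_map_real_divide continuous_map_real_pow continuous_map_from_subtopology
        continuous_map_A1_eval) auto
qed

lemma openin_at_fraction_preimage:
  assumes "openin (A1_top av) W"
  shows "openin (A1_top av) {x \<in> A1 av. x D \<noteq> 0 \<and> at_fraction x N D \<in> W}"
proof -
  have "openin (subtopology (A1_top av) {x \<in> A1 av. x D \<noteq> 0})
      {x \<in> topspace (subtopology (A1_top av) {x \<in> A1 av. x D \<noteq> 0}). at_fraction x N D \<in> W}"
    using openin_continuous_map_preimage[OF continuous_map_from_subtopology_mono[OF
      continuous_map_at_fraction[of D N], of "{x \<in> A1 av. x D \<noteq> 0}"] assms] by blast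
  then have "openin (A1_top av)
      {x \<in> topspace (subtopology (A1_top av) {x \<in> A1 av. x D \<noteq> 0}). at_fraction x N D \<in> W}"
    using openin_trans_full openin_A1_nonzero by blast
  moreover have "{x \<in> topspace (subtopology (A1_top av) {x \<in> A1 av. x D \<noteq> 0}). at_fraction x N D \<in> W}
      = {x \<in> A1 av. x D \<noteq> 0 \<and> at_fraction x N D \<in> W}"
    by (auto simp: topspace_A1_top)
  ultimately show ?thesis by simp
qed

lemma chart_inf_in_P1: "y \<in> A1 av \<Longrightarrow> chart_inf y \<in> P1 av"
  using moebius_in_P1[of "Some y" swap_matrix] by (simp flip: chart_inf_eq)

lemma topspace_P1_top: "topspace (P1_top av) = P1 av"
proof -
  have "openin (P1_top av) (P1 av)"
    by (auto simp: openin_P1_top chart_inf_in_P1 topspace_A1_top[symmetric] intro: openin_topspace cong: conj_cong)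
  moreover have "topspace (P1_top av) \<subseteq> P1 av"
    using openin_topspace[of "P1_top av"] openin_P1_top by blast
  ultimately show ?thesis using openin_subset by blast
qed

lemma moebius_swap_swap: "p \<in> P1 av \<Longrightarrow> moebius av swap_matrix (moebius av swap_matrix p) = p"
  using moebius_mult[of p swap_matrix swap_matrix]
  by (simp add: invertible_swap_matrix swap_matrix_involutive moebius_one)

text \<open>The open sets where \<open>den A\<close> and where \<open>num A\<close> does not vanish
  cover the affine line, by invertibility. On the first the image is read in the standard chart, on
  the second in the chart at infinity.\<close>

lemma openin_moebius_Some_preimage:
  assumes U: "openin (P1_top av) U" and A: "invertible A"
  shows "openin (A1_top av) {x \<in> A1 av. moebius av A (Some x) \<in> U}"
proof -
  define U0 where "U0 = {x \<in> A1 av. Some x \<in> U}"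
  define U1 where "U1 = {y \<in> A1 av. chart_inf y \<in> U}"
  have op: "openin (A1_top av) U0" "openin (A1_top av) U1"
    using U by (auto simp: openin_P1_top U0_def U1_def)
  have other: "moebius av A (Some x) = chart_inf (at_fraction x (den A) (num A))"
    if x: "x \<in> A1 av" and N: "x (num A) \<noteq> 0" for x
  proof -
    have "moebius av A (Some x) = moebius av swap_matrix (moebius av (swap_matrix ** A) (Some x))"
      using moebius_mult[OF _ invertible_swap_matrix A, of "Some x"] moebius_swap_swap[OF moebius_in_P1, of "Some x" A] x
      by simp
    then show ?thesis using N by (simp add: moebius_Some[of _ "swap_matrix ** A"] num_swap_mult den_swap_mult chart_inf_eq[of _ av])
  qed
  have "{x \<in> A1 av. moebius av A (Some x) \<in> U} =
      {x \<in> A1 av. x (den A) \<noteq> 0 \<and> at_fraction x (num A) (den A) \<in> U0} \<union>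
      {x \<in> A1 av. x (num A) \<noteq> 0 \<and> at_fraction x (den A) (num A) \<in> U1}" (is "?L = ?R0 \<union> ?R1")
  proof (intro equalityI subsetI)
    fix x assume L: "x \<in> ?L"
    show "x \<in> ?R0 \<union> ?R1"
    proof (cases "x (den A) = 0")
      case True
      then have "x (num A) \<noteq> 0" using num_nonzero_of_den_zero A L by blast
      then have "x \<in> ?R1" using L other[of x] by (simp add: U1_def at_fraction_A1)
      then show ?thesis ..
    next
      case False
      then have "x \<in> ?R0" using L by (simp add: moebius_Some U0_def at_fraction_A1)
      then show ?thesis ..
    qed
  next
    fix x assume "x \<in> ?R0 \<union> ?R1"
    then consider "x \<in> ?R0" | "x \<in> ?R1" by blast
    then show "x \<in> ?L"
    proof cases
      case 1
      then show ?thesis by (simp add: moebius_Some U0_def)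
    next
      case 2
      then show ?thesis using other[of x] by (simp add: U1_def)
    qed
  qed
  then show ?thesis using op by (auto intro: openin_at_fraction_preimage)
qed

lemma continuous_map_moebius:
  assumes A: "invertible A"
  shows "continuous_map (P1_top av) (P1_top av) (moebius av A)"
  unfolding continuous_map topspace_P1_top
proof (intro conjI allI impI)
  show "moebius av A ` P1 av \<subseteq> P1 av" using moebius_in_P1 by blast
  fix U assume U: "openin (P1_top av) U"
  let ?V = "{p \<in> P1 av. moebius av A p \<in> U}"
  have "{x \<in> A1 av. Some x \<in> ?V} = {x \<in> A1 av. moebius av A (Some x) \<in> U}" by auto
  moreover have "{y \<in> A1 av. chart_inf y \<in> ?V} = {y \<in> A1 av. moebius av (A ** swap_matrix) (Some y) \<in> U}"
    by (auto simp: chart_inf_in_P1) (auto simp: chart_inf_eq[of _ av] moebius_mult A invertible_swap_matrix)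
  ultimately show "openin (P1_top av) ?V"
    using openin_moebius_Some_preimage[OF U A]
      openin_moebius_Some_preimage[OF U invertible_mult[OF A invertible_swap_matrix]]
    by (auto simp: openin_P1_top)
qed

lemma continuous_map_Some: "continuous_map (A1_top av) (P1_top av) Some"
  unfolding continuous_map topspace_P1_top topspace_A1_top by (auto simp: openin_P1_top)

lemma openin_Some_image:
  assumes "openin (A1_top av) W"
  shows "openin (P1_top av) (Some ` W)"
proof -
  have W: "W \<subseteq> A1 av" using openin_subset[OF assms] by (simp add: topspace_A1_top)
  then have "{x \<in> A1 av. Some x \<in> Some ` W} = W" by auto
  moreover have "{y \<in> A1 av. chart_inf y \<in> Some ` W} =
      {y \<in> A1 av. y [:0, 1:] \<noteq> 0 \<and> at_fraction y 1 [:0, 1:] \<in> W}"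
    by (auto simp: chart_inf_def)
  ultimately show ?thesis
    using W assms openin_at_fraction_preimage[OF assms] by (auto simp: openin_P1_top)
qed

lemma moebius_swap_Some: "moebius av swap_matrix (Some y) = (if y [:0, 1:] = 0 then None else Some (at_fraction y 1 [:0, 1:]))"
  by (simp flip: chart_inf_eq add: chart_inf_def)

lemma at_fraction_swap_linear:
  "y \<in> A1 av \<Longrightarrow> y [:0, 1:] \<noteq> 0 \<Longrightarrow> at_fraction y 1 [:0, 1:] [:b, a:] = y [:a, b:] / y [:0, 1:]"
  using at_fraction_eq[of y "[:0, 1:]" "[:b, a:]" 1 1]
  by (simp add: homogenize_linear[unfolded One_nat_def])

lemma Hausdorff_A1: "Hausdorff_space (A1_top av)"
  unfolding Hausdorff_space_def topspace_A1_top
proof (intro allI impI)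
  fix x y assume *: "x \<in> A1 av \<and> y \<in> A1 av \<and> x \<noteq> y"
  then obtain P where "x P \<noteq> y P" by auto
  then obtain U V where UV: "open U" "open V" "x P \<in> U" "y P \<in> V" "U \<inter> V = {}"
    using hausdorff by metis
  have op: "openin (A1_top av) {z \<in> A1 av. z P \<in> S}" if "open S" for S
    using openin_continuous_map_preimage[OF continuous_map_A1_eval[of av P], of S] that
    by (simp add: topspace_A1_top)
  show "\<exists>U V. openin (A1_top av) U \<and> openin (A1_top av) V \<and> x \<in> U \<and> y \<in> V \<and> disjnt U V"
    using UV * op[OF UV(1)] op[OF UV(2)]
    by (intro exI[of _ "{z \<in> A1 av. z P \<in> U}"] exI[of _ "{z \<in> A1 av. z P \<in> V}"]) (auto simp: disjnt_def)
qed

lemma mem_moebius_image_iff: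
  assumes A: "invertible A" "invertible B" "B ** A = Finite_Cartesian_Product.mat 1"
    and S: "S \<subseteq> P1 av" and p: "p \<in> P1 av"
  shows "p \<in> moebius av A ` S \<longleftrightarrow> moebius av B p \<in> S"
proof
  have AB: "A ** B = Finite_Cartesian_Product.mat 1" using A(3) matrix_left_right_inverse by blast
  show "moebius av B p \<in> S" if "p \<in> moebius av A ` S"
    using that S moebius_mult[OF _ A(2,1)] by (auto simp: A(3) moebius_one subset_iff)
  show "p \<in> moebius av A ` S" if "moebius av B p \<in> S"
    using that moebius_mult[OF p A(1,2)] by (auto simp: AB moebius_one p intro!: image_eqI[of _ _ "moebius av B p"])
qed

lemma openin_moebius_image:
  assumes A: "invertible A" and U: "openin (P1_top av) U"
  shows "openin (P1_top av) (moebius av A ` U)"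
proof -
  obtain B where B: "A ** B = Finite_Cartesian_Product.mat 1" "B ** A = Finite_Cartesian_Product.mat 1"
    using A unfolding invertible_def by blast
  then have iB: "invertible B" unfolding invertible_def by blast
  have U': "U \<subseteq> P1 av" using openin_subset[OF U] by (simp add: topspace_P1_top)
  have "moebius av A ` U = {p \<in> P1 av. moebius av B p \<in> U}"
    using mem_moebius_image_iff[OF A iB B(2) U'] moebius_in_P1 U' by blast
  then show ?thesis
    using openin_continuous_map_preimage[OF continuous_map_moebius[OF iB] U] by (simp add: topspace_P1_top)
qed

text \<open>The disc \<open>|T| < R\<close> contains \<open>x\<close> as soon as \<open>R\<close>
  exceeds the value of \<open>T\<close> at \<open>x\<close>. Inverting the disc of radius
  \<open>1 / R\<close> around 0 gives the neighbourhood \<open>|T| > R\<close> of infinity.\<close>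

lemma separate_None_Some:
  assumes x: "x \<in> A1 av"
  shows "\<exists>U V. openin (P1_top av) U \<and> openin (P1_top av) V \<and> None \<in> U \<and> Some x \<in> V \<and> disjnt U V"
proof -
  define R where "R = x [:0, 1:] + 1"
  have R: "0 < R" using A1_nonneg[OF x, of "[:0, 1:]"] by (simp add: R_def)
  define U where "U = moebius av swap_matrix ` Some ` {y \<in> A1 av. y [:0, 1:] < 1 / R}"
  define V where "V = Some ` {y \<in> A1 av. y [:0, 1:] < R}"
  have "openin (P1_top av) V" unfolding V_def
    by (intro openin_Some_image openin_A1_less continuous_map_A1_eval) simp
  moreover have "openin (P1_top av) U" unfolding U_def
    by (intro openin_moebius_image invertible_swap_matrix openin_Some_image openin_A1_less continuous_map_A1_eval) simp
  moreover have "None \<in> U"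
  proof -
    have "eval_point av 0 [:0, 1:] < 1 / R" using R by (simp add: eval_point_def av.zero)
    then have "Some (eval_point av 0) \<in> Some ` {y \<in> A1 av. y [:0, 1:] < 1 / R}"
      using eval_point_A1[OF av] by blast
    then have "moebius av swap_matrix (Some (eval_point av 0)) \<in> U"
      unfolding U_def by (rule imageI)
    then show ?thesis by (simp add: moebius_swap_Some eval_point_def)
  qed
  moreover have "Some x \<in> V" using x by (auto simp: V_def R_def)
  moreover have "disjnt U V"
  proof -
    have False if y: "y \<in> A1 av" "y [:0, 1:] < 1 / R" "y [:0, 1:] \<noteq> 0"
      and lt: "at_fraction y 1 [:0, 1:] [:0, 1:] < R" for y
    proof -
      have pos: "0 < y [:0, 1:]" using y A1_nonneg[OF y(1), of "[:0, 1:]"] by simp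
      have "at_fraction y 1 [:0, 1:] [:0, 1:] = 1 / y [:0, 1:]"
        using at_fraction_swap_linear[OF y(1,3), of 0 1] A1_const[OF y(1), of 1] av.one by simp
      then have "1 < R * y [:0, 1:]" using lt pos by (simp add: pos_divide_less_eq)
      then show False using y(2) R by (simp add: pos_less_divide_eq mult.commute)
    qed
    then have "p \<notin> V" if "p \<in> U" for p
      using that by (auto simp: U_def V_def moebius_swap_Some split: if_splits)
    then show ?thesis by (auto simp: disjnt_def)
  qed
  ultimately show ?thesis by blast
qed

lemma Hausdorff_P1: "Hausdorff_space (P1_top av)"
  unfolding Hausdorff_space_def topspace_P1_top
proof (intro allI impI)
  fix p q assume *: "p \<in> P1 av \<and> q \<in> P1 av \<and> p \<noteq> q"
  show "\<exists>U V. openin (P1_top av) U \<and> openin (P1_top av) V \<and> p \<in> U \<and> q \<in> V \<and> disjnt U V"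
  proof (cases p; cases q)
    fix x y assume [simp]: "p = Some x" "q = Some y"
    then obtain U V where "openin (A1_top av) U" "openin (A1_top av) V" "x \<in> U" "y \<in> V" "disjnt U V"
      using Hausdorff_A1 * unfolding Hausdorff_space_def topspace_A1_top by (metis Some_in_P1)
    then show ?thesis
      by (intro exI[of _ "Some ` U"] exI[of _ "Some ` V"]) (auto simp: openin_Some_image disjnt_def)
  next
    fix x assume "p = None" "q = Some x"
    then show ?thesis using separate_None_Some[of x] * by simp
  next
    fix x assume "p = Some x" "q = None"
    then show ?thesis using separate_None_Some[of x] * disjnt_sym by (metis Some_in_P1)
  qed (use * in simp)
qed

text \<open>Written homogeneously the condition is unchanged by rescaling, so it can be transported
  by matrices, and it also makes sense at infinity, where it reads \<open>1 < r * 0\<close> and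
  fails.\<close>

lemma mem_open_disc_iff:
  "p \<in> P1 av \<Longrightarrow> p \<in> open_disc_A1 av a r \<longleftrightarrow> form_norm av p 1 [:- a, 1:] < r * form_norm av p 1 1"
  by (cases p) (auto simp: open_disc_A1_def av.one av.zero mult_seminorm.one[OF seminorm])

lemma mem_closed_disc_iff:
  "p \<in> P1 av \<Longrightarrow> p \<in> closed_disc_A1 av a r \<longleftrightarrow> form_norm av p 1 [:- a, 1:] \<le> r * form_norm av p 1 1"
  by (cases p) (auto simp: closed_disc_A1_def av.one av.zero mult_seminorm.one[OF seminorm])

lemma open_disc_subset_P1: "open_disc_A1 av a r \<subseteq> P1 av"
  and closed_disc_subset_P1: "closed_disc_A1 av a r \<subseteq> P1 av"
  by (auto simp: open_disc_A1_def closed_disc_A1_def)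

lemma closedin_closed_disc: "closedin (P1_top av) (closed_disc_A1 av a r)"
proof -
  have "openin (P1_top av) (P1 av - closed_disc_A1 av a r)"
    unfolding openin_P1_top
  proof (intro conjI)
    have "{x \<in> A1 av. Some x \<in> P1 av - closed_disc_A1 av a r} = {x \<in> A1 av. r < x [:- a, 1:]}"
      by (auto simp: closed_disc_A1_def)
    then show "openin (A1_top av) {x \<in> A1 av. Some x \<in> P1 av - closed_disc_A1 av a r}"
      using openin_A1_less[of av "\<lambda>_. r" "\<lambda>x. x [:- a, 1:]"] by (simp add: continuous_map_A1_eval)
    \<comment> \<open>Multiplying \<open>|1/T' - a| > r\<close> by \<open>|T'|\<close> yields a
      condition that remains meaningful at \<open>T' = 0\<close>, the point at infinity.\<close>
    have "chart_inf y \<in> P1 av - closed_disc_A1 av a r \<longleftrightarrow> r * y [:0, 1:] < y [:1, - a:]"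
      if y: "y \<in> A1 av" for y
    proof -
      obtain c where c: "c > 0" "\<And>n P. Polynomial.degree P \<le> n \<Longrightarrow>
          form_norm av (Some y) n (subst_form swap_matrix n P) = c ^ n * form_norm av (chart_inf y) n P"
        using form_norm_moebius[of "Some y" swap_matrix] y invertible_swap_matrix by (auto simp: chart_inf_eq[of _ av])
      have "y [:1, - a:] = c * form_norm av (chart_inf y) 1 [:- a, 1:]"
        using c(2)[of "[:- a, 1:]" 1] by (simp add: subst_form_linear[unfolded One_nat_def] num_def den_def)
      moreover have "y [:0, 1:] = c * form_norm av (chart_inf y) 1 1"
      proof -
        have "subst_form swap_matrix 1 1 = [:0, 1:]"
          using subst_form_linear[of swap_matrix 1 0] by (simp add: den_def one_pCons)
        then show ?thesis using c(2)[of 1 1] by (metis degree_1 form_norm_simps(2) power_one_right zero_le)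
      qed
      ultimately show ?thesis
        using c(1) chart_inf_in_P1[OF y] by (simp add: mem_closed_disc_iff not_le mult.left_commute del: One_nat_def)
    qed
    then have "{y \<in> A1 av. chart_inf y \<in> P1 av - closed_disc_A1 av a r} =
        {y \<in> A1 av. r * y [:0, 1:] < y [:1, - a:]}" by blast
    then show "openin (A1_top av) {y \<in> A1 av. chart_inf y \<in> P1 av - closed_disc_A1 av a r}"
      using openin_A1_less[of av "\<lambda>y. r * y [:0, 1:]" "\<lambda>y. y [:1, - a:]"]
      by (simp add: continuous_map_A1_eval continuous_map_real_mult_left)
  qed auto
  then show ?thesis by (simp add: closedin_def topspace_P1_top closed_disc_subset_P1)
qed

lemma closedin_moebius_image:
  assumes A: "invertible A" and C: "closedin (P1_top av) C"
  shows "closedin (P1_top av) (moebius av A ` C)"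
proof -
  obtain B where B: "A ** B = Finite_Cartesian_Product.mat 1" "B ** A = Finite_Cartesian_Product.mat 1"
    using A unfolding invertible_def by blast
  then have iB: "invertible B" unfolding invertible_def by blast
  have C': "C \<subseteq> P1 av" using closedin_subset[OF C] by (simp add: topspace_P1_top)
  have "moebius av A ` C = {p \<in> P1 av. moebius av B p \<in> C}"
    using mem_moebius_image_iff[OF A iB B(2) C'] moebius_in_P1 C' by blast
  then show ?thesis
    using closedin_continuous_map_preimage[OF continuous_map_moebius[OF iB] C] by (simp add: topspace_P1_top)
qed

end

section \<open>Gauss norms and paths\<close>

text \<open>The coefficient ring is arbitrary because two cases occur: coefficients in
  \<open>k\<close>, giving the Gauss points of discs, and coefficients in \<open>k[T]\<close>,
  giving the paths.\<close>

definition gauss :: "('r::comm_ring_1 \<Rightarrow> real) \<Rightarrow> real \<Rightarrow> 'r poly \<Rightarrow> real" where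
  "gauss x t Q = Max ((\<lambda>i. x (Polynomial.coeff Q i) * t ^ i) ` {..Polynomial.degree Q})"

lemma gauss_attained: "\<exists>i. gauss x t Q = x (Polynomial.coeff Q i) * t ^ i"
proof -
  have "gauss x t Q \<in> (\<lambda>i. x (Polynomial.coeff Q i) * t ^ i) ` {..Polynomial.degree Q}"
    unfolding gauss_def by (rule Max_in) auto
  then show ?thesis by blast
qed

context mult_seminorm
begin

lemma gauss_ge:
  assumes "0 \<le> t"
  shows "x (Polynomial.coeff Q i) * t ^ i \<le> gauss x t Q"
proof (cases "i \<le> Polynomial.degree Q")
  case True
  then show ?thesis unfolding gauss_def by (intro Max_ge) auto
next
  case False
  have "x (Polynomial.coeff Q 0) * t ^ 0 \<le> gauss x t Q"
    unfolding gauss_def by (intro Max_ge finite_imageI imageI) simp_all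
  then have "0 \<le> gauss x t Q" using nonneg[of "Polynomial.coeff Q 0"] by simp
  then show ?thesis using False by (simp add: coeff_eq_0 zero)
qed

lemma gauss_le: "(\<And>i. x (Polynomial.coeff Q i) * t ^ i \<le> c) \<Longrightarrow> gauss x t Q \<le> c"
  using gauss_attained[of x t Q] by auto

lemma gauss_nonneg: "0 \<le> t \<Longrightarrow> 0 \<le> gauss x t Q"
  using gauss_ge[of t Q 0] nonneg[of "Polynomial.coeff Q 0"] by simp

lemma gauss_const: "0 \<le> t \<Longrightarrow> gauss x t [:c:] = x c"
  by (simp add: gauss_def)

lemma gauss_linear:
  assumes "0 \<le> t"
  shows "gauss x t [:b, a:] = max (x b) (x a * t)"
proof (rule antisym)
  show "gauss x t [:b, a:] \<le> max (x b) (x a * t)"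
    using nonneg by (intro gauss_le) (auto simp: coeff_pCons zero le_max_iff_disj split: nat.split)
  show "max (x b) (x a * t) \<le> gauss x t [:b, a:]"
    using gauss_ge[OF assms, of "[:b, a:]" 0] gauss_ge[OF assms, of "[:b, a:]" 1] by simp
qed

lemma gauss_zero_radius: "gauss x 0 Q = x (Polynomial.coeff Q 0)"
proof (rule antisym)
  show "gauss x 0 Q \<le> x (Polynomial.coeff Q 0)"
    by (intro gauss_le) (auto simp: power_0_left nonneg)
  show "x (Polynomial.coeff Q 0) \<le> gauss x 0 Q" using gauss_ge[of 0 Q 0] by simp
qed

lemma gauss_least_index:
  obtains i where "x (Polynomial.coeff Q i) * t ^ i = gauss x t Q"
    "\<And>k. k < i \<Longrightarrow> x (Polynomial.coeff Q k) * t ^ k \<noteq> gauss x t Q"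
proof -
  let ?R = "\<lambda>i. x (Polynomial.coeff Q i) * t ^ i = gauss x t Q"
  have "\<exists>i. ?R i" using gauss_attained[of x t Q] by metis
  then have "?R (LEAST i. ?R i)" by (rule LeastI_ex)
  then show ?thesis using that not_less_Least[of _ ?R] by blast
qed

text \<open>
  Gauss's lemma: in the product of \<open>P\<close> and \<open>Q\<close> the coefficient whose index is the sum of the least
  indices at which \<open>P\<close> and \<open>Q\<close> attain their norms has a single dominant summand.
\<close>

lemma gauss_mult:
  assumes t: "0 < t"
  shows "gauss x t (P * Q) = gauss x t P * gauss x t Q"
proof (rule antisym)
  let ?M = "gauss x t P" and ?N = "gauss x t Q"
  have M: "0 \<le> ?M" and N: "0 \<le> ?N" using t by (simp_all add: gauss_nonneg)
  note geP = gauss_ge[OF less_imp_le[OF t], of P] and geQ = gauss_ge[OF less_imp_le[OF t], of Q]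
  have nn: "0 \<le> x c * t ^ k" for c k using t nonneg by simp
  have split: "x (Polynomial.coeff P k * Polynomial.coeff Q (n - k)) * t ^ n =
      (x (Polynomial.coeff P k) * t ^ k) * (x (Polynomial.coeff Q (n - k)) * t ^ (n - k))"
    if "k \<le> n" for k n
  proof -
    have "t ^ n = t ^ k * t ^ (n - k)" using that by (simp flip: power_add)
    then show ?thesis by (simp add: mult)
  qed
  show "gauss x t (P * Q) \<le> ?M * ?N"
  proof (rule gauss_le)
    fix n
    have "x (Polynomial.coeff (P * Q) n) \<le> ?M * ?N / t ^ n"
      unfolding coeff_mult
    proof (rule sum_le)
      fix k assume "k \<in> {..n}"
      then have "x (Polynomial.coeff P k * Polynomial.coeff Q (n - k)) * t ^ n \<le> ?M * ?N"
        using mult_mono[OF geP[of k] geQ[of "n - k"] M nn] by (simp add: split)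
      then show "x (Polynomial.coeff P k * Polynomial.coeff Q (n - k)) \<le> ?M * ?N / t ^ n"
        using t by (simp add: pos_le_divide_eq)
    qed (use t M N in simp)
    then show "x (Polynomial.coeff (P * Q) n) * t ^ n \<le> ?M * ?N"
      using t by (simp add: pos_le_divide_eq)
  qed
  show "?M * ?N \<le> gauss x t (P * Q)"
  proof (cases "?M = 0 \<or> ?N = 0")
    case True
    then show ?thesis using gauss_nonneg[of t "P * Q"] t by auto
  next
    case False
    then have pos: "0 < ?M" "0 < ?N" using M N by auto
    obtain i where i: "x (Polynomial.coeff P i) * t ^ i = ?M"
      "\<And>k. k < i \<Longrightarrow> x (Polynomial.coeff P k) * t ^ k \<noteq> ?M" by (rule gauss_least_index[of P t]) blast
    obtain j where j: "x (Polynomial.coeff Q j) * t ^ j = ?N"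
      "\<And>k. k < j \<Longrightarrow> x (Polynomial.coeff Q k) * t ^ k \<noteq> ?N" by (rule gauss_least_index[of Q t]) blast
    let ?n = "i + j"
    let ?f = "\<lambda>k. Polynomial.coeff P k * Polynomial.coeff Q (?n - k)"
    have fi: "x (?f i) * t ^ ?n = ?M * ?N" using split[of i ?n] i(1) j(1) by simp
    have "x (?f k) < ?M * ?N / t ^ ?n" if k: "k \<in> {..?n} - {i}" for k
    proof -
      consider "k < i" | "?n - k < j" "k \<le> ?n" using k by fastforce
      then have "(x (Polynomial.coeff P k) * t ^ k) * (x (Polynomial.coeff Q (?n - k)) * t ^ (?n - k)) < ?M * ?N"
      proof cases
        case 1
        then have "x (Polynomial.coeff P k) * t ^ k < ?M" using i(2) geP[of k] by force
        then have "x (Polynomial.coeff P k) * t ^ k * ?N < ?M * ?N"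
          using pos by (intro mult_strict_right_mono)
        then show ?thesis
          using mult_left_mono[OF geQ[of "?n - k"] nn[of "Polynomial.coeff P k" k]] by linarith
      next
        case 2
        then have "x (Polynomial.coeff Q (?n - k)) * t ^ (?n - k) < ?N" using j(2) geQ[of "?n - k"] by force
        then have "?M * (x (Polynomial.coeff Q (?n - k)) * t ^ (?n - k)) < ?M * ?N"
          using pos by (intro mult_strict_left_mono)
        then show ?thesis
          using mult_right_mono[OF geP[of k] nn[of "Polynomial.coeff Q (?n - k)" "?n - k"]] by linarith
      qed
      then show ?thesis using k split[of k ?n] t by (simp add: pos_less_divide_eq)
    qed
    then have "x (sum ?f ({..?n} - {i})) < ?M * ?N / t ^ ?n"
      using pos t by (intro sum_less) auto
    moreover have "x (?f i) = ?M * ?N / t ^ ?n" using fi t by (simp add: eq_divide_eq)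
    ultimately have "x (sum ?f ({..?n} - {i})) < x (?f i)" by simp
    then have "x (?f i + sum ?f ({..?n} - {i})) = x (?f i)" by (rule add_eq)
    moreover have "Polynomial.coeff (P * Q) ?n = ?f i + sum ?f ({..?n} - {i})"
      unfolding coeff_mult by (rule sum.remove) auto
    ultimately have "x (Polynomial.coeff (P * Q) ?n) * t ^ ?n = ?M * ?N" using fi by simp
    then show ?thesis using gauss_ge[of t "P * Q" ?n] t by simp
  qed
qed

lemma gauss_seminorm:
  assumes t: "0 < t"
  shows "mult_seminorm (gauss x t)"
proof
  fix P Q :: "'r poly"
  show "0 \<le> gauss x t P" using t by (simp add: gauss_nonneg)
  show "gauss x t (P * Q) = gauss x t P * gauss x t Q" using t by (rule gauss_mult)
  show "gauss x t (P + Q) \<le> max (gauss x t P) (gauss x t Q)"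
  proof (rule gauss_le)
    fix i
    have "x (Polynomial.coeff P i + Polynomial.coeff Q i) * t ^ i
        \<le> max (x (Polynomial.coeff P i)) (x (Polynomial.coeff Q i)) * t ^ i"
      using t by (intro mult_right_mono ultra) simp
    also have "\<dots> = max (x (Polynomial.coeff P i) * t ^ i) (x (Polynomial.coeff Q i) * t ^ i)"
      using t by (simp add: max_mult_distrib_right)
    also have "\<dots> \<le> max (gauss x t P) (gauss x t Q)"
      using t by (intro max.mono gauss_ge) simp_all
    finally show "x (Polynomial.coeff (P + Q) i) * t ^ i \<le> max (gauss x t P) (gauss x t Q)" by simp
  qed
  show "gauss x t 1 = 1" using gauss_const[of t 1] t by (simp add: one flip: one_pCons)
  show "gauss x t 0 = 0" by (simp add: gauss_def zero)
qed

text \<open>The shifted variable still has Gauss norm \<open>t\<close>, so each term of the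
  expansion in its powers is bounded by the corresponding term of \<open>Q\<close>.\<close>

lemma gauss_pcompose_shift_le:
  assumes t: "0 < t" and u: "x u \<le> t"
  shows "gauss x t (pcompose Q [:u, 1:]) \<le> gauss x t Q"
proof -
  interpret g: mult_seminorm "gauss x t" using gauss_seminorm[OF t] .
  have eq: "pcompose Q [:u, 1:] =
      (\<Sum>i\<le>Polynomial.degree (map_poly (\<lambda>c. [:c:]) Q). [:Polynomial.coeff Q i:] * [:u, 1:] ^ i)"
    by (simp add: pcompose_altdef poly_altdef coeff_map_poly)
  have "gauss x t [:u, 1:] = t" using t u by (simp add: gauss_linear one)
  then show ?thesis
    unfolding eq using t
    by (intro g.sum_le) (simp_all only: g.mult g.power gauss_const less_imp_le gauss_ge gauss_nonneg)
qed

text \<open>The shift by \<open>- u\<close> satisfies the same bound and undoes the shift by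
  \<open>u\<close>, which gives the opposite inequality.\<close>

lemma gauss_pcompose_shift:
  assumes t: "0 < t" and u: "x u \<le> t"
  shows "gauss x t (pcompose Q [:u, 1:]) = gauss x t Q"
proof (rule antisym)
  show "gauss x t (pcompose Q [:u, 1:]) \<le> gauss x t Q" using assms by (rule gauss_pcompose_shift_le)
  have "pcompose (pcompose Q [:u, 1:]) [:- u, 1:] = Q"
    by (simp add: pcompose_pCons flip: pcompose_assoc)
  then show "gauss x t Q \<le> gauss x t (pcompose Q [:u, 1:])"
    using gauss_pcompose_shift_le[of t "- u" "pcompose Q [:u, 1:]"] t u by (simp add: uminus)
qed

end

lemma continuous_on_gauss: "continuous_on S (\<lambda>t. gauss x t Q)"
proof -
  have "continuous_on S (\<lambda>t. Max ((\<lambda>i. x (Polynomial.coeff Q i) * t ^ i) ` I))"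
    if "finite I" "I \<noteq> {}" for I
    using that
  proof (induction I rule: finite_ne_induct)
    case (insert i I)
    have "Max ((\<lambda>i. x (Polynomial.coeff Q i) * t ^ i) ` insert i I) =
        max (x (Polynomial.coeff Q i) * t ^ i) (Max ((\<lambda>i. x (Polynomial.coeff Q i) * t ^ i) ` I))" for t
      using insert by simp
    then show ?case using insert.IH by (simp only:) (intro continuous_intros)
  qed (auto intro!: continuous_intros)
  then show ?thesis unfolding gauss_def by simp
qed

section \<open>Taylor expansion and the paths towards Gauss points\<close>

definition lift_poly :: "'a::comm_ring_1 poly \<Rightarrow> 'a poly poly" where
  "lift_poly P = map_poly (\<lambda>c. [:c:]) P"

lemma coeff_lift_poly: "Polynomial.coeff (lift_poly P) i = [:Polynomial.coeff P i:]"
  by (simp add: lift_poly_def coeff_map_poly)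

lemma lift_poly_add: "lift_poly (P + Q) = lift_poly P + lift_poly Q"
  and lift_poly_smult: "lift_poly (Polynomial.smult c P) = Polynomial.smult [:c:] (lift_poly P)"
  by (simp_all add: poly_eq_iff[where ?'a = "'a poly"] coeff_lift_poly)

lemma lift_poly_pCons: "lift_poly (pCons c P) = pCons [:c:] (lift_poly P)"
  by (simp add: lift_poly_def map_poly_pCons)

lemma lift_poly_0 [simp]: "lift_poly 0 = 0"
  by (simp add: lift_poly_def)

lemma lift_poly_mult: "lift_poly (P * Q) = lift_poly P * lift_poly Q"
  by (induction P) (simp_all add: lift_poly_add lift_poly_smult lift_poly_pCons)

lemma lift_poly_pcompose: "lift_poly (pcompose P Q) = pcompose (lift_poly P) (lift_poly Q)"
  by (induction P) (simp_all add: pcompose_pCons lift_poly_add lift_poly_mult lift_poly_pCons)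

text \<open>The polynomial \<open>P(T + S)\<close> in the variable \<open>S\<close> with coefficients in \<open>k[T]\<close>.\<close>

definition taylor :: "'a::comm_ring_1 poly \<Rightarrow> 'a poly poly" where
  "taylor P = pcompose (lift_poly P) [:[:0, 1:], 1:]"

lemma taylor_add: "taylor (P + Q) = taylor P + taylor Q"
  and taylor_mult: "taylor (P * Q) = taylor P * taylor Q"
  by (simp_all add: taylor_def lift_poly_add lift_poly_mult pcompose_add pcompose_mult)

lemma taylor_const: "taylor [:c:] = [:[:c:]:]"
  by (simp add: taylor_def lift_poly_pCons)

lemma taylor_linear: "taylor [:b, 1:] = [:[:b, 1:], 1:]"
  by (simp add: taylor_def lift_poly_pCons pcompose_pCons one_pCons)

text \<open>Setting \<open>S = 0\<close> in \<open>P(T + S)\<close> recovers \<open>P\<close>; this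
  is why the path of radius 0 starts at the given point.\<close>

lemma coeff_taylor_0: "Polynomial.coeff (taylor P) 0 = P"
proof -
  have "Polynomial.coeff (taylor P) 0 = poly (lift_poly P) [:0, 1:]"
    by (simp add: taylor_def)
  also have "\<dots> = pcompose P [:0, 1:]" by (simp add: lift_poly_def pcompose_altdef)
  finally show ?thesis by simp
qed

text \<open>
  \<open>t \<mapsto> flow x t\<close> is a path which starts at \<open>x\<close> and reaches, at time \<open>s\<close>, the Gauss point of every
  disc of radius \<open>s\<close> that contains \<open>x\<close>. It exists over any \<open>k\<close> and enters no open disc.
\<close>

definition flow :: "('k::field poly \<Rightarrow> real) \<Rightarrow> real \<Rightarrow> 'k poly \<Rightarrow> real" where
  "flow x t P = gauss x t (taylor P)"

definition gauss_point :: "('k::field \<Rightarrow> real) \<Rightarrow> 'k \<Rightarrow> real \<Rightarrow> 'k poly \<Rightarrow> real" where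
  "gauss_point av a r P = gauss av r (pcompose P [:a, 1:])"

context nonarch_field
begin

lemma gauss_point_A1:
  assumes r: "0 < r"
  shows "gauss_point av a r \<in> A1 av"
proof (rule A1_I)
  interpret g: mult_seminorm "gauss av r" using av.gauss_seminorm[OF r] .
  show "mult_seminorm (gauss_point av a r)"
    by unfold_locales (simp_all add: gauss_point_def g.nonneg pcompose_add pcompose_mult pcompose_1 g.ultra g.mult g.one g.zero)
qed (use r in \<open>simp add: gauss_point_def av.gauss_const\<close>)

lemma gauss_point_linear: "0 < r \<Longrightarrow> gauss_point av a r [:b, c:] = max (av (b + c * a)) (av c * r)"
  by (simp add: gauss_point_def pcompose_pCons av.gauss_linear)

lemma flow_A1:
  assumes x: "x \<in> A1 av" and t: "0 \<le> t"
  shows "flow x t \<in> A1 av"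
proof -
  interpret x: mult_seminorm x using seminorm[OF x] .
  show ?thesis
  proof (cases "t = 0")
    case True
    then have "flow x t = x" by (auto simp: flow_def x.gauss_zero_radius coeff_taylor_0)
    then show ?thesis using x by simp
  next
    case False
    then interpret g: mult_seminorm "gauss x t" using x.gauss_seminorm t by simp
    have "taylor 0 = (0 :: 'k poly poly)" "taylor 1 = (1 :: 'k poly poly)"
      using taylor_const[of 0] taylor_const[of 1] by (simp_all add: taylor_def lift_poly_def pcompose_1)
    then show ?thesis
      using t by (intro A1_I mult_seminorm.intro)
        (simp_all add: flow_def g.nonneg g.ultra g.mult g.one g.zero taylor_add taylor_mult taylor_const x.gauss_const A1_const[OF x])
  qed
qed

lemma flow_zero: "x \<in> A1 av \<Longrightarrow> flow x 0 = x"
  by (auto simp: flow_def mult_seminorm.gauss_zero_radius[OF seminorm] coeff_taylor_0)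

text \<open>The distance to a rational point never decreases along the path. A point outside an open
  disc therefore stays outside, and a closed disc of radius \<open>s\<close> is not left before time
  \<open>s\<close>.\<close>

lemma flow_linear:
  "x \<in> A1 av \<Longrightarrow> 0 \<le> t \<Longrightarrow> flow x t [:b, 1:] = max (x [:b, 1:]) t"
  by (simp add: flow_def taylor_linear mult_seminorm.gauss_linear[OF seminorm] mult_seminorm.one[OF seminorm])

text \<open>Shifting \<open>S\<close> by \<open>a - T\<close>, which has norm at most
  \<open>s\<close> at \<open>x\<close>, leaves the Gauss norm unchanged and turns
  \<open>P(T + S)\<close> into \<open>P(a + S)\<close>. Its coefficients are constants, on which
  \<open>x\<close> is \<open>av\<close>, so all dependence on \<open>x\<close> disappears.\<close>

lemma flow_eq_gauss_point:
  assumes x: "x \<in> A1 av" and s: "0 < s" and a: "x [:- a, 1:] \<le> s"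
  shows "flow x s = gauss_point av a s"
proof
  fix P
  interpret x: mult_seminorm x using seminorm[OF x] .
  have u: "x [:a, - 1:] \<le> s" using a x.uminus[of "[:- a, 1:]"] by simp
  have "pcompose (taylor P) [:[:a, - 1:], 1:] = pcompose (lift_poly P) [:[:a:], 1:]"
    by (simp add: taylor_def pcompose_pCons flip: pcompose_assoc)
  also have "\<dots> = lift_poly (pcompose P [:a, 1:])"
    by (simp add: lift_poly_pcompose lift_poly_pCons one_pCons)
  finally have "flow x s P = gauss x s (lift_poly (pcompose P [:a, 1:]))"
    using x.gauss_pcompose_shift[OF s u, of "taylor P"] by (simp add: flow_def)
  also have "\<dots> = gauss av s (pcompose P [:a, 1:])"
    by (simp add: gauss_def coeff_lift_poly A1_const[OF x]) (simp add: lift_poly_def degree_map_poly)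
  finally show "flow x s P = gauss_point av a s P" by (simp add: gauss_point_def)
qed

lemma connectedin_flow:
  assumes x: "x \<in> A1 av"
  shows "connectedin (A1_top av) (flow x ` {0..s})"
proof -
  have "continuous_map (top_of_set {0..s}) (A1_top av) (flow x)"
    by (rule continuous_map_into_A1) (auto simp: flow_A1 x flow_def continuous_on_gauss)
  then show ?thesis
    by (rule connectedin_continuous_map_image) (simp add: connectedin_subtopology)
qed

text \<open>The set is a union of paths that remain in it and share the endpoint
  \<open>gauss_point av a s\<close>.\<close>

lemma connectedin_disc_minus_discs:
  assumes s: "0 < s"
  shows "connectedin (A1_top av) {x \<in> A1 av. x [:- a, 1:] \<le> s \<and> (\<forall>(b, r)\<in>K. r \<le> x [:- b, 1:])}"
    (is "connectedin _ ?D")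
proof (cases "?D = {}")
  case False
  have sub: "flow x ` {0..s} \<subseteq> ?D" if "x \<in> ?D" for x
    using that by (auto simp: flow_A1 flow_linear le_max_iff_disj)
  have "?D = (\<Union>x\<in>?D. flow x ` {0..s})"
  proof (intro equalityI subsetI)
    fix x assume "x \<in> ?D"
    moreover have "x \<in> flow x ` {0..s}" using flow_zero[of x] \<open>x \<in> ?D\<close> s by (intro image_eqI[of _ _ 0]) auto
    ultimately show "x \<in> (\<Union>x\<in>?D. flow x ` {0..s})" by blast
  next
    show "x \<in> ?D" if "x \<in> (\<Union>x\<in>?D. flow x ` {0..s})" for x using that sub by blast
  qed
  moreover have "connectedin (A1_top av) (\<Union>x\<in>?D. flow x ` {0..s})"
  proof (rule connectedin_Union)
    show "connectedin (A1_top av) S" if "S \<in> (\<lambda>x. flow x ` {0..s}) ` ?D" for S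
      using that by (auto intro: connectedin_flow)
    have "gauss_point av a s \<in> flow x ` {0..s}" if "x \<in> ?D" for x
      using flow_eq_gauss_point[of x s a] that s by (intro image_eqI[of _ _ s]) auto
    then show "\<Inter>((\<lambda>x. flow x ` {0..s}) ` ?D) \<noteq> {}" by blast
  qed
  ultimately show ?thesis by simp
qed (use connectedin_empty in metis)

end

section \<open>Discs\<close>

definition translation_matrix :: "'k::field \<Rightarrow> 'k ^ 2 ^ 2" where
  "translation_matrix b = vector [vector [1, b], vector [0, 1]]"

lemma translation_matrix_nth [simp]:
  "translation_matrix b $ 1 $ 1 = 1" "translation_matrix b $ 1 $ 2 = b"
  "translation_matrix b $ 2 $ 1 = 0" "translation_matrix b $ 2 $ 2 = 1"
  by (simp_all add: translation_matrix_def)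

lemma invertible_translation_matrix: "invertible (translation_matrix (b :: 'k::field))"
  by (simp add: invertible_det_nz det_2)

lemma translation_matrix_inverse:
  "translation_matrix (- b) ** translation_matrix b = (Finite_Cartesian_Product.mat 1 :: 'k::field ^ 2 ^ 2)"
  by (simp add: vec_eq_iff matrix_matrix_mult_def sum_2 forall_2 Finite_Cartesian_Product.mat_def)

text \<open>The map \<open>T \<mapsto> a + 1/T\<close>: it sends infinity to \<open>a\<close> and
  pulls the open disc of radius \<open>r\<close> around \<open>a\<close> back to the neighbourhood
  \<open>|T| > 1/r\<close> of infinity.\<close>

definition at_infinity_matrix :: "'k::field \<Rightarrow> 'k ^ 2 ^ 2" where
  "at_infinity_matrix a = vector [vector [a, 1], vector [1, 0]]"

lemma at_infinity_matrix_nth [simp]: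
  "at_infinity_matrix a $ 1 $ 1 = a" "at_infinity_matrix a $ 1 $ 2 = 1"
  "at_infinity_matrix a $ 2 $ 1 = 1" "at_infinity_matrix a $ 2 $ 2 = 0"
  by (simp_all add: at_infinity_matrix_def)

lemma invertible_at_infinity_matrix: "invertible (at_infinity_matrix (a :: 'k::field))"
  by (simp add: invertible_det_nz det_2)

lemma invertible_obtain_inverse:
  fixes A :: "'k::field ^ 2 ^ 2"
  assumes "invertible A"
  obtains B where "invertible B" "A ** B = Finite_Cartesian_Product.mat 1" "B ** A = Finite_Cartesian_Product.mat 1"
  using assms unfolding invertible_def by blast

section \<open>Discs under coordinate changes\<close>

context nonarch_field
begin

lemma moebius_inverse:
  assumes "B ** A = Finite_Cartesian_Product.mat 1" "invertible A" "invertible B" "p \<in> P1 av"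
  shows "moebius av B (moebius av A p) = p"
  using moebius_mult[of p B A] assms by (simp add: moebius_one)

lemma moebius_image_mult:
  assumes "S \<subseteq> P1 av" "invertible A" "invertible B"
  shows "moebius av A ` moebius av B ` S = moebius av (A ** B) ` S"
  using moebius_mult[OF _ assms(2,3)] assms(1) by (force simp: image_image subset_iff)

lemma form_norm_moebius_linear:
  assumes p: "p \<in> P1 av" and B: "invertible B"
  obtains c where "c > 0"
    "\<And>a. form_norm av p 1 (num B - Polynomial.smult a (den B)) = c * form_norm av (moebius av B p) 1 [:- a, 1:]"
    "form_norm av p 1 (den B) = c * form_norm av (moebius av B p) 1 1"
proof -
  obtain c where c: "c > 0" "\<And>n P. Polynomial.degree P \<le> n \<Longrightarrow>
      form_norm av p n (subst_form B n P) = c ^ n * form_norm av (moebius av B p) n P"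
    using form_norm_moebius[OF p B] by blast
  have "subst_form B 1 [:- a, 1:] = num B - Polynomial.smult a (den B)" for a
    by (simp only: subst_form_linear smult_1_left smult_minus_left) simp
  moreover have "subst_form B 1 1 = den B"
    using subst_form_linear[of B 1 0] by (simp flip: one_pCons)
  ultimately show ?thesis
    using c(2)[of "[:- _, 1:]" 1] c(2)[of 1 1] by (intro that[of c] c(1)) (simp_all del: One_nat_def)
qed

lemma moebius_mem_open_disc_iff:
  assumes p: "p \<in> P1 av" and B: "invertible B"
  shows "moebius av B p \<in> open_disc_A1 av a r \<longleftrightarrow>
    form_norm av p 1 (num B - Polynomial.smult a (den B)) < r * form_norm av p 1 (den B)"
proof -
  obtain c where "c > 0"
    "\<And>a. form_norm av p 1 (num B - Polynomial.smult a (den B)) = c * form_norm av (moebius av B p) 1 [:- a, 1:]"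
    "form_norm av p 1 (den B) = c * form_norm av (moebius av B p) 1 1"
    using form_norm_moebius_linear[OF p B] by blast
  then show ?thesis
    by (simp only: mem_open_disc_iff[OF moebius_in_P1[OF p]]) (simp add: mult.left_commute del: One_nat_def)
qed

lemma moebius_mem_closed_disc_iff:
  assumes p: "p \<in> P1 av" and B: "invertible B"
  shows "moebius av B p \<in> closed_disc_A1 av a r \<longleftrightarrow>
    form_norm av p 1 (num B - Polynomial.smult a (den B)) \<le> r * form_norm av p 1 (den B)"
proof -
  obtain c where "c > 0"
    "\<And>a. form_norm av p 1 (num B - Polynomial.smult a (den B)) = c * form_norm av (moebius av B p) 1 [:- a, 1:]"
    "form_norm av p 1 (den B) = c * form_norm av (moebius av B p) 1 1"
    using form_norm_moebius_linear[OF p B] by blast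
  then show ?thesis
    by (simp only: mem_closed_disc_iff[OF moebius_in_P1[OF p]]) (simp add: mult.left_commute del: One_nat_def)
qed

text \<open>Write \<open>u\<close> and \<open>v\<close> for the linear polynomials on the two sides.
  Then \<open>v\<close> is a multiple of \<open>u\<close> plus the constant \<open>d\<close>, and
  \<open>r * av v1 \<le> av u1\<close> makes \<open>r\<close> times that multiple at most
  \<open>u\<close> in norm. In the strict comparison of \<open>u\<close> with \<open>r * v\<close>
  only \<open>d\<close> can decide.\<close>

lemma linear_less_iff:
  assumes y: "y \<in> A1 av" and r: "0 < r" and le: "r * av v1 \<le> av u1" and u1: "u1 \<noteq> 0"
    and d: "d = v0 - v1 * u0 / u1"
  shows "y [:u0, u1:] < r * y [:v0, v1:] \<longleftrightarrow> y [:u0 / u1, 1:] < r * av d / av u1"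
proof -
  interpret y: mult_seminorm y using seminorm[OF y] .
  have v: "[:v0, v1:] = Polynomial.smult (v1 / u1) [:u0, u1:] + [:d:]" using u1 by (simp add: d)
  have u: "[:u0, u1:] = Polynomial.smult u1 [:u0 / u1, 1:]" using u1 by simp
  have yu: "y [:u0, u1:] = av u1 * y [:u0 / u1, 1:]" unfolding u by (rule A1_smult[OF y])
  have w: "r * y (Polynomial.smult (v1 / u1) [:u0, u1:]) \<le> y [:u0, u1:]"
  proof -
    have "r * av v1 * y [:u0, u1:] \<le> av u1 * y [:u0, u1:]" using le y.nonneg by (intro mult_right_mono)
    then show ?thesis
      using av_pos[OF u1] unfolding A1_smult[OF y] nonarch_abs_divide[OF av]
      by (simp add: field_simps)
  qed
  have "y [:u0, u1:] < r * y [:v0, v1:] \<longleftrightarrow> y [:u0, u1:] < r * av d"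
  proof
    assume *: "y [:u0, u1:] < r * y [:v0, v1:]"
    have "r * y [:v0, v1:] \<le> r * max (y (Polynomial.smult (v1 / u1) [:u0, u1:])) (y [:d:])"
      unfolding v using r by (intro mult_left_mono y.ultra) simp
    then show "y [:u0, u1:] < r * av d"
      using * w r by (simp add: A1_const[OF y] max_mult_distrib_left del: smult_pCons split: if_splits)
  next
    assume *: "y [:u0, u1:] < r * av d"
    then have "r * y (Polynomial.smult (v1 / u1) [:u0, u1:]) < r * y [:d:]" using w by (simp add: A1_const[OF y] del: smult_pCons)
    then have "y (Polynomial.smult (v1 / u1) [:u0, u1:]) < y [:d:]" using r by simp
    then have "y [:v0, v1:] = y [:d:]" unfolding v by (rule y.add_eq')
    then show "y [:u0, u1:] < r * y [:v0, v1:]" using * by (simp add: A1_const[OF y])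
  qed
  then show ?thesis
    unfolding yu using av_pos[OF u1] by (simp add: pos_less_divide_eq mult.commute)
qed

text \<open>In homogeneous form the image is given by a strict inequality between two linear
  polynomials. That infinity fails it is exactly the coefficient bound allowing the right-hand side
  to be replaced by a constant, which leaves an affine disc.\<close>

lemma open_disc_affine:
  assumes A: "invertible A" and r: "0 < r" and inf: "None \<notin> moebius av A ` open_disc_A1 av a r"
  obtains b s where "0 < s" "moebius av A ` open_disc_A1 av a r = open_disc_A1 av b s"
proof -
  obtain B where B: "invertible B" "A ** B = Finite_Cartesian_Product.mat 1" "B ** A = Finite_Cartesian_Product.mat 1"
    using invertible_obtain_inverse[OF A] .
  define u0 where "u0 = B $ 1 $ 2 - a * B $ 2 $ 2"
  define u1 where "u1 = B $ 1 $ 1 - a * B $ 2 $ 1"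
  define v0 where "v0 = B $ 2 $ 2"
  define v1 where "v1 = B $ 2 $ 1"
  define d where "d = v0 - v1 * u0 / u1"
  have forms: "num B - Polynomial.smult a (den B) = [:u0, u1:]" "den B = [:v0, v1:]"
    by (simp_all add: num_def den_def u0_def u1_def v0_def v1_def)
  have mem: "q \<in> moebius av A ` open_disc_A1 av a r \<longleftrightarrow>
      form_norm av q 1 [:u0, u1:] < r * form_norm av q 1 [:v0, v1:]" if "q \<in> P1 av" for q
    unfolding mem_moebius_image_iff[OF A B(1,3) open_disc_subset_P1 that]
      moebius_mem_open_disc_iff[OF that B(1)] forms(1)
    unfolding forms(2) ..
  \<comment> \<open>At infinity the two linear forms take the values of their leading
    coefficients.\<close>
  have le: "r * av v1 \<le> av u1" using mem[of None] inf by simp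
  have det: "u1 * v0 - u0 * v1 \<noteq> 0"
  proof -
    have "u1 * v0 - u0 * v1 = det B" by (simp add: u0_def u1_def v0_def v1_def det_2 algebra_simps)
    then show ?thesis using B(1) by (simp add: invertible_det_nz)
  qed
  have u1: "u1 \<noteq> 0"
  proof
    assume "u1 = 0"
    then have "av v1 \<le> 0" using le r by (simp add: mult_le_0_iff av.zero)
    then have "v1 = 0" using av_pos[of v1] by force
    then show False using det \<open>u1 = 0\<close> by simp
  qed
  have "d \<noteq> 0" using det u1 by (simp add: d_def field_simps)
  show ?thesis
  proof
    show "0 < r * av d / av u1" using r av_pos[OF u1] av_pos[OF \<open>d \<noteq> 0\<close>] by simp
    have "q \<in> moebius av A ` open_disc_A1 av a r \<longleftrightarrow> q \<in> open_disc_A1 av (- (u0 / u1)) (r * av d / av u1)"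
      if "q \<in> P1 av" for q
    proof (cases q)
      case None
      then show ?thesis using inf by (auto simp: open_disc_A1_def)
    next
      case (Some y)
      then have y: "y \<in> A1 av" using that by simp
      show ?thesis
        using linear_less_iff[OF y r le u1 d_def] mem[OF that] Some y by (auto simp: open_disc_A1_def)
    qed
    moreover have "moebius av A ` open_disc_A1 av a r \<subseteq> P1 av"
      using open_disc_subset_P1 moebius_in_P1 by blast
    ultimately show "moebius av A ` open_disc_A1 av a r = open_disc_A1 av (- (u0 / u1)) (r * av d / av u1)"
      using open_disc_subset_P1 by blast
  qed
qed

lemma translate_discs:
  "moebius av (translation_matrix b) ` open_disc_A1 av 0 r = open_disc_A1 av b r"
  "moebius av (translation_matrix b) ` closed_disc_A1 av 0 r = closed_disc_A1 av b r"
proof -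
  have forms: "num (translation_matrix (- b)) - Polynomial.smult 0 (den (translation_matrix (- b))) = [:- b, 1:]"
    "den (translation_matrix (- b)) = 1"
    by (simp_all add: num_def den_def one_pCons)
  note mem = mem_moebius_image_iff[OF invertible_translation_matrix invertible_translation_matrix translation_matrix_inverse]
  have "q \<in> moebius av (translation_matrix b) ` open_disc_A1 av 0 r \<longleftrightarrow> q \<in> open_disc_A1 av b r" if "q \<in> P1 av" for q
    unfolding mem[OF open_disc_subset_P1 that] moebius_mem_open_disc_iff[OF that invertible_translation_matrix]
      forms(1) mem_open_disc_iff[OF that]
    unfolding forms(2) ..
  then show "moebius av (translation_matrix b) ` open_disc_A1 av 0 r = open_disc_A1 av b r"
    using open_disc_subset_P1 moebius_in_P1 by blast
  have "q \<in> moebius av (translation_matrix b) ` closed_disc_A1 av 0 r \<longleftrightarrow> q \<in> closed_disc_A1 av b r" if "q \<in> P1 av" for q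
    unfolding mem[OF closed_disc_subset_P1 that] moebius_mem_closed_disc_iff[OF that invertible_translation_matrix]
      forms(1) mem_closed_disc_iff[OF that]
    unfolding forms(2) ..
  then show "moebius av (translation_matrix b) ` closed_disc_A1 av 0 r = closed_disc_A1 av b r"
    using closed_disc_subset_P1 moebius_in_P1 by blast
qed

text \<open>The Gauss points around \<open>b\<close> of radius \<open>t < s\<close> lie in the open
  disc and are at distance at least \<open>t\<close> from \<open>a\<close>, hence
  \<open>t \<le> r\<close>; rational points need not reveal this. The centre \<open>b\<close> lies
  in the closed disc and can replace \<open>a\<close> by the ultrametric inequality.\<close>

lemma affine_open_disc_subset_closed_disc:
  assumes s: "0 < s" and r: "0 < r" and sub: "open_disc_A1 av b s \<subseteq> closed_disc_A1 av a r"
  shows "open_disc_A1 av b s \<subseteq> open_disc_A1 av b r" "closed_disc_A1 av a r = closed_disc_A1 av b r"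
proof -
  have "t \<le> r" if t: "0 < t" "t < s" for t
  proof -
    have "Some (gauss_point av b t) \<in> open_disc_A1 av b s"
      using t by (auto simp: open_disc_A1_def gauss_point_A1 gauss_point_linear av.zero av.one)
    then have "gauss_point av b t [:- a, 1:] \<le> r" using sub by (auto simp: closed_disc_A1_def)
    then show ?thesis using t by (simp add: gauss_point_linear av.one)
  qed
  then have "s \<le> r" using s by (meson dense_le_bounded)
  then show "open_disc_A1 av b s \<subseteq> open_disc_A1 av b r" by (auto simp: open_disc_A1_def)
  have "eval_point av b [:- b, 1:] < s" using s by (simp add: eval_point_def av.zero)
  then have "Some (eval_point av b) \<in> open_disc_A1 av b s"
    using eval_point_A1[OF av] by (auto simp: open_disc_A1_def)
  then have ab: "av (b - a) \<le> r" using sub by (auto simp: closed_disc_A1_def eval_point_def)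
  have shift: "x [:- d, 1:] \<le> r" if x: "x \<in> A1 av" and c: "x [:- c, 1:] \<le> r" and cd: "av (c - d) \<le> r" for x c d
  proof -
    interpret x: mult_seminorm x using seminorm[OF x] .
    have "[:- d, 1:] = [:- c, 1:] + [:c - d:]" by simp
    then have "x [:- d, 1:] \<le> max (x [:- c, 1:]) (x [:c - d:])"
      using x.ultra[of "[:- c, 1:]" "[:c - d:]"] by (simp only:)
    then show ?thesis using c cd by (simp add: A1_const[OF x])
  qed
  have "av (a - b) \<le> r" using ab av.minus_commute by metis
  then have "x [:- a, 1:] \<le> r \<longleftrightarrow> x [:- b, 1:] \<le> r" if "x \<in> A1 av" for x
    using shift[OF that] ab by blast
  then show "closed_disc_A1 av a r = closed_disc_A1 av b r"
    unfolding closed_disc_A1_def by (intro arg_cong[where f = "image Some"] Collect_cong) blast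
qed

text \<open>Undoing \<open>H\<close> makes the closed disc affine. The open disc inside it then
  misses infinity, so it is affine too, and its centre may be taken as the common centre.\<close>

lemma normalize_disc_pair:
  assumes A: "invertible A" and r: "0 < r" and H: "invertible H" and s: "0 < s"
    and sub: "moebius av A ` open_disc_A1 av a s \<subseteq> moebius av H ` closed_disc_A1 av c r"
  obtains h where "invertible h" "moebius av H ` closed_disc_A1 av c r = moebius av h ` closed_disc_A1 av 0 r"
    "moebius av A ` open_disc_A1 av a s \<subseteq> moebius av h ` open_disc_A1 av 0 r"
proof -
  obtain K where K: "invertible K" "H ** K = Finite_Cartesian_Product.mat 1" "K ** H = Finite_Cartesian_Product.mat 1"
    using invertible_obtain_inverse[OF H] .
  have KA: "invertible (K ** A)" using K(1) A by (rule invertible_mult)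
  have img: "moebius av (K ** A) ` open_disc_A1 av a s = moebius av K ` moebius av A ` open_disc_A1 av a s"
    using moebius_image_mult[OF open_disc_subset_P1 K(1) A] by simp
  have sub': "moebius av (K ** A) ` open_disc_A1 av a s \<subseteq> closed_disc_A1 av c r"
  proof -
    have "moebius av K ` moebius av H ` closed_disc_A1 av c r = closed_disc_A1 av c r"
      using moebius_image_mult[OF closed_disc_subset_P1 K(1) H] moebius_one closed_disc_subset_P1
      by (force simp: K(3) subset_iff)
    then show ?thesis unfolding img using sub by blast
  qed
  then have "None \<notin> moebius av (K ** A) ` open_disc_A1 av a s" by (auto simp: closed_disc_A1_def)
  then obtain b t where bt: "0 < t" "moebius av (K ** A) ` open_disc_A1 av a s = open_disc_A1 av b t"
    by (rule open_disc_affine[OF KA s])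
  have d: "open_disc_A1 av b t \<subseteq> open_disc_A1 av b r" "closed_disc_A1 av c r = closed_disc_A1 av b r"
    using affine_open_disc_subset_closed_disc[OF bt(1) r] sub' unfolding bt(2) by blast+
  show ?thesis
  proof
    show "invertible (H ** translation_matrix b)" using H invertible_translation_matrix by (rule invertible_mult)
    show "moebius av H ` closed_disc_A1 av c r = moebius av (H ** translation_matrix b) ` closed_disc_A1 av 0 r"
      unfolding d(2) using moebius_image_mult[OF closed_disc_subset_P1 H invertible_translation_matrix, of b 0 r]
      by (simp add: translate_discs)
    have "moebius av H ` moebius av K ` moebius av A ` open_disc_A1 av a s = moebius av A ` open_disc_A1 av a s"
    proof -
      have "moebius av A ` open_disc_A1 av a s \<subseteq> P1 av" using open_disc_subset_P1 moebius_in_P1 by blast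
      then show ?thesis using moebius_inverse[OF K(2,1) H] by (force simp: image_image subset_iff)
    qed
    then have "moebius av A ` open_disc_A1 av a s = moebius av H ` open_disc_A1 av b t"
      using bt(2) img by simp
    then show "moebius av A ` open_disc_A1 av a s \<subseteq> moebius av (H ** translation_matrix b) ` open_disc_A1 av 0 r"
      using image_mono[OF d(1), of "moebius av H"]
        moebius_image_mult[OF open_disc_subset_P1 H invertible_translation_matrix, of b 0 r]
      by (simp add: translate_discs)
  qed
qed

text \<open>The Gauss point has \<open>|T| = r\<close> exactly, whether or not \<open>r\<close> is a
  value of \<open>av\<close>.\<close>

lemma closed_disc_minus_open_disc_nonempty:
  assumes r: "0 < r" and h: "invertible h" and U: "U \<subseteq> moebius av h ` open_disc_A1 av 0 r"
  shows "moebius av h ` closed_disc_A1 av 0 r - U \<noteq> {}"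
proof -
  let ?p = "Some (gauss_point av 0 r)"
  have p: "?p \<in> P1 av" using r by (simp add: gauss_point_A1)
  obtain k where k: "invertible k" "h ** k = Finite_Cartesian_Product.mat 1" "k ** h = Finite_Cartesian_Product.mat 1"
    using invertible_obtain_inverse[OF h] .
  have "?p \<in> closed_disc_A1 av 0 r" "?p \<notin> open_disc_A1 av 0 r"
    using r by (auto simp: closed_disc_A1_def open_disc_A1_def gauss_point_A1 gauss_point_linear av.zero av.one)
  then have "moebius av h ?p \<in> moebius av h ` closed_disc_A1 av 0 r"
    "moebius av h ?p \<notin> moebius av h ` open_disc_A1 av 0 r"
    using mem_moebius_image_iff[OF h k(1,3) open_disc_subset_P1 moebius_in_P1[OF p]] moebius_inverse[OF k(3) h k(1) p] by auto
  then show ?thesis using U by blast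
qed

text \<open>One member of the family is moved to a neighbourhood of infinity, so that its complement
  is a closed affine disc. The remaining members are disjoint from it, hence miss infinity and are
  affine discs, and the statement about an affine disc minus open discs applies.\<close>

lemma connectedin_Diff_open_discs:
  assumes discs: "\<And>U. U \<in> \<U> \<Longrightarrow> \<exists>A a r. invertible A \<and> 0 < r \<and> U = moebius av A ` open_disc_A1 av a r"
    and disj: "disjoint \<U>" and ne: "\<U> \<noteq> {}"
  shows "connectedin (P1_top av) (P1 av - \<Union>\<U>)"
proof -
  obtain U0 where U0: "U0 \<in> \<U>" using ne by blast
  obtain K a r where K: "invertible K" "0 < r" "U0 = moebius av K ` open_disc_A1 av a r"
    using discs[OF U0] by blast
  define h where "h = K ** at_infinity_matrix a"
  have h: "invertible h" unfolding h_def using K(1) invertible_at_infinity_matrix by (rule invertible_mult)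
  obtain k where k: "invertible k" "h ** k = Finite_Cartesian_Product.mat 1" "k ** h = Finite_Cartesian_Product.mat 1"
    using invertible_obtain_inverse[OF h] .
  obtain L where L: "invertible L" "K ** L = Finite_Cartesian_Product.mat 1" "L ** K = Finite_Cartesian_Product.mat 1"
    using invertible_obtain_inverse[OF K(1)] .
  have mem0: "moebius av h p \<in> U0 \<longleftrightarrow> form_norm av p 1 1 < r * form_norm av p 1 [:0, 1:]" if p: "p \<in> P1 av" for p
  proof -
    have forms: "num (at_infinity_matrix a) - Polynomial.smult a (den (at_infinity_matrix a)) = 1"
      "den (at_infinity_matrix a) = [:0, 1:]"
      by (simp_all add: num_def den_def one_pCons)
    have "moebius av L (moebius av h p) = moebius av (at_infinity_matrix a) p"
      unfolding h_def moebius_mult[OF p K(1) invertible_at_infinity_matrix]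
      using moebius_inverse[OF L(3) K(1) L(1) moebius_in_P1[OF p]] .
    then have "moebius av h p \<in> U0 \<longleftrightarrow> moebius av (at_infinity_matrix a) p \<in> open_disc_A1 av a r"
      by (simp only: K(3) mem_moebius_image_iff[OF K(1) L(1,3) open_disc_subset_P1 moebius_in_P1[OF p]])
    then show ?thesis
      unfolding moebius_mem_open_disc_iff[OF p invertible_at_infinity_matrix] forms(1)
      unfolding forms(2) .
  qed
  have inf: "moebius av h None \<in> U0" using mem0[of None] K(2) by (simp add: av.zero av.one)
  have affine: "\<exists>b s. 0 < s \<and> moebius av k ` U = open_disc_A1 av b s" if U: "U \<in> \<U>" "U \<noteq> U0" for U
  proof -
    obtain A c t where A: "invertible A" "0 < t" "U = moebius av A ` open_disc_A1 av c t" using discs[OF U(1)] by blast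
    have UP: "U \<subseteq> P1 av" unfolding A(3) using open_disc_subset_P1 moebius_in_P1 by blast
    have "None \<notin> moebius av k ` U"
    proof
      assume "None \<in> moebius av k ` U"
      then obtain q where "q \<in> U" "None = moebius av k q" by blast
      then have "moebius av h None = q" using moebius_inverse[OF k(2,1) h, of q] UP by auto
      then show False using inf \<open>q \<in> U\<close> disj U U0 unfolding disjoint_def by blast
    qed
    moreover have kU: "moebius av k ` U = moebius av (k ** A) ` open_disc_A1 av c t"
      unfolding A(3) using moebius_image_mult[OF open_disc_subset_P1 k(1) A(1)] .
    ultimately have "None \<notin> moebius av (k ** A) ` open_disc_A1 av c t" by simp
    then obtain b s where "0 < s" "moebius av (k ** A) ` open_disc_A1 av c t = open_disc_A1 av b s"
      by (rule open_disc_affine[OF invertible_mult[OF k(1) A(1)] A(2)])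
    then show ?thesis unfolding kU by blast
  qed
  \<comment> \<open>Centre and radius do not determine each other from the set alone, so all
    descriptions of the remaining discs are collected.\<close>
  define I where "I = {(b, s). 0 < s \<and> (\<exists>U\<in>\<U> - {U0}. moebius av k ` U = open_disc_A1 av b s)}"
  define D where "D = {x \<in> A1 av. x [:- 0, 1:] \<le> 1 / r \<and> (\<forall>(b, s)\<in>I. s \<le> x [:- b, 1:])}"
  have UP: "U \<subseteq> P1 av" if "U \<in> \<U>" for U
    using discs[OF that] open_disc_subset_P1 moebius_in_P1 by blast
  have hk: "q \<in> moebius av h ` Some ` D \<longleftrightarrow> q \<in> P1 av - \<Union>\<U>" if q: "q \<in> P1 av" for q
  proof -
    let ?p = "moebius av k q"
    have p: "?p \<in> P1 av" using q by (rule moebius_in_P1)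
    have hp: "moebius av h ?p = q" using moebius_inverse[OF k(2,1) h q] .
    have DP: "Some ` D \<subseteq> P1 av" by (auto simp: D_def)
    have "q \<in> moebius av h ` Some ` D \<longleftrightarrow> ?p \<in> Some ` D"
      using mem_moebius_image_iff[OF h k(1,3) DP q] .
    also have "\<dots> \<longleftrightarrow> q \<notin> U0 \<and> (\<forall>U\<in>\<U> - {U0}. q \<notin> U)"
    proof (cases ?p)
      case None
      then show ?thesis using hp inf by auto
    next
      case (Some x)
      then have x: "x \<in> A1 av" using p by simp
      have "q \<in> U0 \<longleftrightarrow> 1 < r * x [:0, 1:]"
        using mem0[OF p] mult_seminorm.one[OF seminorm[OF x]] unfolding hp by (simp add: Some)
      then have 0: "q \<notin> U0 \<longleftrightarrow> x [:- 0, 1:] \<le> 1 / r"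
        using K(2) by (simp add: pos_le_divide_eq not_less mult.commute)
      have mem: "q \<in> U \<longleftrightarrow> ?p \<in> moebius av k ` U" if "U \<in> \<U>" for U
        using mem_moebius_image_iff[OF k(1) h k(2) UP[OF that] p] hp by simp
      have "(\<forall>U\<in>\<U> - {U0}. q \<notin> U) \<longleftrightarrow> (\<forall>(b, s)\<in>I. s \<le> x [:- b, 1:])"
      proof
        assume *: "\<forall>U\<in>\<U> - {U0}. q \<notin> U"
        show "\<forall>(b, s)\<in>I. s \<le> x [:- b, 1:]"
        proof clarify
          fix b s assume "(b, s) \<in> I"
          then obtain U where U: "U \<in> \<U> - {U0}" "moebius av k ` U = open_disc_A1 av b s" by (auto simp: I_def)
          then have "?p \<notin> open_disc_A1 av b s" using * mem[of U] by auto
          then show "s \<le> x [:- b, 1:]" using Some x by (auto simp: open_disc_A1_def)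
        qed
      next
        assume *: "\<forall>(b, s)\<in>I. s \<le> x [:- b, 1:]"
        show "\<forall>U\<in>\<U> - {U0}. q \<notin> U"
        proof
          fix U assume U: "U \<in> \<U> - {U0}"
          then obtain b s where bs: "0 < s" "moebius av k ` U = open_disc_A1 av b s" using affine by blast
          then have "(b, s) \<in> I" using U by (auto simp: I_def)
          then have "s \<le> x [:- b, 1:]" using * by auto
          then have "?p \<notin> open_disc_A1 av b s" using Some by (auto simp: open_disc_A1_def)
          then show "q \<notin> U" using mem[of U] U bs(2) by auto
        qed
      qed
      then show ?thesis using 0 Some x by (auto simp: D_def)
    qed
    also have "\<dots> \<longleftrightarrow> q \<in> P1 av - \<Union>\<U>" using q U0 by blast
    finally show ?thesis .
  qed
  have "connectedin (A1_top av) D" unfolding D_def using K(2) by (intro connectedin_disc_minus_discs) simp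
  then have "connectedin (P1_top av) (moebius av h ` Some ` D)"
    using connectedin_continuous_map_image[OF continuous_map_Some] connectedin_continuous_map_image[OF continuous_map_moebius[OF h]] by blast
  moreover have "moebius av h ` Some ` D = P1 av - \<Union>\<U>"
  proof -
    have "moebius av h ` Some ` D \<subseteq> P1 av" by (auto simp: D_def moebius_in_P1)
    then show ?thesis using hk by blast
  qed
  ultimately show ?thesis by simp
qed

section \<open>Loxodromic matrices\<close>

text \<open>The entry \<open>d\<close> dominates: \<open>|a| < |d|\<close>,
  \<open>|b| < r|d|\<close> and \<open>r|c| < |d|\<close>. Hence the trace has absolute value
  \<open>|d|\<close>, while both products in the determinant are smaller than \<open>|d|\<close>
  squared.\<close>

lemma contracting_trace_det:
  assumes A: "invertible A" and r: "0 < r"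
    and sub: "moebius av A ` closed_disc_A1 av 0 r \<subseteq> open_disc_A1 av 0 r"
  shows "av (det A) < (av (trace A))\<^sup>2"
proof -
  define a where "a = A $ 1 $ 1"
  define b where "b = A $ 1 $ 2"
  define c where "c = A $ 2 $ 1"
  define d where "d = A $ 2 $ 2"
  have ND: "num A = [:b, a:]" "den A = [:d, c:]" by (simp_all add: num_def den_def a_def b_def c_def d_def)
  have less: "x [:b, a:] < r * x [:d, c:]" if "x \<in> A1 av" "x [:0, 1:] \<le> r" for x
  proof -
    have "Some x \<in> closed_disc_A1 av 0 r" using that by (auto simp: closed_disc_A1_def)
    then have "moebius av A (Some x) \<in> open_disc_A1 av 0 r" using sub by blast
    then show ?thesis using moebius_mem_open_disc_iff[OF _ A, of "Some x" 0 r] that by (simp add: ND)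
  qed
  have eval: "av (b + e * a) < r * av (d + e * c)" if "av e \<le> r" for e
    using less[OF eval_point_A1[OF av, of e]] that by (simp add: eval_point_def)
  \<comment> \<open>Otherwise the pole \<open>- d / c\<close> is a rational point of the closed
    disc; there the right-hand side of the inequality vanishes, which is impossible.\<close>
  have cd: "r * av c < av d"
  proof (rule ccontr)
    assume "\<not> r * av c < av d"
    then have le: "av d \<le> r * av c" by simp
    have "c \<noteq> 0"
    proof
      assume "c = 0"
      then have "av d \<le> 0" using le by (simp add: av.zero)
      then have "d = 0" using av_pos[of d] by force
      then show False using A \<open>c = 0\<close> by (simp add: invertible_det_nz det_2 c_def d_def)
    qed
    have "av (- d / c) \<le> r"
      using le av_pos[OF \<open>c \<noteq> 0\<close>] by (simp add: nonarch_abs_divide[OF av] av.uminus pos_divide_le_eq)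
    then have "av (b + (- d / c) * a) < r * av (d + (- d / c) * c)" by (rule eval)
    then have "av (b + (- d / c) * a) < 0" using \<open>c \<noteq> 0\<close> by (simp add: av.zero)
    then show False using av.nonneg not_less by blast
  qed
  \<comment> \<open>At the Gauss point the norm of \<open>b + a T\<close> bounds \<open>b\<close>
    and \<open>a\<close> simultaneously, and that of \<open>d + c T\<close> equals
    \<open>av d\<close> by the bound on \<open>c\<close>.\<close>
  have "gauss_point av 0 r [:b, a:] < r * gauss_point av 0 r [:d, c:]"
    using r by (intro less gauss_point_A1) (simp_all add: gauss_point_linear av.zero av.one)
  then have ab: "max (av b) (av a * r) < r * av d"
    using r cd by (simp add: gauss_point_linear mult.commute max_def split: if_splits)
  then have "av a < av d" "av b < r * av d" using r by (simp_all add: mult.commute)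
  then have "d \<noteq> 0" using av.nonneg[of a] by (auto simp: av.zero)
  then have d: "0 < av d" by (rule av_pos)
  have "av (a + d) = av d" using \<open>av a < av d\<close> by (rule av.add_eq')
  then have tr: "av (trace A) = av d" by (simp add: trace_def sum_2 a_def d_def)
  have "av (a * d) < (av d)\<^sup>2" using \<open>av a < av d\<close> d by (simp add: av.mult power2_eq_square)
  moreover have "av (b * c) < (av d)\<^sup>2"
  proof -
    have "r * (av b * av c) \<le> (r * av d) * (r * av c)"
      using mult_right_mono[of "av b" "r * av d" "r * av c"] \<open>av b < r * av d\<close> r av.nonneg[of c] by (simp add: mult_ac)
    also have "\<dots> < (r * av d) * av d" using cd r d by (intro mult_strict_left_mono) simp_all
    finally have "r * av (b * c) < r * (av d)\<^sup>2" by (simp add: av.mult power2_eq_square mult_ac)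
    then show ?thesis using r by simp
  qed
  ultimately have "max (av (a * d)) (av (b * c)) < (av d)\<^sup>2" by simp
  then have "av (a * d - b * c) < (av d)\<^sup>2" using av.diff[of "a * d" "b * c"] by linarith
  then show ?thesis unfolding tr by (simp add: det_2 a_def b_def c_def d_def)
qed

lemma conjugate_trace_det:
  fixes A h k :: "'k ^ 2 ^ 2"
  assumes "h ** k = Finite_Cartesian_Product.mat 1"
  shows "trace (k ** (A ** h)) = trace A" "det (k ** (A ** h)) = det A"
proof -
  have "trace (k ** (A ** h)) = trace ((A ** h) ** k)" by (rule trace_mul_sym)
  then show "trace (k ** (A ** h)) = trace A" using assms by (simp flip: matrix_mul_assoc)
  have "det h * det k = 1" using assms by (metis det_I det_mul)
  then show "det (k ** (A ** h)) = det A" by (simp add: det_mul mult_ac)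
qed

lemma contracting_disc_trace_det:
  assumes A: "invertible A" and h: "invertible h" and r: "0 < r"
    and U: "U \<subseteq> moebius av h ` open_disc_A1 av 0 r"
    and sub: "moebius av A ` moebius av h ` closed_disc_A1 av 0 r \<subseteq> U"
  shows "av (det A) < (av (trace A))\<^sup>2"
proof -
  obtain k where k: "invertible k" "h ** k = Finite_Cartesian_Product.mat 1" "k ** h = Finite_Cartesian_Product.mat 1"
    using invertible_obtain_inverse[OF h] .
  have "moebius av (k ** (A ** h)) ` closed_disc_A1 av 0 r \<subseteq> open_disc_A1 av 0 r"
  proof (rule image_subsetI)
    fix p assume p: "p \<in> closed_disc_A1 av 0 r"
    then have pP: "p \<in> P1 av" using closed_disc_subset_P1 by blast
    have "moebius av A (moebius av h p) \<in> moebius av h ` open_disc_A1 av 0 r" using p sub U by blast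
    then have "moebius av k (moebius av A (moebius av h p)) \<in> open_disc_A1 av 0 r"
      using mem_moebius_image_iff[OF h k(1,3) open_disc_subset_P1] moebius_in_P1[OF moebius_in_P1[OF pP]] by blast
    then show "moebius av (k ** (A ** h)) p \<in> open_disc_A1 av 0 r"
      by (simp add: moebius_mult pP A h k(1) invertible_mult)
  qed
  then show ?thesis
    using contracting_trace_det[OF invertible_mult[OF k(1) invertible_mult[OF A h]] r] conjugate_trace_det[OF k(2), of A] by simp
qed

end

text \<open>
  If both eigenvalues had the same absolute value, the trace would be bounded by it, and its square
  by the determinant.
\<close>

lemma loxodromic_matrix_of_trace_det:
  fixes av :: "'k::field \<Rightarrow> real"
  assumes ext: "extends_to_closure av ava" and less: "av (det A) < (av (trace A))\<^sup>2"
  shows "loxodromic_matrix ava A"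
proof -
  have ava: "nonarch_abs ava" and to_ac: "ava (to_ac z) = av z" for z
    using ext by (auto simp: extends_to_closure_def)
  interpret mult_seminorm ava using nonarch_abs_mult_seminorm[OF ava] .
  define a where "a = to_ac (A $ 1 $ 1)"
  define b where "b = to_ac (A $ 1 $ 2)"
  define c where "c = to_ac (A $ 2 $ 1)"
  define d where "d = to_ac (A $ 2 $ 2)"
  have tr: "a + d = to_ac (trace A)" by (simp add: a_def d_def trace_def sum_2)
  have det: "a * d - b * c = to_ac (det A)" by (simp add: a_def b_def c_def d_def det_2)
  obtain l where "poly [:a * d - b * c, - (a + d), 1:] l = 0"
    using alg_closed_imp_poly_has_root[of "[:a * d - b * c, - (a + d), 1:]"] by auto
  then have l: "l * l = (a + d) * l - (a * d - b * c)" by (simp add: algebra_simps)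
  define m where "m = a + d - l"
  have m: "m * m = (a + d) * m - (a * d - b * c)" using l by (simp add: m_def algebra_simps)
  have lm: "l * m = a * d - b * c" using l by (simp add: m_def algebra_simps)
  have eigen: "eigenvalue_ac A e" if e: "e * e = (a + d) * e - (a * d - b * c)" for e
  proof -
    have mv: "map_matrix to_ac A *v v = vector [a * v $ 1 + b * v $ 2, c * v $ 1 + d * v $ 2]" for v
      by (simp add: vec_eq_iff forall_2 matrix_vector_mult_def sum_2 map_matrix_def a_def b_def c_def d_def)
    \<comment> \<open>The candidates are \<open>(b, e - a)\<close> and \<open>(e - d, c)\<close>,
      each solving one row identically and the other by the characteristic equation. If both are
      zero the matrix is scalar and \<open>(1, 0)\<close> works.\<close>
    have sv: "eigenvalue_ac A e" if "p \<noteq> 0 \<or> q \<noteq> 0" "a * p + b * q = e * p" "c * p + d * q = e * q" for p q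
      unfolding eigenvalue_ac_def mv
      by (rule exI[of _ "vector [p, q]"]) (use that in \<open>auto simp: vec_eq_iff forall_2\<close>)
    show ?thesis
    proof (cases "b = 0 \<and> e = a")
      case False
      then show ?thesis by (intro sv[of b "e - a"]) (use e in \<open>auto simp: algebra_simps\<close>)
    next
      case ba: True
      show ?thesis
      proof (cases "c = 0 \<and> e = d")
        case False
        then show ?thesis by (intro sv[of "e - d" c]) (use e ba in \<open>auto simp: algebra_simps\<close>)
      next
        case True
        then show ?thesis using ba by (intro sv[of 1 0]) auto
      qed
    qed
  qed
  have "ava l \<noteq> ava m"
  proof
    assume eq: "ava l = ava m"
    have "ava (l + m) \<le> ava l" using ultra[of l m] eq by simp
    then have "(ava (l + m))\<^sup>2 \<le> (ava l)\<^sup>2" using nonneg by (intro power_mono)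
    also have "\<dots> = ava (l * m)" using eq by (simp add: mult power2_eq_square)
    finally have "(ava (a + d))\<^sup>2 \<le> ava (a * d - b * c)" unfolding lm by (simp add: m_def)
    then show False using less by (simp add: tr det to_ac)
  qed
  then show ?thesis using eigen[OF l] eigen[OF m] unfolding loxodromic_matrix_def by blast
qed

section \<open>Ping-pong\<close>

definition letter_inv :: "'a \<times> bool \<Rightarrow> 'a \<times> bool" where
  "letter_inv l = (fst l, \<not> snd l)"

lemma letter_inv_simps [simp]:
  "letter_inv (letter_inv l) = l" "fst (letter_inv l) = fst l" "letter_inv l \<noteq> l" "l \<noteq> letter_inv l"
  by (auto simp: letter_inv_def prod_eq_iff)

lemma Nil_in_reduced_words [simp]: "[] \<in> reduced_words S"
  by (simp add: reduced_words_def)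

lemma Cons_in_reduced_words:
  "l # w \<in> reduced_words S \<longleftrightarrow> fst l \<in> S \<and> w \<in> reduced_words S \<and> (w = [] \<or> hd w \<noteq> letter_inv l)"
  by (cases w) (auto simp: reduced_words_def letter_inv_def prod_eq_iff)

lemma snoc_in_reduced_wordsD: "w @ [l] \<in> reduced_words S \<Longrightarrow> w \<in> reduced_words S"
  by (auto simp: reduced_words_def successively_append_iff)

definition letter_value :: "('a, 'b) monoid_scheme \<Rightarrow> 'a \<times> bool \<Rightarrow> 'a" where
  "letter_value G l = (if snd l then fst l else inv\<^bsub>G\<^esub> fst l)"

lemma eval_word_Nil [simp]: "eval_word G [] = \<one>\<^bsub>G\<^esub>"
  by (simp add: eval_word_def)

lemma eval_word_Cons: "eval_word G (l # w) = letter_value G l \<otimes>\<^bsub>G\<^esub> eval_word G w"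
  by (simp add: eval_word_def letter_value_def split: prod.split)

text \<open>The figure as seen by topology: \<open>B l\<close> and \<open>U l\<close> are the closed
  and the open disc of a letter, whose inverse letter indexes the opposite pair. Closedness of the
  \<open>B l\<close> yields open neighbourhoods of \<open>F\<close>; the last two assumptions make
  neighbouring translates of \<open>F\<close> overlap and keep \<open>F\<close> itself
  connected.\<close>

locale ping_pong = group G for G :: "('g, 'b) monoid_scheme" (structure) +
  fixes S :: "'g set" and T :: "'x topology" and act :: "'g \<Rightarrow> 'x \<Rightarrow> 'x"
    and B U :: "'g \<times> bool \<Rightarrow> 'x set"
  assumes S: "finite S" "S \<noteq> {}" "S \<subseteq> carrier G"
    and act_one: "p \<in> topspace T \<Longrightarrow> act \<one> p = p"
    and act_mult: "\<lbrakk>g \<in> carrier G; h \<in> carrier G; p \<in> topspace T\<rbrakk> \<Longrightarrow> act (g \<otimes> h) p = act g (act h p)"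
    and act_continuous: "g \<in> carrier G \<Longrightarrow> continuous_map T T (act g)"
    and Hausdorff: "Hausdorff_space T"
    and B_closed: "fst l \<in> S \<Longrightarrow> closedin T (B l)"
    and U_subset_B: "fst l \<in> S \<Longrightarrow> U l \<subseteq> B l"
    and U_eq: "fst l \<in> S \<Longrightarrow> act (letter_value G l) ` (topspace T - B (letter_inv l)) = U l"
    and B_disjoint: "\<lbrakk>fst l \<in> S; fst m \<in> S; l \<noteq> m\<rbrakk> \<Longrightarrow> B l \<inter> B m = {}"
    and B_not_subset_U: "fst l \<in> S \<Longrightarrow> B l - U l \<noteq> {}"
    and connected: "connectedin T (topspace T - (\<Union>l\<in>S \<times> UNIV. U l))"
begin

abbreviation val :: "'g \<times> bool \<Rightarrow> 'g" where "val \<equiv> letter_value G"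
abbreviation ev :: "('g \<times> bool) list \<Rightarrow> 'g" where "ev \<equiv> eval_word G"

definition \<Gamma> :: "'g set" where "\<Gamma> = generate G S"

definition F :: "'x set" where "F = topspace T - (\<Union>l\<in>S \<times> UNIV. U l)"

definition E :: "'x set" where "E = (\<Union>g\<in>\<Gamma>. act g ` F)"

lemma val_closed: "fst l \<in> S \<Longrightarrow> val l \<in> carrier G"
  using S(3) by (auto simp: letter_value_def)

lemma val_inv: "fst l \<in> S \<Longrightarrow> val (letter_inv l) = inv (val l)"
  using S(3) by (auto simp: letter_value_def letter_inv_def)

lemma ev_closed: "w \<in> reduced_words S \<Longrightarrow> ev w \<in> carrier G"
  by (induction w) (auto simp: Cons_in_reduced_words eval_word_Cons val_closed)

lemma act_closed: "g \<in> carrier G \<Longrightarrow> p \<in> topspace T \<Longrightarrow> act g p \<in> topspace T"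
  using act_continuous continuous_map_image_subset_topspace by blast

lemma act_inv: "g \<in> carrier G \<Longrightarrow> p \<in> topspace T \<Longrightarrow> act (inv g) (act g p) = p"
  and act_inv': "g \<in> carrier G \<Longrightarrow> p \<in> topspace T \<Longrightarrow> act g (act (inv g) p) = p"
  using act_mult[of "inv g" g p] act_mult[of g "inv g" p] act_one by auto

lemma mem_act_image_iff:
  assumes g: "g \<in> carrier G" and A: "A \<subseteq> topspace T" and p: "p \<in> topspace T"
  shows "p \<in> act g ` A \<longleftrightarrow> act (inv g) p \<in> A"
  using act_inv[OF g] act_inv'[OF g p] A by (metis (no_types, lifting) image_iff subsetD)

lemma act_image_eq_preimage:
  assumes g: "g \<in> carrier G" and A: "A \<subseteq> topspace T"
  shows "act g ` A = {p \<in> topspace T. act (inv g) p \<in> A}"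
  using mem_act_image_iff[OF g A] act_closed[OF g] A by blast

lemma openin_act_image: "g \<in> carrier G \<Longrightarrow> openin T A \<Longrightarrow> openin T (act g ` A)"
  using act_image_eq_preimage[of g A] openin_subset[of T A]
    openin_continuous_map_preimage[OF act_continuous[of "inv g"], of A] by simp

lemma closedin_act_image: "g \<in> carrier G \<Longrightarrow> closedin T A \<Longrightarrow> closedin T (act g ` A)"
  using act_image_eq_preimage[of g A] closedin_subset[of T A]
    closedin_continuous_map_preimage[OF act_continuous[of "inv g"], of A] by simp

lemma act_image_mult:
  "\<lbrakk>g \<in> carrier G; h \<in> carrier G; A \<subseteq> topspace T\<rbrakk> \<Longrightarrow> act g ` act h ` A = act (g \<otimes> h) ` A"
  using act_mult[of g h] by (force simp: image_image subset_iff)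

lemma B_subset: "fst l \<in> S \<Longrightarrow> B l \<subseteq> topspace T"
  using B_closed closedin_subset by blast

lemma U_subset: "fst l \<in> S \<Longrightarrow> U l \<subseteq> topspace T"
  using B_subset U_subset_B by blast

lemma F_subset: "F \<subseteq> topspace T"
  by (auto simp: F_def)

section \<open>Dynamics of letters and reduced words; freeness of the group\<close>

lemma notin_U_if_F: "p \<in> F \<Longrightarrow> fst l \<in> S \<Longrightarrow> p \<notin> U l"
  unfolding F_def by (metis DiffD2 UNIV_I UN_I mem_Sigma_iff prod.collapse)

lemma act_in_U: "\<lbrakk>fst l \<in> S; p \<in> topspace T; p \<notin> B (letter_inv l)\<rbrakk> \<Longrightarrow> act (val l) p \<in> U l"
  using U_eq[of l] by blast

text \<open>Contrapositive of \<open>act_in_U\<close> for the inverse letter: a point whose image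
  missed \<open>B l\<close> would come back into \<open>U (letter_inv l)\<close>.\<close>

lemma act_in_B:
  assumes l: "fst l \<in> S" and p: "p \<in> topspace T" "p \<notin> U (letter_inv l)"
  shows "act (val l) p \<in> B l"
proof (rule ccontr)
  assume "act (val l) p \<notin> B l"
  then have "act (val (letter_inv l)) (act (val l) p) \<in> U (letter_inv l)"
    using act_in_U[of "letter_inv l" "act (val l) p"] l p(1) by (simp add: act_closed val_closed)
  then show False using act_inv[OF val_closed[OF l] p(1)] p(2) by (simp add: val_inv l)
qed

lemma act_notin_U:
  assumes l: "fst l \<in> S" and p: "p \<in> B (letter_inv l)"
  shows "act (val l) p \<notin> U l"
proof
  assume "act (val l) p \<in> U l"
  then obtain q where q: "q \<in> topspace T" "q \<notin> B (letter_inv l)" "act (val l) p = act (val l) q"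
    using U_eq[OF l] by blast
  have "p \<in> topspace T" using B_subset[of "letter_inv l"] l p by auto
  then have "p = q" using q(1,3) act_inv[OF val_closed[OF l]] by metis
  then show False using p q(2) by simp
qed

text \<open>By disjointness a point of \<open>B l\<close> can meet no open disc other than
  \<open>U l\<close>.\<close>

lemma ring_in_F: "fst l \<in> S \<Longrightarrow> p \<in> B l \<Longrightarrow> p \<notin> U l \<Longrightarrow> p \<in> F"
  unfolding F_def using B_subset[of l] B_disjoint[of l] U_subset_B by fastforce

text \<open>A single letter may send a point of \<open>F\<close> onto the ring
  \<open>B l - U l\<close>, which still belongs to \<open>F\<close>; from the second letter on the
  image is in the open disc. This gap is why only letters can bring a point of \<open>F\<close> back
  to \<open>F\<close>.\<close>

lemma word_act:
  assumes "l # w \<in> reduced_words S" and p: "p \<in> F"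
  shows "act (ev (l # w)) p \<in> B l" "w \<noteq> [] \<Longrightarrow> act (ev (l # w)) p \<in> U l"
proof -
  have "act (ev (l # w)) p \<in> B l \<and> (w \<noteq> [] \<longrightarrow> act (ev (l # w)) p \<in> U l)"
    using assms(1)
  proof (induction w arbitrary: l)
    case Nil
    then have l: "fst l \<in> S" by (simp add: Cons_in_reduced_words)
    then show ?case
      using act_in_B[OF l, of p] notin_U_if_F[OF p, of "letter_inv l"] F_subset p
      by (auto simp: eval_word_Cons val_closed)
  next
    case (Cons m w)
    then have l: "fst l \<in> S" and m: "fst m \<in> S" "m \<noteq> letter_inv l" and red: "m # w \<in> reduced_words S"
      by (auto simp: Cons_in_reduced_words)
    define q where "q = act (ev (m # w)) p"
    have q: "q \<in> B m" using Cons.IH[OF red] by (simp add: q_def)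
    \<comment> \<open>Reducedness enters here: the disc reached so far is not the one that the next
      letter excludes.\<close>
    then have qB: "q \<notin> B (letter_inv l)" using B_disjoint[OF m(1), of "letter_inv l"] l m by auto
    have "act (ev (l # m # w)) p = act (val l) q"
      using F_subset p by (auto simp: q_def eval_word_Cons[of G l] act_mult val_closed l ev_closed[OF red])
    moreover have "act (val l) q \<in> U l" using act_in_U[OF l _ qB] q B_subset[OF m(1)] by blast
    ultimately show ?case using U_subset_B[OF l] by auto
  qed
  then show "act (ev (l # w)) p \<in> B l" "w \<noteq> [] \<Longrightarrow> act (ev (l # w)) p \<in> U l" by auto
qed

text \<open>The ring of the inverse letter provides the point. A word beginning with
  \<open>l\<close> sends it into \<open>B l\<close> and so acts nontrivially.\<close>

lemma F_not_subset_B: "fst l \<in> S \<Longrightarrow> \<exists>p\<in>F. p \<notin> B l"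
proof -
  assume l: "fst l \<in> S"
  then obtain p where p: "p \<in> B (letter_inv l)" "p \<notin> U (letter_inv l)"
    using B_not_subset_U[of "letter_inv l"] by auto
  then have "p \<in> F" using ring_in_F[of "letter_inv l"] l by simp
  moreover have "p \<notin> B l" using B_disjoint[of "letter_inv l" l] p(1) l by auto
  ultimately show ?thesis by blast
qed

lemma F_nonempty: "F \<noteq> {}"
  using F_not_subset_B[of "(SOME s. s \<in> S, True)"] S(2) by (auto simp: some_in_eq)

text \<open>The first letter of a word can be read off from the disc into which it sends a point of
  \<open>F\<close>; cancelling it gives the induction.\<close>

lemma ev_inj: "inj_on ev (reduced_words S)"
proof -
  have ne: "ev (l # u) \<noteq> \<one>" if "l # u \<in> reduced_words S" for l u
  proof
    assume eq: "ev (l # u) = \<one>"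
    have "fst l \<in> S" using that by (simp add: Cons_in_reduced_words)
    then obtain p where p: "p \<in> F" "p \<notin> B l" using F_not_subset_B by blast
    then have "act (ev (l # u)) p = p" unfolding eq using F_subset by (intro act_one) auto
    then show False using word_act(1)[OF that p(1)] p(2) by simp
  qed
  have "v = w" if "v \<in> reduced_words S" "w \<in> reduced_words S" "ev v = ev w" for v w
    using that
  proof (induction v arbitrary: w)
    case Nil
    show ?case
    proof (cases w)
      case (Cons m u)
      then show ?thesis using ne[of m u] Nil.prems by simp
    qed simp
  next
    case (Cons l u)
    have "w \<noteq> []" using ne[OF Cons.prems(1)] Cons.prems(3) by auto
    then obtain m u' where w: "w = m # u'" by (cases w) auto
    obtain p where p: "p \<in> F" using F_nonempty by blast
    have "act (ev (l # u)) p \<in> B l" using word_act(1)[OF Cons.prems(1) p] .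
    moreover have "act (ev (l # u)) p \<in> B m"
      using word_act(1)[of m u', OF _ p] Cons.prems(2) unfolding Cons.prems(3) w by blast
    moreover have "fst l \<in> S" "fst m \<in> S" using Cons.prems w by (auto simp: Cons_in_reduced_words)
    ultimately have lm: "l = m" using B_disjoint by blast
    have "u \<in> reduced_words S" "u' \<in> reduced_words S" "fst l \<in> S"
      using Cons.prems w by (auto simp: Cons_in_reduced_words)
    moreover have "ev u = ev u'"
      using Cons.prems(3) calculation by (simp add: w lm eval_word_Cons val_closed ev_closed)
    ultimately show ?case using Cons.IH w lm by blast
  qed
  then show ?thesis by (rule inj_onI)
qed

lemma val_mult_ev:
  assumes l: "fst l \<in> S" and w: "w \<in> reduced_words S"
  shows "\<exists>v\<in>reduced_words S. val l \<otimes> ev w = ev v"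
proof (cases "w \<noteq> [] \<and> hd w = letter_inv l")
  case False
  then have "l # w \<in> reduced_words S" using l w by (auto simp: Cons_in_reduced_words)
  then show ?thesis by (metis eval_word_Cons)
next
  case True
  then obtain v where v: "w = letter_inv l # v" by (cases w) auto
  then have vr: "v \<in> reduced_words S" using w by (simp add: Cons_in_reduced_words)
  have "val l \<otimes> ev w = ev v"
    using val_closed[OF l] ev_closed[OF vr] by (simp add: v eval_word_Cons val_inv l flip: m_assoc)
  then show ?thesis using vr by blast
qed

lemma generate_closed_carrier: "\<Gamma> \<subseteq> carrier G"
  unfolding \<Gamma>_def using generate_in_carrier[OF S(3)] by blast

lemma \<Gamma>_subgroup: "subgroup \<Gamma> G"
  unfolding \<Gamma>_def using generate_is_subgroup[OF S(3)] .

lemma \<Gamma>_obtain_word: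
  assumes "g \<in> \<Gamma>"
  obtains w where "w \<in> reduced_words S" "g = ev w"
proof -
  \<comment> \<open>Closure under products requires the stronger claim that \<open>g\<close> maps
    every reduced word, and not just the empty one, to a reduced word.\<close>
  have "\<forall>w\<in>reduced_words S. \<exists>v\<in>reduced_words S. g \<otimes> ev w = ev v"
    using assms unfolding \<Gamma>_def
  proof (induction g rule: generate.induct)
    case one
    then show ?case by (metis ev_closed l_one)
  next
    case (incl h)
    then show ?case using val_mult_ev[of "(h, True)"] by (simp add: letter_value_def)
  next
    case (inv h)
    then show ?case using val_mult_ev[of "(h, False)"] by (simp add: letter_value_def)
  next
    case (eng g h)
    then have "g \<in> carrier G" "h \<in> carrier G" using generate_in_carrier[OF S(3)] by auto
    then show ?case using eng by (metis ev_closed m_assoc)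
  qed
  then obtain v where "v \<in> reduced_words S" "g \<otimes> ev [] = ev v" using Nil_in_reduced_words by blast
  moreover have "g \<in> carrier G" using assms generate_closed_carrier by blast
  ultimately show ?thesis using that by simp
qed

lemma ev_in_\<Gamma>: "w \<in> reduced_words S \<Longrightarrow> ev w \<in> \<Gamma>"
proof (induction w)
  case (Cons l w)
  then have "fst l \<in> S" "ev w \<in> \<Gamma>" by (auto simp: Cons_in_reduced_words)
  moreover have "val l \<in> \<Gamma>"
    using \<open>fst l \<in> S\<close> unfolding \<Gamma>_def letter_value_def by (auto intro: generate.intros)
  ultimately show ?case using subgroup.m_closed[OF \<Gamma>_subgroup] by (simp add: eval_word_Cons)
qed (simp add: subgroup.one_closed[OF \<Gamma>_subgroup])

lemma ev_bij: "bij_betw ev (reduced_words S) \<Gamma>"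
  unfolding bij_betw_def using ev_inj ev_in_\<Gamma> \<Gamma>_obtain_word by blast

lemma free_group: "is_free_group (G\<lparr>carrier := \<Gamma>\<rparr>)"
proof -
  have S\<Gamma>: "S \<subseteq> \<Gamma>" unfolding \<Gamma>_def by (auto intro: generate.incl)
  have "eval_word (G\<lparr>carrier := \<Gamma>\<rparr>) w = ev w" if "w \<in> reduced_words S" for w
    using that
  proof (induction w)
    case (Cons l w)
    then have "fst l \<in> \<Gamma>" using S\<Gamma> by (auto simp: Cons_in_reduced_words)
    then have "letter_value (G\<lparr>carrier := \<Gamma>\<rparr>) l = val l"
      by (simp add: letter_value_def m_inv_consistent[OF \<Gamma>_subgroup])
    then show ?case using Cons by (simp add: eval_word_Cons Cons_in_reduced_words)
  qed simp
  then have "bij_betw (eval_word (G\<lparr>carrier := \<Gamma>\<rparr>)) (reduced_words S) \<Gamma>"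
    using ev_bij bij_betw_cong by blast
  moreover have "Group.group (G\<lparr>carrier := \<Gamma>\<rparr>)"
    using subgroup.subgroup_is_group[OF \<Gamma>_subgroup is_group] .
  ultimately show ?thesis unfolding is_free_group_def using S\<Gamma> by auto
qed

text \<open>Starting outside the disc excluded by the last letter, already the first move ends in an
  open disc. Unlike a start in \<open>F\<close>, this applies to whole discs and gives
  contraction.\<close>

lemma word_act_outside:
  assumes "w \<in> reduced_words S" "w \<noteq> []" and p: "p \<in> topspace T" "p \<notin> B (letter_inv (last w))"
  shows "act (ev w) p \<in> U (hd w)"
  using assms(1,2) p(2)
proof (induction w)
  case (Cons l w)
  then have l: "fst l \<in> S" and w: "w \<in> reduced_words S" by (auto simp: Cons_in_reduced_words)
  show ?case
  proof (cases "w = []")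
    case True
    then show ?thesis using Cons.prems(3) act_in_U[OF l p(1)] by (simp add: eval_word_Cons val_closed l)
  next
    case False
    then have m: "fst (hd w) \<in> S" "hd w \<noteq> letter_inv l"
      using Cons.prems(1) w by (auto simp: Cons_in_reduced_words neq_Nil_conv)
    have "act (ev w) p \<in> B (hd w)" using Cons.IH[OF w False] Cons.prems(3) False U_subset_B[OF m(1)] by auto
    then have "act (ev w) p \<notin> B (letter_inv l)" using B_disjoint[OF m(1), of "letter_inv l"] l m by auto
    then show ?thesis
      using act_in_U[OF l] act_closed[OF ev_closed[OF w] p(1)] by (simp add: eval_word_Cons act_mult val_closed l ev_closed w p(1))
  qed
qed simp

lemma ev_snoc:
  "w \<in> reduced_words S \<Longrightarrow> fst l \<in> S \<Longrightarrow> ev (w @ [l]) = ev w \<otimes> val l"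
  by (induction w) (auto simp: eval_word_Cons Cons_in_reduced_words val_closed ev_closed m_assoc)

text \<open>Here \<open>g\<close> is the value of a cyclically reduced conjugate of \<open>w\<close>.\<close>

lemma conjugate_contracting:
  assumes "w \<in> reduced_words S" "w \<noteq> []"
  shows "\<exists>h\<in>carrier G. \<exists>g\<in>carrier G. \<exists>l. fst l \<in> S \<and> ev w = h \<otimes> g \<otimes> inv h \<and> act g ` B l \<subseteq> U l"
  using assms
proof (induction "length w" arbitrary: w rule: less_induct)
  case less
  obtain l v where w: "w = l # v" using less.prems by (cases w) auto
  then have l: "fst l \<in> S" and v: "v \<in> reduced_words S" using less.prems by (auto simp: Cons_in_reduced_words)
  have last: "fst (last w) \<in> S" using less.prems by (auto simp: reduced_words_def)
  show ?case
  proof (cases "last w = letter_inv l")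
    case False
    \<comment> \<open>In the cyclically reduced case \<open>B l\<close> is disjoint from the disc
      which the last letter excludes, so the whole of \<open>B l\<close> is sent into the open disc
      of the first letter.\<close>
    have "act (ev w) ` B l \<subseteq> U l"
    proof (rule image_subsetI)
      fix p assume p: "p \<in> B l"
      have "l \<noteq> letter_inv (last w)" using False by (metis letter_inv_simps(1))
      then have "p \<notin> B (letter_inv (last w))" using B_disjoint[OF l, of "letter_inv (last w)"] last p by auto
      then show "act (ev w) p \<in> U l"
        using word_act_outside[OF less.prems, of p] B_subset[OF l] p w by auto
    qed
    then show ?thesis
      using l ev_closed[OF less.prems(1)] by (intro bexI[of _ \<one>] bexI[of _ "ev w"] exI[of _ l]) auto
  next
    case True
    then have "v \<noteq> []" using w by auto
    then obtain u where u: "v = u @ [letter_inv l]" using True w by (metis append_butlast_last_id last_ConsR)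
    have ur: "u \<in> reduced_words S" using v u snoc_in_reduced_wordsD by blast
    \<comment> \<open>Otherwise \<open>w\<close> would be a letter followed by its inverse.\<close>
    have "u \<noteq> []" using less.prems(1) w u by (auto simp: Cons_in_reduced_words)
    moreover have "length u < length w" using w u by simp
    ultimately obtain h g m where h: "h \<in> carrier G" "g \<in> carrier G" "fst m \<in> S"
        "ev u = h \<otimes> g \<otimes> inv h" "act g ` B m \<subseteq> U m"
      using less.hyps ur by metis
    have vl: "val l \<in> carrier G" using l by (rule val_closed)
    have "ev w = val l \<otimes> (h \<otimes> g \<otimes> inv h \<otimes> inv (val l))"
      using ev_snoc[OF ur, of "letter_inv l"] l by (simp add: w u eval_word_Cons h(4) val_inv)
    also have "\<dots> = (val l \<otimes> h) \<otimes> g \<otimes> inv (val l \<otimes> h)"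
      using vl h(1,2) by (simp add: inv_mult_group m_assoc)
    finally show ?thesis using h vl by (intro bexI[of _ "val l \<otimes> h"] bexI[of _ g] exI[of _ m]) auto
  qed
qed

section \<open>The invariant open set, free action and local finiteness\<close>

lemma E_subset: "E \<subseteq> topspace T"
  unfolding E_def using F_subset act_closed generate_closed_carrier by blast

lemma F_subset_E: "F \<subseteq> E"
proof
  fix p assume p: "p \<in> F"
  then have "p = act \<one> p" using act_one F_subset by auto
  then have "p \<in> act \<one> ` F" using p by blast
  then show "p \<in> E" unfolding E_def using subgroup.one_closed[OF \<Gamma>_subgroup] by blast
qed

lemma act_E_subset: "g \<in> \<Gamma> \<Longrightarrow> act g ` E \<subseteq> E"
proof -
  assume g: "g \<in> \<Gamma>"
  have "act g (act h p) \<in> E" if "h \<in> \<Gamma>" "p \<in> F" for h p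
  proof -
    have "act g (act h p) = act (g \<otimes> h) p"
      using act_mult g that F_subset generate_closed_carrier by (metis subsetD)
    moreover have "g \<otimes> h \<in> \<Gamma>" using subgroup.m_closed[OF \<Gamma>_subgroup] g that by blast
    ultimately show ?thesis using that(2) unfolding E_def by auto
  qed
  then show ?thesis unfolding E_def by auto
qed

lemma act_E: "g \<in> \<Gamma> \<Longrightarrow> act g ` E = E"
proof
  assume g: "g \<in> \<Gamma>"
  then show "act g ` E \<subseteq> E" by (rule act_E_subset)
  have "inv g \<in> \<Gamma>" using subgroup.m_inv_closed[OF \<Gamma>_subgroup g] .
  then have "act (inv g) p \<in> E" if "p \<in> E" for p using act_E_subset[of "inv g"] that by blast
  moreover have "g \<in> carrier G" using g generate_closed_carrier by blast
  ultimately show "E \<subseteq> act g ` E" using mem_act_image_iff[of g E] E_subset by blast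
qed

lemma return_to_F:
  assumes g: "g \<in> \<Gamma>" and p: "p \<in> F" "act g p \<in> F"
  shows "g = \<one> \<or> (\<exists>l. fst l \<in> S \<and> g = val l)"
proof -
  obtain w where w: "w \<in> reduced_words S" "g = ev w" using g by (rule \<Gamma>_obtain_word)
  show ?thesis
  proof (cases w)
    case (Cons l u)
    then have l: "fst l \<in> S" using w by (simp add: Cons_in_reduced_words)
    have "u = []" using word_act(2)[of l u p] notin_U_if_F[OF p(2) l] p(1) w Cons by auto
    then have "g = val l" using w Cons l by (simp add: eval_word_Cons val_closed)
    then show ?thesis using l by blast
  qed (use w in simp)
qed

text \<open>A fixing element could only be a letter. The fixed point would then lie in
  \<open>B l\<close>, hence outside the opposite closed disc, and be sent to \<open>U l\<close>,
  which is disjoint from \<open>F\<close>.\<close>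

lemma free_action_F:
  assumes g: "g \<in> \<Gamma>" and p: "p \<in> F" "act g p = p"
  shows "g = \<one>"
proof (rule ccontr)
  assume "g \<noteq> \<one>"
  then obtain l where l: "fst l \<in> S" "g = val l" using return_to_F[OF g p(1)] p by auto
  have "p \<in> B l" using act_in_B[OF l(1), of p] notin_U_if_F[OF p(1), of "letter_inv l"] l p F_subset by auto
  then have "p \<notin> B (letter_inv l)" using B_disjoint[of l "letter_inv l"] l(1) by auto
  then have "p \<in> U l" using act_in_U[OF l(1), of p] p F_subset l(2) by auto
  then show False using notin_U_if_F[OF p(1) l(1)] by simp
qed

lemma free_action:
  assumes g: "g \<in> \<Gamma>" and p: "p \<in> E" "act g p = p"
  shows "g = \<one>"
proof -
  obtain h q where h: "h \<in> \<Gamma>" "q \<in> F" "p = act h q" using p(1) unfolding E_def by blast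
  have c: "g \<in> carrier G" "h \<in> carrier G" using g h generate_closed_carrier by auto
  have q: "q \<in> topspace T" using h F_subset by blast
  have "act (inv h \<otimes> (g \<otimes> h)) q = q"
    using p(2) act_inv[OF c(2) q] c q by (simp add: act_mult act_closed h(3))
  moreover have "inv h \<otimes> (g \<otimes> h) \<in> \<Gamma>"
    using g h(1) subgroup.m_closed[OF \<Gamma>_subgroup] subgroup.m_inv_closed[OF \<Gamma>_subgroup] by blast
  ultimately have "inv h \<otimes> (g \<otimes> h) = \<one>" using free_action_F h(2) by blast
  then have "h \<otimes> (inv h \<otimes> (g \<otimes> h)) = h" using c by simp
  then have "g \<otimes> h = h" using c by (simp flip: m_assoc)
  then show ?thesis using c by simp
qed

text \<open>
  An open neighbourhood of the fundamental domain \<open>F\<close> which is contained in the union of \<open>F\<close> with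
  its neighbouring translates.
\<close>

definition V :: "'x set" where
  "V = topspace T - (\<Union>l\<in>S \<times> UNIV. \<Union>m\<in>S \<times> UNIV - {letter_inv l}. act (val l) ` B m)"

lemma openin_V: "openin T V"
proof -
  have fin: "finite (S \<times> (UNIV :: bool set))" using S(1) by simp
  have "closedin T (\<Union>l\<in>S \<times> UNIV. \<Union>m\<in>S \<times> UNIV - {letter_inv l}. act (val l) ` B m)"
    using fin by (intro closedin_Union finite_imageI) (auto intro!: closedin_Union closedin_act_image val_closed B_closed)
  then show ?thesis unfolding V_def by (rule openin_diff[OF openin_topspace])
qed

lemma F_subset_V: "F \<subseteq> V"
proof
  fix p assume p: "p \<in> F"
  have "p \<notin> act (val l) ` B m" if l: "fst l \<in> S" and m: "fst m \<in> S" "m \<noteq> letter_inv l" for l m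
  proof
    assume "p \<in> act (val l) ` B m"
    then obtain q where q: "q \<in> B m" "p = act (val l) q" by blast
    then have "q \<notin> B (letter_inv l)" using B_disjoint[OF m(1), of "letter_inv l"] l m by auto
    then have "p \<in> U l" using act_in_U[OF l] q B_subset[OF m(1)] by auto
    then show False using notin_U_if_F[OF p l] by simp
  qed
  then have "p \<notin> act (val l) ` B m" if "l \<in> S \<times> UNIV" "m \<in> S \<times> UNIV - {letter_inv l}" for l m
    using that by (simp add: mem_Times_iff)
  then have "p \<notin> (\<Union>l\<in>S \<times> UNIV. \<Union>m\<in>S \<times> UNIV - {letter_inv l}. act (val l) ` B m)"
    by (simp only: UN_iff) blast
  then show "p \<in> V" using p F_subset unfolding V_def by blast
qed

text \<open>A point of \<open>V\<close> outside \<open>F\<close> lies in some \<open>U l\<close>.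
  Undoing \<open>l\<close> leads outside \<open>B (letter_inv l)\<close>, and the definition of
  \<open>V\<close> keeps it outside every other closed disc, so it is in \<open>F\<close>.\<close>

lemma V_subset:
  assumes p: "p \<in> V"
  shows "\<exists>g\<in>insert \<one> (val ` (S \<times> UNIV)). p \<in> act g ` F"
proof (cases "p \<in> F")
  case True
  then have "p = act \<one> p" using act_one F_subset by auto
  then show ?thesis using True by blast
next
  case False
  have pT: "p \<in> topspace T" using p by (simp add: V_def)
  then obtain l where l: "fst l \<in> S" "p \<in> U l" using False by (auto simp: F_def)
  then obtain q where q: "q \<in> topspace T" "q \<notin> B (letter_inv l)" "p = act (val l) q" using U_eq by blast
  have "q \<in> F"
  proof (rule ccontr)
    assume "q \<notin> F"
    then obtain m where m: "fst m \<in> S" "q \<in> U m" using q(1) by (auto simp: F_def)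
    then have qm: "q \<in> B m" using U_subset_B by blast
    then have "m \<noteq> letter_inv l" using q(2) by auto
    then have "p \<notin> V" using qm q(3) m(1) l(1) unfolding V_def by (cases l; cases m) auto
    then show False using p by simp
  qed
  moreover have "val l \<in> val ` (S \<times> UNIV)" using l(1) by (cases l) auto
  ultimately show ?thesis using q(3) by blast
qed

lemma nearby_subset_\<Gamma>: "insert \<one> (val ` (S \<times> UNIV)) \<subseteq> \<Gamma>"
proof -
  have "val l \<in> \<Gamma>" if "fst l \<in> S" for l
    using that unfolding \<Gamma>_def letter_value_def by (auto intro: generate.intros)
  then show ?thesis using subgroup.one_closed[OF \<Gamma>_subgroup] by auto
qed

lemma V_subset_E: "V \<subseteq> E"
proof
  fix p assume "p \<in> V"
  then obtain g where "g \<in> insert \<one> (val ` (S \<times> UNIV))" "p \<in> act g ` F" using V_subset by metis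
  then show "p \<in> E" unfolding E_def by (intro UN_I[of g]) (rule subsetD[OF nearby_subset_\<Gamma>])
qed

lemma E_eq_V: "E = (\<Union>g\<in>\<Gamma>. act g ` V)"
proof
  show "E \<subseteq> (\<Union>g\<in>\<Gamma>. act g ` V)"
    unfolding E_def by (intro UN_mono image_mono F_subset_V order_refl)
  have "act g ` V \<subseteq> E" if "g \<in> \<Gamma>" for g
    using image_mono[OF V_subset_E] act_E_subset[OF that] by (rule order_trans)
  then show "(\<Union>g\<in>\<Gamma>. act g ` V) \<subseteq> E" by (rule UN_least)
qed

lemma openin_E: "openin T E"
  unfolding E_eq_V using openin_act_image openin_V generate_closed_carrier by blast

text \<open>If \<open>a\<close> and \<open>b\<close> are the neighbouring elements carrying
  \<open>F\<close> to the two points involved, then \<open>inv b \<otimes> (g \<otimes> a)\<close>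
  returns a point of \<open>F\<close> to \<open>F\<close>. Thus \<open>g\<close> is a product of
  three elements from a finite set.\<close>

lemma finite_meeting_V: "finite {g \<in> \<Gamma>. act g ` V \<inter> V \<noteq> {}}"
proof -
  let ?N = "insert \<one> (val ` (S \<times> UNIV))"
  have "{g \<in> \<Gamma>. act g ` V \<inter> V \<noteq> {}} \<subseteq> (\<lambda>(a, b, t). b \<otimes> (t \<otimes> inv a)) ` (?N \<times> ?N \<times> ?N)"
  proof
    fix g assume "g \<in> {g \<in> \<Gamma>. act g ` V \<inter> V \<noteq> {}}"
    then obtain p where g: "g \<in> \<Gamma>" and p: "p \<in> V" "act g p \<in> V" by blast
    obtain a q where a: "a \<in> ?N" "q \<in> F" "p = act a q" using V_subset[OF p(1)] by blast
    obtain b r where b: "b \<in> ?N" "r \<in> F" "act g p = act b r" using V_subset[OF p(2)] by blast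
    have \<Gamma>: "a \<in> \<Gamma>" "b \<in> \<Gamma>" using a(1) b(1) nearby_subset_\<Gamma> by auto
    then have c: "a \<in> carrier G" "b \<in> carrier G" "g \<in> carrier G" using g generate_closed_carrier by auto
    have qr: "q \<in> topspace T" "r \<in> topspace T" using a b F_subset by auto
    define t where "t = inv b \<otimes> (g \<otimes> a)"
    have "act t q = act (inv b) (act g p)" using c qr by (simp add: t_def act_mult act_closed a(3))
    also have "\<dots> = r" unfolding b(3) using act_inv[OF c(2) qr(2)] .
    finally have "act t q \<in> F" using b(2) by simp
    moreover have "t \<in> \<Gamma>" unfolding t_def
      using \<Gamma> g subgroup.m_closed[OF \<Gamma>_subgroup] subgroup.m_inv_closed[OF \<Gamma>_subgroup] by blast
    ultimately have "t = \<one> \<or> (\<exists>l. fst l \<in> S \<and> t = val l)" using return_to_F a(2) by blast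
    then have t: "t \<in> ?N" by (metis UNIV_I image_eqI insertCI mem_Sigma_iff prod.collapse)
    have "b \<otimes> (t \<otimes> inv a) = (b \<otimes> inv b) \<otimes> g \<otimes> (a \<otimes> inv a)"
      using c by (simp only: t_def m_assoc m_closed inv_closed)
    then have "g = b \<otimes> (t \<otimes> inv a)" using c by simp
    then show "g \<in> (\<lambda>(a, b, t). b \<otimes> (t \<otimes> inv a)) ` (?N \<times> ?N \<times> ?N)"
      using a(1) b(1) t by (intro image_eqI[of _ _ "(a, b, t)"]) auto
  qed
  moreover have "finite ?N" using S(1) by simp
  ultimately show ?thesis by (meson finite_SigmaI finite_imageI finite_subset)
qed

lemma finite_meeting_translates:
  assumes a: "a \<in> \<Gamma>" and b: "b \<in> \<Gamma>"
  shows "finite {g \<in> \<Gamma>. act g ` act a ` V \<inter> act b ` V \<noteq> {}}"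
proof -
  have c: "a \<in> carrier G" "b \<in> carrier G" using a b generate_closed_carrier by auto
  have VT: "V \<subseteq> topspace T" by (auto simp: V_def)
  let ?f = "\<lambda>g. inv b \<otimes> (g \<otimes> a)"
  have inj: "inj_on ?f \<Gamma>"
    using c generate_closed_carrier by (intro inj_onI) (simp add: subset_iff)
  have "?f ` {g \<in> \<Gamma>. act g ` act a ` V \<inter> act b ` V \<noteq> {}} \<subseteq> {g \<in> \<Gamma>. act g ` V \<inter> V \<noteq> {}}"
  proof (rule image_subsetI)
    fix g assume "g \<in> {g \<in> \<Gamma>. act g ` act a ` V \<inter> act b ` V \<noteq> {}}"
    then obtain p q where g: "g \<in> \<Gamma>" and pq: "p \<in> V" "q \<in> V" "act g (act a p) = act b q" by blast
    have gc: "g \<in> carrier G" using g generate_closed_carrier by blast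
    have T: "p \<in> topspace T" "q \<in> topspace T" using pq VT by auto
    have "act (?f g) p = act (inv b) (act b q)" using gc c T by (simp add: act_mult act_closed pq(3))
    also have "\<dots> = q" using act_inv[OF c(2) T(2)] .
    finally have "act (?f g) ` V \<inter> V \<noteq> {}" using pq by blast
    moreover have "?f g \<in> \<Gamma>"
      using a b g subgroup.m_closed[OF \<Gamma>_subgroup] subgroup.m_inv_closed[OF \<Gamma>_subgroup] by blast
    ultimately show "?f g \<in> {g \<in> \<Gamma>. act g ` V \<inter> V \<noteq> {}}" by blast
  qed
  then have "finite (?f ` {g \<in> \<Gamma>. act g ` act a ` V \<inter> act b ` V \<noteq> {}})"
    using finite_meeting_V by (rule finite_subset)
  then show ?thesis by (rule finite_imageD) (rule inj_on_subset[OF inj], blast)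
qed

text \<open>For each word there is a connected subset of \<open>E\<close> joining \<open>F\<close>
  to its translate. To prepend a letter \<open>l\<close>, that subset is moved by \<open>l\<close>
  and \<open>F\<close> is added; the two meet in the ring of \<open>l\<close>.\<close>

lemma connectedin_E: "connectedin T E"
proof -
  have F: "connectedin T F" using connected by (simp add: F_def)
  have "\<exists>K. connectedin T K \<and> K \<subseteq> E \<and> F \<subseteq> K \<and> act (ev w) ` F \<subseteq> K" if "w \<in> reduced_words S" for w
    using that
  proof (induction w)
    case Nil
    then show ?case using F F_subset_E F_subset by (intro exI[of _ F]) (auto simp: act_one)
  next
    case (Cons l w)
    then have l: "fst l \<in> S" and w: "w \<in> reduced_words S" by (auto simp: Cons_in_reduced_words)
    obtain K where K: "connectedin T K" "K \<subseteq> E" "F \<subseteq> K" "act (ev w) ` F \<subseteq> K" using Cons.IH[OF w] by blast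
    obtain p where p: "p \<in> B l" "p \<notin> U l" using B_not_subset_U[OF l] by blast
    then have pT: "p \<in> topspace T" using B_subset[OF l] by blast
    define q where "q = act (val (letter_inv l)) p"
    have "q \<in> F"
      using p act_in_B[of "letter_inv l" p] act_notin_U[of "letter_inv l" p] ring_in_F[of "letter_inv l" q] l pT
      by (simp add: q_def)
    moreover have "act (val l) q = p" using act_inv'[OF val_closed[OF l] pT] by (simp add: q_def val_inv l)
    ultimately have "p \<in> act (val l) ` K" using K(3) by blast
    moreover have "p \<in> F" using ring_in_F[OF l] p by blast
    ultimately have "connectedin T (act (val l) ` K \<union> F)"
      using connectedin_continuous_map_image[OF act_continuous[OF val_closed[OF l]] K(1)] F
      by (intro connectedin_Un) auto
    moreover have "act (val l) ` K \<subseteq> E"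
    proof -
      have "val l \<in> \<Gamma>" using ev_in_\<Gamma>[of "[l]"] l by (simp add: eval_word_Cons val_closed Cons_in_reduced_words)
      then show ?thesis using act_E_subset K(2) by blast
    qed
    moreover have "act (ev (l # w)) ` F \<subseteq> act (val l) ` K"
      using act_image_mult[OF val_closed[OF l] ev_closed[OF w] F_subset] K(4) by (auto simp: eval_word_Cons)
    ultimately show ?case using F_subset_E by (intro exI[of _ "act (val l) ` K \<union> F"]) auto
  qed
  then obtain K where K: "\<And>w. w \<in> reduced_words S \<Longrightarrow>
      connectedin T (K w) \<and> K w \<subseteq> E \<and> F \<subseteq> K w \<and> act (ev w) ` F \<subseteq> K w" by metis
  have "E = \<Union>(K ` reduced_words S)"
  proof
    have "act g ` F \<subseteq> \<Union>(K ` reduced_words S)" if g: "g \<in> \<Gamma>" for g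
    proof -
      obtain w where "w \<in> reduced_words S" "g = ev w" using g by (rule \<Gamma>_obtain_word)
      then show ?thesis using K[of w] by blast
    qed
    then show "E \<subseteq> \<Union>(K ` reduced_words S)" unfolding E_def by (rule UN_least)
    show "\<Union>(K ` reduced_words S) \<subseteq> E" using K by (intro UN_least) blast
  qed
  moreover have "connectedin T (\<Union>(K ` reduced_words S))"
    using K F_nonempty by (intro connectedin_Union) (auto, blast)
  ultimately show ?thesis by simp
qed

text \<open>Freeness makes the map injective, so properness reduces to closedness. The image of a
  closed set is a union of closed pieces of graphs of group elements, and this union is locally
  finite.\<close>

lemma proper_action:
  "proper_map (prod_topology (discrete_topology \<Gamma>) (subtopology T E))
     (prod_topology (subtopology T E) (subtopology T E)) (\<lambda>(g, x). (x, act g x))"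
  (is "proper_map ?X ?Y ?f")
proof (rule closed_injective_imp_proper_map)
  have topE: "topspace (subtopology T E) = E" using E_subset by (simp add: inf_absorb2)
  show "inj_on ?f (topspace ?X)"
  proof (rule inj_onI, clarsimp simp: topE)
    fix g h x assume gh: "g \<in> \<Gamma>" "h \<in> \<Gamma>" and x: "x \<in> E" and eq: "act g x = act h x"
    have c: "g \<in> carrier G" "h \<in> carrier G" "x \<in> topspace T" using gh x E_subset generate_closed_carrier by auto
    have "act (inv h \<otimes> g) x = x" using c eq act_inv[OF c(2,3)] by (simp add: act_mult)
    moreover have "inv h \<otimes> g \<in> \<Gamma>"
      using gh subgroup.m_closed[OF \<Gamma>_subgroup] subgroup.m_inv_closed[OF \<Gamma>_subgroup] by blast
    ultimately have "inv h \<otimes> g = \<one>" using free_action x by blast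
    then have "h \<otimes> (inv h \<otimes> g) = h" using c by simp
    then show "g = h" using c by (simp flip: m_assoc)
  qed
  show "closed_map ?X ?Y ?f"
    unfolding closed_map_def
  proof (intro allI impI)
    fix C assume C: "closedin ?X C"
    \<comment> \<open>The part of the graph of \<open>g\<close> lying over the slice of
      \<open>C\<close> at \<open>g\<close>. It is closed because graphs of continuous maps into a
      Hausdorff space are.\<close>
    define D where "D g = {z \<in> topspace ?Y. (g, fst z) \<in> C} \<inter> {z \<in> topspace ?Y. snd z = (act g \<circ> fst) z}" for g
    have "?f ` C = \<Union>(D ` \<Gamma>)"
    proof (intro equalityI subsetI)
      fix z assume "z \<in> ?f ` C"
      then obtain g x where gx: "(g, x) \<in> C" "z = (x, act g x)" by auto
      then have "g \<in> \<Gamma>" "x \<in> E" using closedin_subset[OF C] topE by auto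
      then show "z \<in> \<Union>(D ` \<Gamma>)" using gx act_E_subset topE by (auto simp: D_def)
    next
      fix z assume "z \<in> \<Union>(D ` \<Gamma>)"
      then obtain g where "(g, fst z) \<in> C" "snd z = act g (fst z)" by (auto simp: D_def)
      then show "z \<in> ?f ` C" by (intro image_eqI[of _ _ "(g, fst z)"]) (auto simp: prod_eq_iff)
    qed
    moreover have "closedin ?Y (\<Union>(D ` \<Gamma>))"
    proof (rule closedin_locally_finite_Union)
      fix A assume "A \<in> D ` \<Gamma>"
      then obtain g where g: "g \<in> \<Gamma>" "A = D g" by blast
      have "continuous_map ?Y ?X (\<lambda>z. (g, fst z))"
        using g by (intro continuous_map_pairedI continuous_map_fst) simp
      then have "closedin ?Y {z \<in> topspace ?Y. (g, fst z) \<in> C}"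
        using C by (rule closedin_continuous_map_preimage)
      moreover have "continuous_map (subtopology T E) (subtopology T E) (act g)"
        using g act_continuous generate_closed_carrier act_E_subset[OF g(1)] topE
        by (intro continuous_map_into_subtopology continuous_map_from_subtopology) auto
      then have "closedin ?Y {z \<in> topspace ?Y. snd z = (act g \<circ> fst) z}"
        by (rule closedin_continuous_maps_eq[OF Hausdorff_space_subtopology[OF Hausdorff]
            continuous_map_snd continuous_map_compose[OF continuous_map_fst]])
      ultimately show "closedin ?Y A" unfolding g(2) D_def by (rule closedin_Int)
    next
      show "locally_finite_in ?Y (D ` \<Gamma>)"
        unfolding locally_finite_in_def
      proof (intro conjI ballI)
        show "\<Union>(D ` \<Gamma>) \<subseteq> topspace ?Y" by (auto simp: D_def)
        fix z assume "z \<in> topspace ?Y"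
        then obtain x y where z: "z = (x, y)" "x \<in> E" "y \<in> E" using topE by auto
        obtain a where a: "a \<in> \<Gamma>" "x \<in> act a ` V" using z E_eq_V by auto
        obtain b where b: "b \<in> \<Gamma>" "y \<in> act b ` V" using z E_eq_V by auto
        have op: "openin (subtopology T E) (act h ` V)" if "h \<in> \<Gamma>" for h
        proof -
          have "h \<in> carrier G" using that generate_closed_carrier by blast
          moreover have "act h ` V \<subseteq> E" using that unfolding E_eq_V by (rule UN_upper)
          ultimately show ?thesis
            using openin_act_image[OF _ openin_V] openin_open_subtopology[OF openin_E] by blast
        qed
        show "\<exists>W. openin ?Y W \<and> z \<in> W \<and> finite {A \<in> D ` \<Gamma>. A \<inter> W \<noteq> {}}"
        proof (intro exI conjI)
          show "openin ?Y (act a ` V \<times> act b ` V)" using op a b by (simp add: openin_prod_Times_iff)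
          show "z \<in> act a ` V \<times> act b ` V" using a b z by simp
          \<comment> \<open>If the graph of \<open>g\<close> meets a product of two translates of
            \<open>V\<close>, then \<open>g\<close> moves the first translate so that it meets the
            second, which only finitely many \<open>g\<close> do.\<close>
          have "{A \<in> D ` \<Gamma>. A \<inter> act a ` V \<times> act b ` V \<noteq> {}} \<subseteq> D ` {g \<in> \<Gamma>. act g ` act a ` V \<inter> act b ` V \<noteq> {}}"
          proof
            fix A assume "A \<in> {A \<in> D ` \<Gamma>. A \<inter> act a ` V \<times> act b ` V \<noteq> {}}"
            then obtain g p q where g: "g \<in> \<Gamma>" "A = D g"
              and pq: "(act a p, act b q) \<in> D g" "p \<in> V" "q \<in> V" by blast
            then have "act b q = act g (act a p)" by (simp add: D_def)
            then have "act g ` act a ` V \<inter> act b ` V \<noteq> {}" using pq(2,3) by (metis IntI empty_iff imageI)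
            then show "A \<in> D ` {g \<in> \<Gamma>. act g ` act a ` V \<inter> act b ` V \<noteq> {}}" using g by blast
          qed
          then show "finite {A \<in> D ` \<Gamma>. A \<inter> act a ` V \<times> act b ` V \<noteq> {}}"
            using finite_meeting_translates[OF a(1) b(1)] by (meson finite_imageI finite_subset)
        qed
      qed
    qed
    ultimately show "closedin ?Y (?f ` C)" by simp
  qed
qed

end

section \<open>The projective linear group\<close>

lemma mat_scalar_commute: "Finite_Cartesian_Product.mat c ** A = A ** Finite_Cartesian_Product.mat c"
  for A :: "'k::field ^ 2 ^ 2"
  by (simp add: vec_eq_iff matrix_matrix_mult_def sum_2 forall_2 Finite_Cartesian_Product.mat_def mult.commute)

lemma mat_scalar_mult:
  "Finite_Cartesian_Product.mat c ** Finite_Cartesian_Product.mat d = (Finite_Cartesian_Product.mat (c * d) :: 'k::field ^ 2 ^ 2)"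
  by (simp add: vec_eq_iff matrix_matrix_mult_def sum_2 forall_2 Finite_Cartesian_Product.mat_def)

lemma GL2_simps [simp]:
  "carrier GL2 = {A. invertible A}" "A \<otimes>\<^bsub>GL2\<^esub> B = A ** B" "\<one>\<^bsub>GL2\<^esub> = Finite_Cartesian_Product.mat 1"
  by (simp_all add: GL2_def)

lemma invertible_mat_1: "invertible (Finite_Cartesian_Product.mat 1 :: 'k::field ^ 2 ^ 2)"
  by (simp add: invertible_det_nz)

lemma group_GL2: "Group.group (GL2 :: ('k::field ^ 2 ^ 2) monoid)"
proof (rule groupI)
  fix A :: "'k ^ 2 ^ 2" assume "A \<in> carrier GL2"
  then show "\<exists>B\<in>carrier GL2. B \<otimes>\<^bsub>GL2\<^esub> A = \<one>\<^bsub>GL2\<^esub>"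
    using invertible_obtain_inverse[of A] by auto
qed (auto simp: invertible_mult invertible_mat_1 matrix_mul_assoc)

lemma invertible_scalar: "c \<noteq> 0 \<Longrightarrow> invertible (Finite_Cartesian_Product.mat c :: 'k::field ^ 2 ^ 2)"
  by (simp add: invertible_det_nz det_2 Finite_Cartesian_Product.mat_def)

lemma scalars2_normal: "scalars2 \<lhd> (GL2 :: ('k::field ^ 2 ^ 2) monoid)"
proof -
  interpret group "GL2 :: ('k ^ 2 ^ 2) monoid" by (rule group_GL2)
  have inv: "inv\<^bsub>GL2\<^esub> Finite_Cartesian_Product.mat c = (Finite_Cartesian_Product.mat (inverse c) :: 'k ^ 2 ^ 2)"
    if "c \<noteq> 0" for c
    using that by (intro inv_equality) (auto simp: mat_scalar_mult invertible_scalar)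
  have "subgroup scalars2 (GL2 :: ('k ^ 2 ^ 2) monoid)"
  proof
    show "scalars2 \<subseteq> carrier (GL2 :: ('k ^ 2 ^ 2) monoid)"
      by (auto simp: scalars2_def invertible_scalar)
    show "\<one>\<^bsub>GL2\<^esub> \<in> (scalars2 :: ('k ^ 2 ^ 2) set)" unfolding GL2_simps scalars2_def using one_neq_zero by blast
    show "A \<otimes>\<^bsub>GL2\<^esub> B \<in> scalars2" if "A \<in> scalars2" "B \<in> scalars2" for A B :: "'k ^ 2 ^ 2"
    proof -
      obtain c d where "c \<noteq> 0" "d \<noteq> 0" "A = Finite_Cartesian_Product.mat c" "B = Finite_Cartesian_Product.mat d"
        using \<open>A \<in> scalars2\<close> \<open>B \<in> scalars2\<close> by (auto simp: scalars2_def)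
      then show ?thesis unfolding scalars2_def
        by (intro CollectI exI[of _ "c * d"]) (simp add: mat_scalar_mult)
    qed
    show "inv\<^bsub>GL2\<^esub> A \<in> scalars2" if "A \<in> scalars2" for A :: "'k ^ 2 ^ 2"
    proof -
      obtain c where "c \<noteq> 0" "A = Finite_Cartesian_Product.mat c"
        using \<open>A \<in> scalars2\<close> by (auto simp: scalars2_def)
      then show ?thesis unfolding scalars2_def
        by (intro CollectI exI[of _ "inverse c"]) (simp add: inv)
    qed
  qed
  moreover have "A ** C ** inv\<^bsub>GL2\<^esub> A \<in> scalars2" if A: "invertible A" and C: "C \<in> scalars2" for A C :: "'k ^ 2 ^ 2"
  proof -
    obtain c where "C = Finite_Cartesian_Product.mat c" using C by (auto simp: scalars2_def)
    then have "A ** C = C ** A" by (simp add: mat_scalar_commute)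
    moreover have "A ** inv\<^bsub>GL2\<^esub> A = Finite_Cartesian_Product.mat 1" using r_inv[of A] A by simp
    ultimately have "A ** C ** inv\<^bsub>GL2\<^esub> A = C" by (simp flip: matrix_mul_assoc)
    then show ?thesis using C by simp
  qed
  ultimately show ?thesis by (simp add: normal_inv_iff)
qed

lemma group_PGL2: "Group.group (PGL2 :: ('k::field ^ 2 ^ 2) set monoid)"
  unfolding PGL2_def using normal.factorgroup_is_group[OF scalars2_normal] .

definition pgl :: "'k::field ^ 2 ^ 2 \<Rightarrow> ('k ^ 2 ^ 2) set" where
  "pgl A = scalars2 #>\<^bsub>GL2\<^esub> A"

lemma carrier_PGL2: "carrier PGL2 = pgl ` {A. invertible A}"
  by (auto simp: PGL2_def FactGroup_def RCOSETS_def pgl_def)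

lemma pgl_in_carrier: "invertible A \<Longrightarrow> pgl A \<in> carrier PGL2"
  by (simp add: carrier_PGL2)

lemma pgl_mult: "invertible A \<Longrightarrow> invertible B \<Longrightarrow> pgl A \<otimes>\<^bsub>PGL2\<^esub> pgl B = pgl (A ** B)"
  using normal.rcos_sum[OF scalars2_normal, of A B] by (simp add: PGL2_def FactGroup_def pgl_def)

lemma pgl_one: "pgl (Finite_Cartesian_Product.mat 1 :: 'k::field ^ 2 ^ 2) = \<one>\<^bsub>PGL2\<^esub>"
proof -
  have "scalars2 \<subseteq> carrier (GL2 :: ('k ^ 2 ^ 2) monoid)"
    using normal_imp_subgroup[OF scalars2_normal] subgroup.subset by blast
  then show "pgl (Finite_Cartesian_Product.mat 1 :: 'k ^ 2 ^ 2) = \<one>\<^bsub>PGL2\<^esub>"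
    using group.coset_mult_one[OF group_GL2, of scalars2] by (simp add: PGL2_def FactGroup_def pgl_def)
qed

lemma mem_pgl: "A \<in> pgl A"
proof -
  have "Finite_Cartesian_Product.mat 1 \<otimes>\<^bsub>GL2\<^esub> A \<in> pgl A"
    unfolding pgl_def r_coset_def scalars2_def using one_neq_zero by blast
  then show ?thesis by simp
qed

lemma pgl_inv:
  assumes "invertible A" "invertible B" "A ** B = Finite_Cartesian_Product.mat 1"
  shows "inv\<^bsub>PGL2\<^esub> pgl A = pgl B"
proof -
  have "B ** A = Finite_Cartesian_Product.mat 1" using assms(3) matrix_left_right_inverse by blast
  then show ?thesis
    using assms by (intro group.inv_equality[OF group_PGL2]) (simp_all add: pgl_mult pgl_one pgl_in_carrier)
qed

context nonarch_field
begin

lemma pgl_act_eq: "p \<in> P1 av \<Longrightarrow> pgl_act av (pgl A) p = moebius av A p"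
  unfolding pgl_def by (rule pgl_act_rcoset[OF av])

lemma pgl_act_image: "D \<subseteq> P1 av \<Longrightarrow> pgl_act av (pgl A) ` D = moebius av A ` D"
  by (intro image_cong) (auto simp: pgl_act_eq)

lemma is_open_discD:
  assumes "is_open_disc av U"
  shows "\<exists>A a r. invertible A \<and> 0 < r \<and> U = moebius av A ` open_disc_A1 av a r"
  using assms unfolding is_open_disc_def carrier_PGL2 by (auto simp: pgl_act_image open_disc_subset_P1)

lemma is_closed_discD:
  assumes "is_closed_disc av U"
  shows "\<exists>A a r. invertible A \<and> 0 < r \<and> U = moebius av A ` closed_disc_A1 av a r"
  using assms unfolding is_closed_disc_def carrier_PGL2 by (auto simp: pgl_act_image closed_disc_subset_P1)

lemma is_closed_disc_closedin: "is_closed_disc av C \<Longrightarrow> closedin (P1_top av) C"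
  using is_closed_discD closedin_moebius_image closedin_closed_disc by blast

text \<open>Applied to a closed disc of the figure and its open disc: in suitable coordinates both
  are compared with the standard discs of one radius around 0, where the ring contains the Gauss
  point and contraction can be tested.\<close>

lemma disc_pair_coordinates:
  assumes C: "is_closed_disc av C" and U: "is_open_disc av U" and sub: "U \<subseteq> C"
  obtains h r where "invertible h" "0 < r" "C = moebius av h ` closed_disc_A1 av 0 r"
    "U \<subseteq> moebius av h ` open_disc_A1 av 0 r"
proof -
  obtain H c r where H: "invertible H" "0 < r" "C = moebius av H ` closed_disc_A1 av c r"
    using is_closed_discD[OF C] by blast
  obtain A a s where A: "invertible A" "0 < s" "U = moebius av A ` open_disc_A1 av a s"
    using is_open_discD[OF U] by blast
  have "moebius av A ` open_disc_A1 av a s \<subseteq> moebius av H ` closed_disc_A1 av c r" using sub A H by simp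
  then obtain h where "invertible h" "moebius av H ` closed_disc_A1 av c r = moebius av h ` closed_disc_A1 av 0 r"
    "moebius av A ` open_disc_A1 av a s \<subseteq> moebius av h ` open_disc_A1 av 0 r"
    by (rule normalize_disc_pair[OF A(1) H(2) H(1) A(2)])
  then show ?thesis using that[of h r] H A by simp
qed

lemma pgl_act_one: "p \<in> P1 av \<Longrightarrow> pgl_act av \<one>\<^bsub>PGL2\<^esub> p = p"
  by (simp add: pgl_act_eq moebius_one flip: pgl_one)

lemma pgl_act_mult:
  assumes "C \<in> carrier PGL2" "D \<in> carrier PGL2" "p \<in> P1 av"
  shows "pgl_act av (C \<otimes>\<^bsub>PGL2\<^esub> D) p = pgl_act av C (pgl_act av D p)"
  using assms by (auto simp: carrier_PGL2 pgl_mult pgl_act_eq moebius_mult moebius_in_P1)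

lemma pgl_act_continuous:
  assumes "C \<in> carrier PGL2"
  shows "continuous_map (P1_top av) (P1_top av) (pgl_act av C)"
proof -
  obtain A where A: "invertible A" "C = pgl A" using assms by (auto simp: carrier_PGL2)
  show ?thesis
    by (rule continuous_map_eq[OF continuous_map_moebius[OF A(1)]]) (simp add: A(2) pgl_act_eq topspace_P1_top)
qed

text \<open>The trace and determinant of a representative of \<open>g\<close> are those of its
  conjugate by a representative of \<open>h\<close>, so the inequality found on the contracted disc
  passes to the conjugate.\<close>

lemma conjugate_contracting_loxodromic:
  assumes ext: "extends_to_closure av ava" and h: "h \<in> carrier PGL2" and g: "g \<in> carrier PGL2"
    and C: "is_closed_disc av C" and U: "is_open_disc av U" "U \<subseteq> C" and sub: "pgl_act av g ` C \<subseteq> U"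
  shows "loxodromic ava (h \<otimes>\<^bsub>PGL2\<^esub> g \<otimes>\<^bsub>PGL2\<^esub> inv\<^bsub>PGL2\<^esub> h)"
proof -
  obtain A where A: "invertible A" "g = pgl A" using g by (auto simp: carrier_PGL2)
  obtain H where H: "invertible H" "h = pgl H" using h by (auto simp: carrier_PGL2)
  obtain K where K: "invertible K" "H ** K = Finite_Cartesian_Product.mat 1" "K ** H = Finite_Cartesian_Product.mat 1"
    using invertible_obtain_inverse[OF H(1)] .
  obtain k r where k: "invertible k" "0 < r" "C = moebius av k ` closed_disc_A1 av 0 r"
    "U \<subseteq> moebius av k ` open_disc_A1 av 0 r"
    using disc_pair_coordinates[OF C U] .
  have "C \<subseteq> P1 av" using k(3) closed_disc_subset_P1 moebius_in_P1 by blast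
  then have "moebius av A ` moebius av k ` closed_disc_A1 av 0 r \<subseteq> U"
    using sub by (simp add: A(2) pgl_act_image k(3))
  then have "av (det A) < (av (trace A))\<^sup>2"
    by (rule contracting_disc_trace_det[OF A(1) k(1,2,4)])
  then have "loxodromic_matrix ava (H ** (A ** K))"
    using conjugate_trace_det[OF K(3), of A] by (intro loxodromic_matrix_of_trace_det[OF ext]) simp
  moreover have "h \<otimes>\<^bsub>PGL2\<^esub> g \<otimes>\<^bsub>PGL2\<^esub> inv\<^bsub>PGL2\<^esub> h = pgl (H ** (A ** K))"
    using A H K by (simp add: pgl_inv[OF H(1) K(1,2)] pgl_mult invertible_mult matrix_mul_assoc)
  ultimately show ?thesis unfolding loxodromic_def using mem_pgl by metis
qed

end

theorem proposition3p24:
  fixes av :: "'k::field \<Rightarrow> real"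
    and ava :: "'k alg_closure \<Rightarrow> real"
    and g :: nat
    and \<gamma> :: "nat \<Rightarrow> ('k ^ 2 ^ 2) set"
    and \<Gamma> :: "('k ^ 2 ^ 2) set set"
  assumes "complete_nonarch_abs av"
    and "extends_to_closure av ava"
    and "g \<ge> 1"
    and "\<gamma> ` {1..g} \<subseteq> carrier PGL2"
    and "\<Gamma> = generate PGL2 (\<gamma> ` {1..g})"
    and "\<exists>B. schottky_figure av g \<gamma> B"
  shows "schottky_group av ava \<Gamma>"
proof -
  interpret nonarch_field av
    using assms(1) by unfold_locales (simp add: complete_nonarch_abs_def)
  interpret PGL2: group "PGL2 :: ('k ^ 2 ^ 2) set monoid" by (rule group_PGL2)
  obtain B0 where fig: "schottky_figure av g \<gamma> B0" using assms(6) by blast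
  define S where "S = \<gamma> ` {1..g}"
  \<comment> \<open>The free basis will be the set of generators, whose letters carry no index, so
    each generator is assigned one index of the figure.\<close>
  define idx where "idx s = (SOME i. i \<in> {1..g} \<and> \<gamma> i = s)" for s
  define sg :: "bool \<Rightarrow> int" where "sg e = (if e then 1 else - 1)" for e
  define B where "B l = B0 (idx (fst l)) (sg (snd l))" for l
  define U where "U l = figure_open_disc av \<gamma> B0 (idx (fst l)) (sg (snd l))" for l
  have idx: "idx s \<in> {1..g} \<and> \<gamma> (idx s) = s" if "s \<in> S" for s
    unfolding idx_def by (rule someI_ex) (use that in \<open>auto simp: S_def\<close>)
  have sg: "sg e \<in> {1, - 1}" "- sg e = sg (\<not> e)" for e by (auto simp: sg_def)
  have closed: "is_closed_disc av (B l)" and maximal: "is_maximal_open_disc_in av (U l) (B l)"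
    if "fst l \<in> S" for l
    using fig idx[OF that] sg(1)[of "snd l"] unfolding schottky_figure_def B_def U_def by blast+
  have U_sub: "U l \<subseteq> B l" and U_open: "is_open_disc av (U l)" if "fst l \<in> S" for l
    using maximal[OF that] by (simp_all add: is_maximal_open_disc_in_def)
  have disj: "B l \<inter> B m = {}" if l: "fst l \<in> S" and m: "fst m \<in> S" and "l \<noteq> m" for l m
  proof -
    let ?i = "(idx (fst l), sg (snd l))" and ?j = "(idx (fst m), sg (snd m))"
    have "?i \<noteq> ?j"
    proof
      assume "?i = ?j"
      then have "idx (fst l) = idx (fst m)" "snd l = snd m" by (auto simp: sg_def split: if_splits)
      then have "fst l = fst m" using idx[OF l] idx[OF m] by metis
      then show False using \<open>l \<noteq> m\<close> \<open>snd l = snd m\<close> by (simp add: prod_eq_iff)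
    qed
    moreover have "?i \<in> {1..g} \<times> {1, - 1}" "?j \<in> {1..g} \<times> {1, - 1}" using idx[OF l] idx[OF m] sg by auto
    moreover have "disjoint_family_on (\<lambda>(i, \<epsilon>). B0 i \<epsilon>) ({1..g} \<times> {1, - 1})"
      using fig by (simp add: schottky_figure_def)
    ultimately have "(\<lambda>(i, \<epsilon>). B0 i \<epsilon>) ?i \<inter> (\<lambda>(i, \<epsilon>). B0 i \<epsilon>) ?j = {}"
      by (intro disjoint_family_onD)
    then show ?thesis by (simp add: B_def)
  qed
  have SC: "S \<subseteq> carrier PGL2" using assms(4) by (simp add: S_def)
  have U_eq: "pgl_act av (letter_value PGL2 l) ` (topspace (P1_top av) - B (letter_inv l)) = U l" if l: "fst l \<in> S" for l
  proof -
    have "letter_value PGL2 l = \<gamma> (idx (fst l)) [^]\<^bsub>PGL2\<^esub> sg (snd l)"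
      using idx[OF l] SC l by (auto simp: letter_value_def sg_def PGL2.int_pow_neg PGL2.int_pow_1)
    then show ?thesis by (simp add: U_def figure_open_disc_def B_def letter_inv_def sg(2) topspace_P1_top)
  qed
  have conn: "connectedin (P1_top av) (topspace (P1_top av) - (\<Union>l\<in>S \<times> UNIV. U l))"
    unfolding topspace_P1_top
  proof (rule connectedin_Diff_open_discs)
    show "\<exists>A a r. invertible A \<and> 0 < r \<and> V = moebius av A ` open_disc_A1 av a r" if V: "V \<in> U ` (S \<times> UNIV)" for V
    proof -
      obtain l where "fst l \<in> S" "V = U l" using V by auto
      then show ?thesis using is_open_discD[OF U_open] by blast
    qed
    \<comment> \<open>Distinct open discs come from distinct letters and lie in disjoint closed
      discs.\<close>
    have "U l \<inter> U m = {}" if "fst l \<in> S" "fst m \<in> S" "U l \<noteq> U m" for l m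
    proof -
      have "l \<noteq> m" using that(3) by auto
      then show ?thesis using disj[OF that(1,2)] U_sub[OF that(1)] U_sub[OF that(2)] by blast
    qed
    then show "disjoint (U ` (S \<times> UNIV))" by (auto simp: disjoint_def)
    show "U ` (S \<times> UNIV) \<noteq> {}" using assms(3) by (auto simp: S_def)
  qed
  have ring: "B l - U l \<noteq> {}" if l: "fst l \<in> S" for l
  proof -
    obtain h r where "invertible h" "0 < r" "B l = moebius av h ` closed_disc_A1 av 0 r"
      "U l \<subseteq> moebius av h ` open_disc_A1 av 0 r"
      using disc_pair_coordinates[OF closed[OF l] U_open[OF l] U_sub[OF l]] .
    then show ?thesis using closed_disc_minus_open_disc_nonempty by simp
  qed
  interpret ping_pong "PGL2 :: ('k ^ 2 ^ 2) set monoid" S "P1_top av" "pgl_act av" B U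
  proof
    show "finite S" "S \<noteq> {}" using assms(3) by (auto simp: S_def)
    show "S \<subseteq> carrier PGL2" by (rule SC)
    show "B l - U l \<noteq> {}" if "fst l \<in> S" for l using that by (rule ring)
  qed (simp_all add: topspace_P1_top pgl_act_one pgl_act_mult pgl_act_continuous Hausdorff_P1
        is_closed_disc_closedin closed U_sub U_eq[unfolded topspace_P1_top] disj conn[unfolded topspace_P1_top])
  have \<Gamma>: "\<Gamma> = ping_pong.\<Gamma> PGL2 S" unfolding \<Gamma>_def using assms(5) by (simp only: S_def)
  have lox: "loxodromic ava x" if x: "x \<in> \<Gamma>" "x \<noteq> \<one>\<^bsub>PGL2\<^esub>" for x
  proof -
    obtain w where w: "w \<in> reduced_words S" "x = eval_word PGL2 w"
      using x(1) unfolding \<Gamma> by (rule \<Gamma>_obtain_word)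
    then have "w \<noteq> []" using x(2) by auto
    then obtain h y l where "h \<in> carrier PGL2" "y \<in> carrier PGL2" "fst l \<in> S"
        "x = h \<otimes>\<^bsub>PGL2\<^esub> y \<otimes>\<^bsub>PGL2\<^esub> inv\<^bsub>PGL2\<^esub> h" "pgl_act av y ` B l \<subseteq> U l"
      using conjugate_contracting[OF w(1)] w(2) by blast
    then show ?thesis
      using conjugate_contracting_loxodromic[OF assms(2), of h y "B l" "U l"] closed U_open U_sub by simp
  qed
  have fg: "is_finitely_generated (PGL2\<lparr>carrier := \<Gamma>\<rparr>)"
  proof -
    have "S \<subseteq> \<Gamma>" unfolding assms(5) S_def[symmetric] by (auto intro: generate.incl)
    moreover have "generate (PGL2\<lparr>carrier := \<Gamma>\<rparr>) S = \<Gamma>"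
      using PGL2.generate_consistent[OF \<open>S \<subseteq> \<Gamma>\<close>] \<Gamma>_subgroup assms(5) by (simp add: \<Gamma> S_def)
    ultimately show ?thesis unfolding is_finitely_generated_def using S(1) by auto
  qed
  show ?thesis
    unfolding schottky_group_def acts_freely_on_def acts_properly_on_def
  proof (intro conjI exI[of _ E] ballI impI)
    show "E \<noteq> {}" using F_nonempty F_subset_E by blast
  qed (use \<Gamma>_subgroup free_group fg lox openin_E connectedin_E act_E free_action proper_action in \<open>auto simp: \<Gamma>\<close>)
qed

end
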